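(* There is a constant $c > 0$ such that for every prime $p$ with $p \equiv 1 \pmod 4$, the value of the degree 4 sum-of-squares relaxation of the clique number of the Paley graph $G_p$ satisfies $\mathrm{SOS}_4(G_p) \geq c\, p^{1/3}$.
   Context: For a prime $p \equiv 1 \pmod 4$, the Paley graph $G_p$ has vertex set $\mathbb{F}_p$, with distinct $a,b$ adjacent iff $a-b$ is a nonzero square in $\mathbb{F}_p$. For a graph $G$ on vertex set $V$, $\mathrm{SOS}_4(G)$ is the maximum of $\sum_{i\in V}\widetilde{\mathbb{E}}[x_i]$ over all linear functionals $\widetilde{\mathbb{E}}$ on the real polynomials of degree at most $4$ in variables $(x_i)_{i\in V}$ such that: $\widetilde{\mathbb{E}}[1]=1$; $\widetilde{\mathbb{E}}[(x_i^2-x_i)q]=0$ for all $i\in V$ and all polynomials $q$ of degree at most $2$; $\widetilde{\mathbb{E}}[x_ix_jq]=0$ for all distinct non-adjacent $i,j$ and all $q$ of degree at most $2$; and $\widetilde{\mathbb{E}}[q^2]\geq 0$ for all polynomials $q$ of degree at most $2$. *)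

theory Defs
  imports
    "HOL-Analysis.Analysis"
    "HOL-Library.Poly_Mapping"
    "HOL-Number_Theory.Number_Theory"
begin

text \<open>
  Real polynomials in variables indexed by \<open>'v\<close> are finitely supported maps from exponent vectors
  to coefficients; their product is the convolution product of \<^theory>\<open>HOL-Library.Poly_Mapping\<close>.
\<close>

type_synonym 'v mpoly = "('v \<Rightarrow>\<^sub>0 nat) \<Rightarrow>\<^sub>0 real"

definition const_poly :: "real \<Rightarrow> 'v mpoly" where
  "const_poly c = Poly_Mapping.single 0 c"

definition var_poly :: "'v \<Rightarrow> 'v mpoly" where
  "var_poly i = Poly_Mapping.single (Poly_Mapping.single i 1) 1"

definition mon_degree :: "('v \<Rightarrow>\<^sub>0 nat) \<Rightarrow> nat" where
  "mon_degree m = (\<Sum>i\<in>Poly_Mapping.keys m. Poly_Mapping.lookup m i)"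

definition polys_upto :: "'v set \<Rightarrow> nat \<Rightarrow> 'v mpoly set" where
  "polys_upto V d =
     {f. \<forall>m\<in>Poly_Mapping.keys f. Poly_Mapping.keys m \<subseteq> V \<and> mon_degree m \<le> d}"

text \<open>
  Only the values of \<open>E\<close> on \<open>polys_upto V 4\<close> are constrained, and only they matter.
\<close>

definition linear_functional_upto :: "'v set \<Rightarrow> nat \<Rightarrow> ('v mpoly \<Rightarrow> real) \<Rightarrow> bool" where
  "linear_functional_upto V d E \<longleftrightarrow>
     (\<forall>f\<in>polys_upto V d. \<forall>g\<in>polys_upto V d. E (f + g) = E f + E g) \<and>
     (\<forall>c. \<forall>f\<in>polys_upto V d. E (const_poly c * f) = c * E f)"

definition sos4_feasible :: "'v set \<Rightarrow> ('v \<Rightarrow> 'v \<Rightarrow> bool) \<Rightarrow> ('v mpoly \<Rightarrow> real) \<Rightarrow> bool" where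
  "sos4_feasible V adj E \<longleftrightarrow>
     linear_functional_upto V 4 E \<and>
     E 1 = 1 \<and>
     (\<forall>i\<in>V. \<forall>q\<in>polys_upto V 2. E ((var_poly i ^ 2 - var_poly i) * q) = 0) \<and>
     (\<forall>i\<in>V. \<forall>j\<in>V. i \<noteq> j \<and> \<not> adj i j \<longrightarrow>
        (\<forall>q\<in>polys_upto V 2. E (var_poly i * var_poly j * q) = 0)) \<and>
     (\<forall>q\<in>polys_upto V 2. E (q ^ 2) \<ge> 0)"

text \<open>
  The supremum is a maximum whenever \<open>V\<close> is finite: see \<open>SOS4_is_maximum\<close> below.
\<close>

definition SOS4 :: "'v set \<Rightarrow> ('v \<Rightarrow> 'v \<Rightarrow> bool) \<Rightarrow> real" where
  "SOS4 V adj = Sup {\<Sum>i\<in>V. E (var_poly i) | E. sos4_feasible V adj E}"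

text \<open>
  The field of order \<open>p\<close> is represented by the integers \<open>0, \<dots>, p - 1\<close> modulo \<open>p\<close>.
\<close>

definition paley_vertices :: "nat \<Rightarrow> int set" where
  "paley_vertices p = {0..<int p}"

definition paley_adj :: "nat \<Rightarrow> int \<Rightarrow> int \<Rightarrow> bool" where
  "paley_adj p a b \<longleftrightarrow> \<not> [a - b = 0] (mod int p) \<and> QuadRes (int p) (a - b)"


lemma mon_degree_superset:
  assumes "finite A" "Poly_Mapping.keys m \<subseteq> A"
  shows "mon_degree m = (\<Sum>i\<in>A. Poly_Mapping.lookup m i)"
  unfolding mon_degree_def using assms
  by (intro sum.mono_neutral_left) (auto simp: in_keys_iff)

lemma keys_add_nat:
  "Poly_Mapping.keys (a + b) = Poly_Mapping.keys a \<union> Poly_Mapping.keys (b :: 'v \<Rightarrow>\<^sub>0 nat)"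
  by (auto simp: in_keys_iff lookup_add)

lemma mon_degree_add: "mon_degree (a + b) = mon_degree a + mon_degree b"
proof -
  let ?A = "Poly_Mapping.keys a \<union> Poly_Mapping.keys b"
  have "mon_degree (a + b) = (\<Sum>i\<in>?A. Poly_Mapping.lookup (a + b) i)"
    by (rule mon_degree_superset) (auto simp: keys_add_nat)
  also have "\<dots> = (\<Sum>i\<in>?A. Poly_Mapping.lookup a i) + (\<Sum>i\<in>?A. Poly_Mapping.lookup b i)"
    by (simp add: lookup_add sum.distrib)
  also have "\<dots> = mon_degree a + mon_degree b"
    by (simp add: mon_degree_superset[of ?A])
  finally show ?thesis .
qed

lemma mon_degree_0 [simp]: "mon_degree 0 = 0"
  by (simp add: mon_degree_def)

lemma mon_degree_single [simp]: "mon_degree (Poly_Mapping.single i n) = n"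
  by (simp add: mon_degree_def)

lemma polys_upto_add: "f \<in> polys_upto V d \<Longrightarrow> g \<in> polys_upto V d \<Longrightarrow> f + g \<in> polys_upto V d"
  using Poly_Mapping.keys_add[of f g] by (fastforce simp: polys_upto_def)

lemma polys_upto_mult:
  assumes "f \<in> polys_upto V d" "g \<in> polys_upto V e"
  shows "f * g \<in> polys_upto V (d + e)"
proof -
  have "Poly_Mapping.keys m \<subseteq> V \<and> mon_degree m \<le> d + e" if m: "m \<in> Poly_Mapping.keys (f * g)" for m
  proof -
    obtain a b where "m = a + b" "a \<in> Poly_Mapping.keys f" "b \<in> Poly_Mapping.keys g"
      using keys_mult[of f g] m by blast
    then show ?thesis
      using assms by (auto simp: polys_upto_def mon_degree_add keys_add_nat intro!: add_mono)
  qed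
  then show ?thesis by (auto simp: polys_upto_def)
qed

lemma polys_upto_mono: "f \<in> polys_upto V d \<Longrightarrow> d \<le> e \<Longrightarrow> f \<in> polys_upto V e"
  by (fastforce simp: polys_upto_def)

lemma const_poly_upto: "const_poly c \<in> polys_upto V d"
  by (simp add: const_poly_def polys_upto_def)

lemma one_upto: "1 \<in> polys_upto V d"
  by (simp add: polys_upto_def)

lemma zero_upto: "0 \<in> polys_upto V d"
  by (simp add: polys_upto_def)

lemma monomial_upto:
  "Poly_Mapping.keys m \<subseteq> V \<Longrightarrow> mon_degree m \<le> d \<Longrightarrow> Poly_Mapping.single m c \<in> polys_upto V d"
  by (simp add: polys_upto_def)

lemma var_upto: "i \<in> V \<Longrightarrow> 1 \<le> d \<Longrightarrow> var_poly i \<in> polys_upto V d"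
  unfolding var_poly_def by (rule monomial_upto) auto

lemma scale_upto: "f \<in> polys_upto V d \<Longrightarrow> const_poly c * f \<in> polys_upto V d"
  using polys_upto_mult[OF const_poly_upto[of c V 0], of f d] by simp

lemma uminus_upto: "f \<in> polys_upto V d \<Longrightarrow> - f \<in> polys_upto V d"
  by (simp add: polys_upto_def in_keys_iff)

lemma diff_upto: "f \<in> polys_upto V d \<Longrightarrow> g \<in> polys_upto V d \<Longrightarrow> f - g \<in> polys_upto V d"
  using polys_upto_add[of f V d "- g"] uminus_upto[of g V d] by simp

lemma functional_add:
  "linear_functional_upto V d E \<Longrightarrow> f \<in> polys_upto V d \<Longrightarrow> g \<in> polys_upto V d \<Longrightarrow>
     E (f + g) = E f + E g"
  by (simp add: linear_functional_upto_def)

lemma functional_scale: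
  "linear_functional_upto V d E \<Longrightarrow> f \<in> polys_upto V d \<Longrightarrow> E (const_poly c * f) = c * E f"
  by (simp add: linear_functional_upto_def)

lemma functional_diff:
  assumes "linear_functional_upto V d E" "f \<in> polys_upto V d" "g \<in> polys_upto V d"
  shows "E (f - g) = E f - E g"
  using functional_add[OF assms(1) diff_upto[OF assms(2,3)] assms(3)] by simp

lemma functional_0: "linear_functional_upto V d E \<Longrightarrow> E 0 = 0"
  using functional_scale[of V d E 0 0] by (simp add: zero_upto)

lemma poly_as_sum:
  "f = (\<Sum>m\<in>Poly_Mapping.keys f. Poly_Mapping.single m (Poly_Mapping.lookup f m))"
proof (rule poly_mapping_eqI)
  fix k
  show "Poly_Mapping.lookup f k =
    Poly_Mapping.lookup (\<Sum>m\<in>Poly_Mapping.keys f. Poly_Mapping.single m (Poly_Mapping.lookup f m)) k"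
    by (simp add: lookup_sum lookup_single when_def sum.delta' in_keys_iff)
qed

lemma functional_sum:
  assumes E: "linear_functional_upto V d E" and "\<And>x. x \<in> A \<Longrightarrow> g x \<in> polys_upto V d"
  shows "E (sum g A) = (\<Sum>x\<in>A. E (g x))"
proof (cases "finite A")
  case True
  have "B \<subseteq> A \<Longrightarrow> sum g B \<in> polys_upto V d \<and> E (sum g B) = (\<Sum>x\<in>B. E (g x))" if "finite B" for B
    using that
  proof (induction B rule: finite_induct)
    case empty
    then show ?case by (simp add: zero_upto functional_0[OF E])
  next
    case (insert x B)
    then show ?case using assms(2)[of x] by (simp add: functional_add[OF E] polys_upto_add)
  qed
  from this[OF True] show ?thesis by simp
qed (simp add: functional_0[OF E])

lemma mon_split:
  "mon_degree m \<le> a + b \<Longrightarrow> \<exists>u v. m = u + v \<and> mon_degree u \<le> a \<and> mon_degree v \<le> b"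
proof (induction b arbitrary: m)
  case 0
  then show ?case by (intro exI[of _ m] exI[of _ 0]) simp
next
  case (Suc b)
  show ?case
  proof (cases "m = 0")
    case True
    then show ?thesis by (intro exI[of _ 0]) simp
  next
    case False
    then obtain i where i: "Poly_Mapping.lookup m i > 0"
      by (metis gr0I lookup_zero poly_mapping_eqI)
    define n where "n = m - Poly_Mapping.single i 1"
    have m: "m = n + Poly_Mapping.single i 1"
      by (rule poly_mapping_eqI) (use i in \<open>auto simp: n_def lookup_add lookup_minus lookup_single when_def\<close>)
    then have "mon_degree n \<le> a + b"
      using Suc.prems by (simp add: mon_degree_add)
    then obtain u v where uv: "n = u + v" "mon_degree u \<le> a" "mon_degree v \<le> b"
      using Suc.IH by blast
    show ?thesis
      by (intro exI[of _ u] exI[of _ "v + Poly_Mapping.single i 1"])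
         (use uv m in \<open>auto simp: mon_degree_add add.assoc\<close>)
  qed
qed

lemma mon_degree_le_1: "mon_degree m \<le> 1 \<Longrightarrow> m = 0 \<or> (\<exists>i. m = Poly_Mapping.single i 1)"
proof -
  assume le: "mon_degree m \<le> 1"
  show ?thesis
  proof (cases "m = 0")
    case False
    then obtain i where i: "Poly_Mapping.lookup m i > 0"
      by (metis gr0I lookup_zero poly_mapping_eqI)
    define n where "n = m - Poly_Mapping.single i 1"
    have m: "m = n + Poly_Mapping.single i 1"
      by (rule poly_mapping_eqI) (use i in \<open>auto simp: n_def lookup_add lookup_minus lookup_single when_def\<close>)
    then have "mon_degree n = 0"
      using le by (simp add: mon_degree_add)
    then have "n = 0"
      unfolding mon_degree_def by (intro poly_mapping_eqI) (auto simp: in_keys_iff)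
    with m show ?thesis by auto
  qed simp
qed

lemma feasible_mult_bound:
  assumes F: "sos4_feasible V adj E" and u: "u \<in> polys_upto V 2" and v: "v \<in> polys_upto V 2"
  shows "2 * \<bar>E (u * v)\<bar> \<le> E (u ^ 2) + E (v ^ 2)"
proof -
  have L: "linear_functional_upto V 4 E" and P: "\<And>q. q \<in> polys_upto V 2 \<Longrightarrow> E (q ^ 2) \<ge> 0"
    using F by (auto simp: sos4_feasible_def)
  have in4: "a * b \<in> polys_upto V 4" if "a \<in> polys_upto V 2" "b \<in> polys_upto V 2" for a b
    using polys_upto_mult[OF that] by simp
  have sq: "u ^ 2 \<in> polys_upto V 4" "v ^ 2 \<in> polys_upto V 4"
    using in4 u v by (auto simp: power2_eq_square)
  have uv: "u * v \<in> polys_upto V 4" using in4 u v by simp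
  have "(u + v) ^ 2 = u ^ 2 + v ^ 2 + (u * v + u * v)"
    by (simp add: power2_eq_square algebra_simps)
  then have "E ((u + v) ^ 2) = E (u ^ 2) + E (v ^ 2) + (E (u * v) + E (u * v))"
    by (simp only: functional_add[OF L] polys_upto_add sq uv)
  moreover have "(u - v) ^ 2 = u ^ 2 + v ^ 2 - (u * v + u * v)"
    by (simp add: power2_eq_square algebra_simps)
  then have "E ((u - v) ^ 2) = E (u ^ 2) + E (v ^ 2) - (E (u * v) + E (u * v))"
    by (simp only: functional_add[OF L] functional_diff[OF L] polys_upto_add sq uv)
  ultimately show ?thesis
    using P[OF polys_upto_add[OF u v]] P[OF diff_upto[OF u v]] by linarith
qed

lemma feasible_var:
  assumes F: "sos4_feasible V adj E" and i: "i \<in> V"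
  shows "E (var_poly i ^ 2) = E (var_poly i)" "0 \<le> E (var_poly i)" "E (var_poly i) \<le> 1"
proof -
  have L: "linear_functional_upto V 4 E" and P: "\<And>q. q \<in> polys_upto V 2 \<Longrightarrow> E (q ^ 2) \<ge> 0"
    and one: "E 1 = 1" and B: "\<And>q. q \<in> polys_upto V 2 \<Longrightarrow> E ((var_poly i ^ 2 - var_poly i) * q) = 0"
    using F i by (auto simp: sos4_feasible_def)
  have v2: "var_poly i \<in> polys_upto V 2" and v4: "var_poly i \<in> polys_upto V 4"
    using i by (auto intro: var_upto)
  have vv: "var_poly i ^ 2 \<in> polys_upto V 4"
    using polys_upto_mult[OF v2 v2] by (simp add: power2_eq_square)
  show eq: "E (var_poly i ^ 2) = E (var_poly i)"
    using B[OF one_upto] by (simp add: functional_diff[OF L vv v4])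
  show "0 \<le> E (var_poly i)" using P[OF v2] eq by simp
  have "2 * \<bar>E (var_poly i * 1)\<bar> \<le> E (var_poly i ^ 2) + E (1 ^ 2)"
    by (rule feasible_mult_bound[OF F v2 one_upto])
  then show "E (var_poly i) \<le> 1" using eq one by simp
qed

lemma feasible_monomial_square:
  assumes F: "sos4_feasible V adj E" and k: "Poly_Mapping.keys u \<subseteq> V" and d: "mon_degree u \<le> 2"
  shows "E (Poly_Mapping.single u 1 ^ 2) \<le> 1"
proof -
  have L: "linear_functional_upto V 4 E" and one: "E 1 = 1"
    and B: "\<And>i q. i \<in> V \<Longrightarrow> q \<in> polys_upto V 2 \<Longrightarrow> E ((var_poly i ^ 2 - var_poly i) * q) = 0"
    using F by (auto simp: sos4_feasible_def)
  obtain a b where ab: "u = a + b" "mon_degree a \<le> 1" "mon_degree b \<le> 1"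
    using mon_split[of u 1 1] d by auto
  have kab: "Poly_Mapping.keys a \<subseteq> V" "Poly_Mapping.keys b \<subseteq> V"
    using k ab by (auto simp: keys_add_nat)
  have s: "Poly_Mapping.single u 1 = Poly_Mapping.single a 1 * (Poly_Mapping.single b 1 :: 'a mpoly)"
    by (simp add: mult_single ab)
  have A: "Poly_Mapping.single a 1 = (1 :: 'a mpoly) \<or> (\<exists>i\<in>V. Poly_Mapping.single a 1 = var_poly i)"
    using mon_degree_le_1[OF ab(2)] kab by (auto simp: var_poly_def)
  have B': "Poly_Mapping.single b 1 = (1 :: 'a mpoly) \<or> (\<exists>i\<in>V. Poly_Mapping.single b 1 = var_poly i)"
    using mon_degree_le_1[OF ab(3)] kab by (auto simp: var_poly_def)
  have var: "E (var_poly i ^ 2) \<le> 1" if "i \<in> V" for i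
    using feasible_var[OF F that] by simp
  have two: "E ((var_poly i * var_poly j) ^ 2) \<le> 1" if i: "i \<in> V" and j: "j \<in> V" for i j
  proof -
    have vi: "var_poly i \<in> polys_upto V 1" "var_poly i \<in> polys_upto V 2"
      and vj: "var_poly j \<in> polys_upto V 1" "var_poly j \<in> polys_upto V 2"
      using i j by (auto intro: var_upto)
    have ij: "var_poly i * var_poly j \<in> polys_upto V 2" "var_poly j ^ 2 \<in> polys_upto V 2"
      "var_poly i ^ 2 \<in> polys_upto V 2"
      using polys_upto_mult[OF vi(1) vj(1)] polys_upto_mult[OF vj(1) vj(1)] polys_upto_mult[OF vi(1) vi(1)]
      by (auto simp: power2_eq_square numeral_2_eq_2)
    have in4: "x * y \<in> polys_upto V 4" if "x \<in> polys_upto V 2" "y \<in> polys_upto V 2" for x y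
      using polys_upto_mult[OF that] by simp
    have "E (var_poly i ^ 2 * var_poly j ^ 2) - E (var_poly i * var_poly j ^ 2) = 0"
      using B[OF i ij(2)] functional_diff[OF L in4[OF ij(3) ij(2)] in4[OF vi(2) ij(2)]]
      by (simp add: left_diff_distrib)
    moreover have "E (var_poly j ^ 2 * var_poly i) - E (var_poly j * var_poly i) = 0"
      using B[OF j vi(2)] functional_diff[OF L in4[OF ij(2) vi(2)] in4[OF vj(2) vi(2)]]
      by (simp add: left_diff_distrib)
    ultimately have "E ((var_poly i * var_poly j) ^ 2) = E (var_poly i * var_poly j)"
      by (simp add: power_mult_distrib mult.commute)
    then show ?thesis
      using feasible_mult_bound[OF F vi(2) vj(2)] var[OF i] var[OF j] by linarith
  qed
  show ?thesis
    using A B' one var two unfolding s by auto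
qed

lemma feasible_bound:
  assumes F: "sos4_feasible V adj E" and f: "f \<in> polys_upto V 4"
  shows "\<bar>E f\<bar> \<le> (\<Sum>m\<in>Poly_Mapping.keys f. \<bar>Poly_Mapping.lookup f m\<bar>)"
proof -
  have L: "linear_functional_upto V 4 E"
    using F by (auto simp: sos4_feasible_def)
  have k: "Poly_Mapping.keys m \<subseteq> V" "mon_degree m \<le> 4" if "m \<in> Poly_Mapping.keys f" for m
    using f that by (auto simp: polys_upto_def)
  have one: "\<bar>E (Poly_Mapping.single m 1)\<bar> \<le> 1" if m: "m \<in> Poly_Mapping.keys f" for m
  proof -
    obtain u v where uv: "m = u + v" "mon_degree u \<le> 2" "mon_degree v \<le> 2"
      using mon_split[of m 2 2] k(2)[OF m] by auto
    have kuv: "Poly_Mapping.keys u \<subseteq> V" "Poly_Mapping.keys v \<subseteq> V"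
      using k(1)[OF m] uv by (auto simp: keys_add_nat)
    have "2 * \<bar>E (Poly_Mapping.single u 1 * Poly_Mapping.single v 1)\<bar>
        \<le> E (Poly_Mapping.single u 1 ^ 2) + E (Poly_Mapping.single v 1 ^ 2)"
      by (rule feasible_mult_bound[OF F monomial_upto monomial_upto]) (use kuv uv in auto)
    also have "\<dots> \<le> 1 + 1"
      by (intro add_mono feasible_monomial_square[OF F] kuv uv)
    finally show ?thesis by (simp add: mult_single uv)
  qed
  have "E f = (\<Sum>m\<in>Poly_Mapping.keys f. E (Poly_Mapping.single m (Poly_Mapping.lookup f m)))"
    by (subst poly_as_sum, rule functional_sum[OF L]) (use k in \<open>auto intro: monomial_upto\<close>)
  also have "\<dots> = (\<Sum>m\<in>Poly_Mapping.keys f. Poly_Mapping.lookup f m * E (Poly_Mapping.single m 1))"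
  proof (rule sum.cong[OF refl])
    fix m assume "m \<in> Poly_Mapping.keys f"
    then have "Poly_Mapping.single m 1 \<in> polys_upto V 4" using k by (auto intro: monomial_upto)
    from functional_scale[OF L this, of "Poly_Mapping.lookup f m"]
    show "E (Poly_Mapping.single m (Poly_Mapping.lookup f m)) =
      Poly_Mapping.lookup f m * E (Poly_Mapping.single m 1)"
      by (simp add: const_poly_def mult_single)
  qed
  also have "\<bar>\<dots>\<bar> \<le> (\<Sum>m\<in>Poly_Mapping.keys f. \<bar>Poly_Mapping.lookup f m * E (Poly_Mapping.single m 1)\<bar>)"
    by (rule sum_abs)
  also have "\<dots> \<le> (\<Sum>m\<in>Poly_Mapping.keys f. \<bar>Poly_Mapping.lookup f m\<bar>)"
    by (intro sum_mono) (auto simp: abs_mult intro: mult_left_le one)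
  finally show ?thesis .
qed

lemma lookup_mult_0:
  fixes f g :: "'v mpoly"
  shows "Poly_Mapping.lookup (f * g) 0 = Poly_Mapping.lookup f 0 * Poly_Mapping.lookup g 0"
proof -
  have z: "(0 = k + l) = (k = 0 \<and> l = 0)" for k l :: "'v \<Rightarrow>\<^sub>0 nat"
    by (auto simp: poly_mapping_eq_iff fun_eq_iff lookup_add)
  show ?thesis
    by (simp add: lookup_mult z mult_when flip: when_when)
qed

lemma feasible_eval_0: "sos4_feasible V adj (\<lambda>f. Poly_Mapping.lookup f 0)"
proof -
  have v: "Poly_Mapping.lookup (var_poly i) 0 = 0" for i :: 'a
    by (simp add: var_poly_def lookup_single when_def poly_mapping_eq_iff fun_eq_iff)
  show ?thesis
    by (auto simp: sos4_feasible_def linear_functional_upto_def lookup_add lookup_mult_0 const_poly_def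
        lookup_minus v power2_eq_square)
qed

lemma feasible_cong:
  assumes F: "sos4_feasible V adj E" and eq: "\<And>f. f \<in> polys_upto V 4 \<Longrightarrow> E' f = E f"
  shows "sos4_feasible V adj E'"
proof -
  have in4: "x * y \<in> polys_upto V 4" if "x \<in> polys_upto V 2" "y \<in> polys_upto V 2" for x y :: "'a mpoly"
    using polys_upto_mult[OF that] by simp
  have vv: "var_poly i * var_poly j \<in> polys_upto V 2" if "i \<in> V" "j \<in> V" for i j :: 'a
    using polys_upto_mult[OF var_upto[of i V 1] var_upto[of j V 1]] that by (simp add: numeral_2_eq_2)
  have vd: "var_poly i ^ 2 - var_poly i \<in> polys_upto V 2" if "i \<in> V" for i :: 'a
    using vv[OF that that] var_upto[OF that, of 2] by (simp add: power2_eq_square diff_upto)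
  show ?thesis
    using F unfolding sos4_feasible_def linear_functional_upto_def
    by (simp add: eq in4 vv vd one_upto scale_upto polys_upto_add power2_eq_square[of "_ :: 'a mpoly"]
        del: power2_eq_square) (simp add: eq in4 vd flip: power2_eq_square)
qed

lemma SOS4_is_maximum:
  assumes "finite V"
  obtains E where "sos4_feasible V adj E" "(\<Sum>i\<in>V. E (var_poly i)) = SOS4 V adj"
    "\<And>E'. sos4_feasible V adj E' \<Longrightarrow> (\<Sum>i\<in>V. E' (var_poly i)) \<le> SOS4 V adj"
proof -
  define B where "B f = (if f \<in> polys_upto V 4 then
     {- (\<Sum>m\<in>Poly_Mapping.keys f. \<bar>Poly_Mapping.lookup f m\<bar>) ..
      (\<Sum>m\<in>Poly_Mapping.keys f. \<bar>Poly_Mapping.lookup f m\<bar>)} else {0})" for f :: "'a mpoly"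
  define K where "K = PiE UNIV B"
  define S where "S = {E. sos4_feasible V adj E}"
  have "compactin (product_topology (\<lambda>_. euclidean) UNIV) K"
    unfolding K_def by (subst compactin_PiE) (auto simp: B_def)
  then have K: "compact K"
    by (simp add: euclidean_product_topology)
  have ev: "continuous_on UNIV (\<lambda>E :: 'a mpoly \<Rightarrow> real. E f)" for f
    by simp
  have "closed S"
    unfolding S_def sos4_feasible_def linear_functional_upto_def Ball_def
    by (intro closed_Collect_conj closed_Collect_all closed_Collect_imp open_Collect_const
        closed_Collect_eq closed_Collect_le continuous_intros ev)
  then have C: "compact (S \<inter> K)"
    using K compact_Int_closed[of K S] by (simp add: Int_commute)
  have restr: "(\<lambda>f. if f \<in> polys_upto V 4 then E f else 0) \<in> S \<inter> K" if "sos4_feasible V adj E" for E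
    using feasible_cong[OF that, of "\<lambda>f. if f \<in> polys_upto V 4 then E f else 0"]
      feasible_bound[OF that] by (auto simp: S_def K_def B_def abs_le_iff minus_le_iff)
  have "S \<inter> K \<noteq> {}"
    using restr[OF feasible_eval_0] by blast
  then obtain E where E: "E \<in> S \<inter> K"
    and max: "\<And>E'. E' \<in> S \<inter> K \<Longrightarrow> (\<Sum>i\<in>V. E' (var_poly i)) \<le> (\<Sum>i\<in>V. E (var_poly i))"
    using continuous_attains_sup[OF C, of "\<lambda>E. \<Sum>i\<in>V. E (var_poly i)"]
    by (force intro: continuous_intros continuous_on_subset[OF ev])
  have le: "(\<Sum>i\<in>V. E' (var_poly i)) \<le> (\<Sum>i\<in>V. E (var_poly i))" if "sos4_feasible V adj E'" for E'
    using max[OF restr[OF that]] by (simp add: var_upto)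
  have F: "sos4_feasible V adj E" using E by (simp add: S_def)
  have "SOS4 V adj = (\<Sum>i\<in>V. E (var_poly i))"
    unfolding SOS4_def by (rule cSup_eq_maximum) (use F le in auto)
  then show ?thesis using that F le by simp
qed

end

theory Submission
  imports Defs
begin

text \<open>
  The pseudomoments are those of Feige and Krauthgamer: the moment of a set depends only on its size if
  the set is a clique, and vanishes otherwise, with first moment \<open>t\<close> of order \<open>p\<close> to the power \<open>-2/3\<close>.
  Expanding the clique indicators in the quadratic character \<open>chi\<close> writes the moment form at
  \<open>c + \<Sum> a i x i + \<Sum> b i j x i x j\<close> as a positive main part plus forms in products of values
  \<open>chi (i - k)\<close>. All of these except one are bounded by iterating the fact that the matrix
  \<open>chi (i - j)\<close> has norm \<open>sqrt p\<close>.

  The exception is the operator \<open>T\<close> on pairs with kernel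
  \<open>chi ((i - k) (i - l) (j - k) (j - l))\<close>, for which a norm bound of order \<open>p\<close> to the power \<open>5/4\<close>
  suffices. The trace of the fourth power of \<open>T\<close> is a fourth moment of character sums over products of
  four linear factors; embedding these products in the family of all monic quartics bounds it by
  \<open>O(p ^ 6)\<close> without the Weil bound. Since \<open>T\<close> commutes with the affine group, its
  singular values occur with multiplicity about \<open>p\<close> away from the translation-invariant functions,
  which gives the claimed bound there; here multiplicity is replaced by averaging over the group.
  The kernel is a function of the cross ratio, so \<open>T\<close> also commutes with inversion, and
  inversion moves translation-invariant functions almost entirely to the good part.
\<close>

section \<open>Kernels on finite sets\<close>

lemma L2_set_power2: "(L2_set f A)\<^sup>2 = (\<Sum>x\<in>A. (f x)\<^sup>2)"
  by (simp add: L2_set_def sum_nonneg)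

lemma L2_set_mult_self: "L2_set f A * L2_set f A = (\<Sum>x\<in>A. (f x)\<^sup>2)"
  by (simp add: L2_set_power2 flip: power2_eq_square)

lemma L2_set_leI: "(\<Sum>x\<in>A. (f x)\<^sup>2) \<le> c\<^sup>2 \<Longrightarrow> 0 \<le> c \<Longrightarrow> L2_set f A \<le> c"
  unfolding L2_set_def by (rule real_le_lsqrt) (simp_all add: sum_nonneg)

lemma L2_set_abs [simp]: "L2_set (\<lambda>x. \<bar>f x\<bar>) A = L2_set f A"
  by (simp add: L2_set_def)

lemma L2_set_mult_le:
  assumes "\<And>x. x \<in> A \<Longrightarrow> \<bar>g x\<bar> \<le> 1"
  shows "L2_set (\<lambda>x. g x * f x) A \<le> L2_set f A"
proof -
  have "L2_set (\<lambda>x. \<bar>g x * f x\<bar>) A \<le> L2_set (\<lambda>x. \<bar>f x\<bar>) A"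
    using assms by (intro L2_set_mono) (auto simp: abs_mult mult_left_le_one_le)
  then show ?thesis by simp
qed

lemma abs_sum_mult_le_L2_set: "\<bar>\<Sum>x\<in>A. f x * g x\<bar> \<le> L2_set f A * L2_set g A"
  using sum_abs[of "\<lambda>x. f x * g x" A] L2_set_mult_ineq[of f g A] by (simp add: abs_mult)

lemma abs_sum_le_L2_set: "\<bar>\<Sum>x\<in>A. f x\<bar> \<le> sqrt (card A) * L2_set f A"
  using abs_sum_mult_le_L2_set[of "\<lambda>_. 1" f A] by (simp add: L2_set_def)

lemma sum_mult_of_bool_delta:
  fixes f :: "'a \<Rightarrow> 'b::semiring_1"
  assumes "finite A" "a \<in> A"
  shows "(\<Sum>x\<in>A. f x * of_bool (x = a)) = f a" "(\<Sum>x\<in>A. f x * of_bool (a = x)) = f a"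
  using assms by simp_all

lemma sum_power4:
  fixes f :: "'a \<Rightarrow> 'b::comm_semiring_1"
  shows "(\<Sum>x\<in>A. f x) ^ 4 = (\<Sum>(x, y, z, w)\<in>A \<times> A \<times> A \<times> A. f x * f y * f z * f w)"
proof -
  have "(\<Sum>x\<in>A. f x) ^ 4 = (\<Sum>x\<in>A. \<Sum>y\<in>A. \<Sum>z\<in>A. \<Sum>w\<in>A. f x * (f y * (f z * f w)))"
    by (simp add: power4_eq_xxxx mult.assoc flip: sum_distrib_left sum_distrib_right)
  then show ?thesis
    by (simp add: sum.cartesian_product' mult.assoc)
qed

lemma abs_diff_le_1:
  fixes x y :: real
  assumes "0 \<le> x" "x \<le> 1" "0 \<le> y" "y \<le> 1"
  shows "\<bar>x - y\<bar> \<le> 1"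
  using assms by linarith

lemma le_powr_if_power4_le:
  fixes x y c r :: real
  assumes "x ^ 4 \<le> c ^ 4 * r ^ n * y ^ 4" "0 \<le> c" "0 < r" "0 \<le> y"
  shows "x \<le> c * r powr (n / 4) * y"
proof (rule power_le_imp_le_base[where n = 3])
  have "(r powr (n / 4)) ^ 4 = r ^ n"
    using assms(3) by (simp add: powr_power powr_realpow)
  then show "x ^ Suc 3 \<le> (c * r powr (n / 4) * y) ^ Suc 3"
    using assms(1) by (simp add: power_mult_distrib)
qed (use assms in simp)

lemma L2_set_reindex_bij_betw: "bij_betw h A B \<Longrightarrow> L2_set (\<lambda>x. f (h x)) A = L2_set f B"
  unfolding L2_set_def by (simp add: sum.reindex_bij_betw[of h A B "\<lambda>x. (f x)\<^sup>2"])

lemma bij_betw_swap: "bij_betw prod.swap (A \<times> B) (B \<times> A)"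
  by (rule bij_betw_byWitness[where f' = prod.swap]) auto

definition kernel_op :: "('a \<Rightarrow> 'b \<Rightarrow> real) \<Rightarrow> 'b set \<Rightarrow> ('b \<Rightarrow> real) \<Rightarrow> 'a \<Rightarrow> real" where
  "kernel_op K B g x = (\<Sum>y\<in>B. K x y * g y)"

definition kernel_form ::
  "'a set \<Rightarrow> 'b set \<Rightarrow> ('a \<Rightarrow> 'b \<Rightarrow> real) \<Rightarrow> ('a \<Rightarrow> real) \<Rightarrow> ('b \<Rightarrow> real) \<Rightarrow> real" where
  "kernel_form A B K f g = (\<Sum>x\<in>A. \<Sum>y\<in>B. f x * g y * K x y)"

lemma kernel_form_kernel_op: "kernel_form A B K f g = (\<Sum>x\<in>A. f x * kernel_op K B g x)"
  by (simp add: kernel_form_def kernel_op_def sum_distrib_left mult_ac)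

lemma kernel_form_transpose: "kernel_form A B K f g = kernel_form B A (\<lambda>y x. K x y) g f"
  unfolding kernel_form_def by (subst sum.swap) (simp add: mult_ac)

lemma kernel_form_add: "kernel_form A B (\<lambda>x y. K x y + K' x y) f g
  = kernel_form A B K f g + kernel_form A B K' f g"
  and kernel_form_diff: "kernel_form A B (\<lambda>x y. K x y - K' x y) f g
      = kernel_form A B K f g - kernel_form A B K' f g"
  and kernel_form_mult: "kernel_form A B (\<lambda>x y. r * K x y) f g = r * kernel_form A B K f g"
  and kernel_form_divide: "kernel_form A B (\<lambda>x y. K x y / r) f g = kernel_form A B K f g / r"
  by (simp_all add: kernel_form_def ring_distribs sum.distrib sum_subtractf sum_distrib_left
      sum_divide_distrib mult_ac)

lemma kernel_form_add_left: "kernel_form A B K (\<lambda>x. f x + f' x) g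
  = kernel_form A B K f g + kernel_form A B K f' g"
  and kernel_form_add_right: "kernel_form A B K f (\<lambda>y. g y + g' y)
      = kernel_form A B K f g + kernel_form A B K f g'"
  by (simp_all add: kernel_form_def ring_distribs sum.distrib)

lemma kernel_form_1: "kernel_form A B (\<lambda>_ _. 1) f g = (\<Sum>x\<in>A. f x) * (\<Sum>y\<in>B. g y)"
  by (simp add: kernel_form_def sum_product)

lemma kernel_form_cong:
  assumes "\<And>x y. x \<in> A \<Longrightarrow> y \<in> B \<Longrightarrow> f x \<noteq> 0 \<Longrightarrow> g y \<noteq> 0 \<Longrightarrow> K x y = K' x y"
  shows "kernel_form A B K f g = kernel_form A B K' f g"
  unfolding kernel_form_def
proof (intro sum.cong refl)
  fix x y assume "x \<in> A" "y \<in> B"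
  then show "f x * g y * K x y = f x * g y * K' x y"
    using assms by (cases "f x = 0 \<or> g y = 0") auto
qed

lemma kernel_form_diagonal:
  "finite A \<Longrightarrow> kernel_form A A (\<lambda>x y. of_bool (x = y)) f g = (\<Sum>x\<in>A. f x * g x)"
  unfolding kernel_form_def by (intro sum.cong refl) (simp add: sum_mult_of_bool_delta)

lemma abs_kernel_form_diff_le:
  assumes "\<And>x y. x \<in> A \<Longrightarrow> y \<in> B \<Longrightarrow> \<bar>K x y - K' x y\<bar> \<le> E x y"
  shows "\<bar>kernel_form A B K f g - kernel_form A B K' f g\<bar> \<le> kernel_form A B E (\<lambda>x. \<bar>f x\<bar>) (\<lambda>y. \<bar>g y\<bar>)"
proof -
  have "\<bar>kernel_form A B (\<lambda>x y. K x y - K' x y) f g\<bar> \<le> (\<Sum>x\<in>A. \<Sum>y\<in>B. \<bar>f x * g y * (K x y - K' x y)\<bar>)"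
    unfolding kernel_form_def by (intro order_trans[OF sum_abs] sum_mono order_refl)
  also have "\<dots> \<le> kernel_form A B E (\<lambda>x. \<bar>f x\<bar>) (\<lambda>y. \<bar>g y\<bar>)"
    unfolding kernel_form_def abs_mult by (intro sum_mono mult_left_mono assms) auto
  finally show ?thesis by (simp add: kernel_form_diff)
qed

lemma abs_kernel_form_le: "\<bar>kernel_form A B K f g\<bar> \<le> L2_set f A * L2_set (kernel_op K B g) A"
  unfolding kernel_form_kernel_op by (rule abs_sum_mult_le_L2_set)

lemma abs_kernel_form_le_op_bound:
  "L2_set (kernel_op K B g) A \<le> C \<Longrightarrow> \<bar>kernel_form A B K f g\<bar> \<le> L2_set f A * C"
  by (rule order_trans[OF abs_kernel_form_le mult_left_mono]) simp_all

lemma kernel_form_reindex: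
  assumes "bij_betw \<pi> A A" "bij_betw \<sigma> B B"
  shows "kernel_form A B (\<lambda>x y. K (\<pi> x) (\<sigma> y)) (\<lambda>x. f (\<pi> x)) (\<lambda>y. g (\<sigma> y)) = kernel_form A B K f g"
proof -
  have "kernel_form A B (\<lambda>x y. K (\<pi> x) (\<sigma> y)) (\<lambda>x. f (\<pi> x)) (\<lambda>y. g (\<sigma> y))
      = (\<Sum>x\<in>A. \<Sum>y\<in>B. f (\<pi> x) * g y * K (\<pi> x) y)"
    unfolding kernel_form_def
    by (intro sum.cong refl sum.reindex_bij_betw[OF assms(2), of "\<lambda>y. f (\<pi> _) * g y * K (\<pi> _) y"])
  also have "\<dots> = kernel_form A B K f g"
    unfolding kernel_form_def
    by (rule sum.reindex_bij_betw[OF assms(1), of "\<lambda>x. \<Sum>y\<in>B. f x * g y * K x y"])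
  finally show ?thesis .
qed

lemma L2_set_kernel_op_power2:
  "(L2_set (kernel_op K B g) A)\<^sup>2 = kernel_form B B (\<lambda>y y'. \<Sum>x\<in>A. K x y * K x y') g g"
proof -
  have "(L2_set (kernel_op K B g) A)\<^sup>2 = (\<Sum>x\<in>A. \<Sum>y\<in>B. \<Sum>y'\<in>B. g y * g y' * (K x y * K x y'))"
    unfolding L2_set_power2 kernel_op_def unfolding power2_eq_square sum_product
    by (intro sum.cong refl) (simp add: mult_ac)
  also have "\<dots> = (\<Sum>y\<in>B. \<Sum>x\<in>A. \<Sum>y'\<in>B. g y * g y' * (K x y * K x y'))"
    by (rule sum.swap)
  also have "\<dots> = (\<Sum>y\<in>B. \<Sum>y'\<in>B. \<Sum>x\<in>A. g y * g y' * (K x y * K x y'))"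
    by (intro sum.cong refl sum.swap)
  finally show ?thesis by (simp add: kernel_form_def sum_distrib_left)
qed

lemma kernel_form_two_valued:
  assumes "finite A" "\<And>x y. x \<in> A \<Longrightarrow> y \<in> A \<Longrightarrow> K x y = (if x = y then \<alpha> else \<beta>)"
  shows "kernel_form A A K f f = (\<alpha> - \<beta>) * (L2_set f A)\<^sup>2 + \<beta> * (\<Sum>x\<in>A. f x)\<^sup>2"
proof -
  have "kernel_form A A K f f = kernel_form A A (\<lambda>x y. (\<alpha> - \<beta>) * of_bool (x = y) + \<beta> * 1) f f"
    by (rule kernel_form_cong) (simp add: assms(2))
  also have "\<dots> = (\<alpha> - \<beta>) * kernel_form A A (\<lambda>x y. of_bool (x = y)) f f + \<beta> * (\<Sum>x\<in>A. f x)\<^sup>2"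
    by (simp only: kernel_form_add kernel_form_mult kernel_form_1 power2_eq_square)
  finally show ?thesis
    by (simp add: kernel_form_diagonal assms(1) L2_set_power2 power2_eq_square[of "f _"])
qed

lemma L2_set_kernel_op_slices_le:
  assumes op: "\<And>f. L2_set (kernel_op K B f) C \<le> c * L2_set f B" and "0 \<le> c"
  shows "L2_set (\<lambda>(x, z). kernel_op K B (\<lambda>y. b (x, y)) z) (A \<times> C) \<le> c * L2_set b (A \<times> B)"
proof (rule L2_set_leI)
  have "(\<Sum>q\<in>A \<times> C. ((\<lambda>(x, z). kernel_op K B (\<lambda>y. b (x, y)) z) q)\<^sup>2)
      = (\<Sum>x\<in>A. (L2_set (kernel_op K B (\<lambda>y. b (x, y))) C)\<^sup>2)"
    by (simp add: sum.cartesian_product' L2_set_power2)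
  also have "\<dots> \<le> (\<Sum>x\<in>A. (c * L2_set (\<lambda>y. b (x, y)) B)\<^sup>2)"
    by (intro sum_mono power_mono op L2_set_nonneg)
  also have "\<dots> = (c * L2_set b (A \<times> B))\<^sup>2"
    by (simp add: power_mult_distrib L2_set_power2 sum.cartesian_product' sum_distrib_left)
  finally show "(\<Sum>q\<in>A \<times> C. ((\<lambda>(x, z). kernel_op K B (\<lambda>y. b (x, y)) z) q)\<^sup>2)
      \<le> (c * L2_set b (A \<times> B))\<^sup>2" .
qed (simp add: assms)

lemma sum_Gram_swap:
  fixes f :: "'g \<Rightarrow> 'a \<Rightarrow> real"
  shows "(\<Sum>x\<in>A. \<Sum>y\<in>A. (\<Sum>g\<in>G. f g x * f g y)\<^sup>2) = (\<Sum>g\<in>G. \<Sum>h\<in>G. (\<Sum>x\<in>A. f g x * f h x)\<^sup>2)"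
proof -
  have "(\<Sum>x\<in>A. \<Sum>y\<in>A. (\<Sum>g\<in>G. f g x * f g y)\<^sup>2)
      = (\<Sum>(x, y)\<in>A \<times> A. \<Sum>(g, h)\<in>G \<times> G. (f g x * f g y) * (f h x * f h y))"
    by (simp add: power2_eq_square sum_product flip: sum.cartesian_product)
  also have "\<dots> = (\<Sum>(g, h)\<in>G \<times> G. \<Sum>(x, y)\<in>A \<times> A. (f g x * f h x) * (f g y * f h y))"
    by (simp add: case_prod_unfold mult_ac) (rule sum.swap)
  also have "\<dots> = (\<Sum>g\<in>G. \<Sum>h\<in>G. (\<Sum>x\<in>A. f g x * f h x)\<^sup>2)"
    by (simp add: power2_eq_square sum_product flip: sum.cartesian_product)
  finally show ?thesis .
qed

lemma sum_kernel_form_power2_le: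
  "(\<Sum>g\<in>G. kernel_form A A K (f g) (f g))\<^sup>2
    \<le> (\<Sum>g\<in>G. \<Sum>h\<in>G. (\<Sum>x\<in>A. f g x * f h x)\<^sup>2) * (\<Sum>x\<in>A. \<Sum>y\<in>A. (K x y)\<^sup>2)"
proof -
  let ?w = "\<lambda>x y. \<Sum>g\<in>G. f g x * f g y"
  have "(\<Sum>g\<in>G. kernel_form A A K (f g) (f g)) = (\<Sum>x\<in>A. \<Sum>g\<in>G. \<Sum>y\<in>A. f g x * f g y * K x y)"
    unfolding kernel_form_def by (rule sum.swap)
  also have "\<dots> = (\<Sum>x\<in>A. \<Sum>y\<in>A. \<Sum>g\<in>G. f g x * f g y * K x y)"
    by (intro sum.cong refl sum.swap)
  also have "\<dots> = (\<Sum>(x, y)\<in>A \<times> A. ?w x y * K x y)"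
    by (simp only: sum_distrib_right flip: sum.cartesian_product)
  also have "\<dots>\<^sup>2 \<le> (\<Sum>(x, y)\<in>A \<times> A. (?w x y)\<^sup>2) * (\<Sum>(x, y)\<in>A \<times> A. (K x y)\<^sup>2)"
    using Cauchy_Schwarz_ineq_sum[of "\<lambda>(x, y). ?w x y" "\<lambda>(x, y). K x y" "A \<times> A"]
    by (simp add: case_prod_unfold)
  also have "\<dots> = (\<Sum>g\<in>G. \<Sum>h\<in>G. (\<Sum>x\<in>A. f g x * f h x)\<^sup>2) * (\<Sum>x\<in>A. \<Sum>y\<in>A. (K x y)\<^sup>2)"
    unfolding sum.cartesian_product[symmetric] by (subst sum_Gram_swap) (rule refl)
  finally show ?thesis .
qed

text \<open>Many functions that are nearly orthogonal to each other and give the form the same value bound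
  that value better than one function does.\<close>

lemma card_mult_kernel_form_power2_le:
  assumes finite: "finite G" and nonempty: "G \<noteq> {}"
    and form: "\<And>g. g \<in> G \<Longrightarrow> kernel_form A A K (f g) (f g) = r"
    and near_orthogonal: "\<And>g. g \<in> G \<Longrightarrow> (\<Sum>h\<in>G. (\<Sum>x\<in>A. f g x * f h x)\<^sup>2) \<le> M"
  shows "real (card G) * r\<^sup>2 \<le> M * (\<Sum>x\<in>A. \<Sum>y\<in>A. (K x y)\<^sup>2)"
proof -
  have "real (card G) * (real (card G) * r\<^sup>2) = (\<Sum>g\<in>G. kernel_form A A K (f g) (f g))\<^sup>2"
    by (simp add: form power2_eq_square)
  also have "\<dots> \<le> (\<Sum>g\<in>G. \<Sum>h\<in>G. (\<Sum>x\<in>A. f g x * f h x)\<^sup>2) * (\<Sum>x\<in>A. \<Sum>y\<in>A. (K x y)\<^sup>2)"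
    by (rule sum_kernel_form_power2_le)
  also have "\<dots> \<le> (real (card G) * M) * (\<Sum>x\<in>A. \<Sum>y\<in>A. (K x y)\<^sup>2)"
    by (intro mult_right_mono sum_bounded_above near_orthogonal) (auto intro!: sum_nonneg)
  finally show ?thesis
    using finite nonempty by (simp add: mult.assoc card_gt_0_iff)
qed


section \<open>Functions on the residues\<close>

lemmas cong_intros = cong_refl cong_add cong_diff cong_mult cong_uminus cong_pow

locale modulus =
  fixes p :: nat
  assumes p_pos: "0 < p"
begin

abbreviation P :: int where "P \<equiv> int p"

abbreviation F :: "int set" where "F \<equiv> {0..<int p}"

lemma one_le_sqrt_p: "1 \<le> sqrt (real p)"
  using p_pos by simp

lemma sqrt_p_le: "sqrt (real p) \<le> real p"
  using p_pos by (intro real_le_lsqrt) (auto simp: power2_eq_square)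

definition periodic :: "(int \<Rightarrow> 'b) \<Rightarrow> bool" where
  "periodic f \<longleftrightarrow> (\<forall>x y. [x = y] (mod P) \<longrightarrow> f x = f y)"

definition periodic2 :: "(int \<times> int \<Rightarrow> 'b) \<Rightarrow> bool" where
  "periodic2 b \<longleftrightarrow>
    (\<forall>x x' y y'. [x = x'] (mod P) \<longrightarrow> [y = y'] (mod P) \<longrightarrow> b (x, y) = b (x', y'))"

lemma periodicI: "(\<And>x y. [x = y] (mod P) \<Longrightarrow> f x = f y) \<Longrightarrow> periodic f"
  by (simp add: periodic_def)

lemma periodicD: "periodic f \<Longrightarrow> [x = y] (mod P) \<Longrightarrow> f x = f y"
  by (simp add: periodic_def)

lemma periodic2I:
  "(\<And>x x' y y'. [x = x'] (mod P) \<Longrightarrow> [y = y'] (mod P) \<Longrightarrow> b (x, y) = b (x', y')) \<Longrightarrow> periodic2 b"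
  by (simp add: periodic2_def)

lemma periodic2D:
  "periodic2 b \<Longrightarrow> [x = x'] (mod P) \<Longrightarrow> [y = y'] (mod P) \<Longrightarrow> b (x, y) = b (x', y')"
  by (simp add: periodic2_def)

lemma periodic_sum: "(\<And>y. y \<in> A \<Longrightarrow> periodic (\<lambda>x. f x y)) \<Longrightarrow> periodic (\<lambda>x. \<Sum>y\<in>A. f x y)"
  by (auto simp: periodic_def intro!: sum.cong)

lemma eq_if_cong_F: "x \<in> F \<Longrightarrow> y \<in> F \<Longrightarrow> [x = y] (mod P) \<Longrightarrow> x = y"
  using cong_less_imp_eq_int[of x P y] by simp

lemma cong_iff_eq_mod: "x \<in> F \<Longrightarrow> [x = y] (mod P) \<longleftrightarrow> x = y mod P"
  by (simp add: cong_def)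

lemma mod_in_F: "x mod P \<in> F"
  using p_pos by simp

lemma bij_betw_mod_F:
  assumes "\<And>x y. x \<in> F \<Longrightarrow> y \<in> F \<Longrightarrow> [g x = g y] (mod P) \<Longrightarrow> [x = y] (mod P)"
  shows "bij_betw (\<lambda>x. g x mod P) F F"
proof -
  have inj: "inj_on (\<lambda>x. g x mod P) F"
    unfolding cong_def[symmetric] inj_on_def using assms eq_if_cong_F by blast
  moreover have "(\<lambda>x. g x mod P) ` F = F"
    by (rule endo_inj_surj[OF _ _ inj]) (use mod_in_F in auto)
  ultimately show ?thesis
    by (simp add: bij_betw_def)
qed

lemma bij_betw_affine: "coprime u P \<Longrightarrow> bij_betw (\<lambda>x. (u * x + v) mod P) F F"
  by (rule bij_betw_mod_F) (simp add: cong_add_rcancel cong_mult_lcancel)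

lemma sum_affine:
  assumes "periodic f" "coprime u P"
  shows "(\<Sum>x\<in>F. f (u * x + v)) = (\<Sum>x\<in>F. f x)"
proof -
  have "(\<Sum>x\<in>F. f (u * x + v)) = (\<Sum>x\<in>F. f ((u * x + v) mod P))"
    by (intro sum.cong refl periodicD[OF assms(1)]) simp
  also have "\<dots> = (\<Sum>x\<in>F. f x)"
    by (rule sum.reindex_bij_betw[OF bij_betw_affine[OF assms(2)]])
  finally show ?thesis .
qed

lemma sum_shift: "periodic f \<Longrightarrow> (\<Sum>x\<in>F. f (x + v)) = (\<Sum>x\<in>F. f x)"
  using sum_affine[of f 1 v] by simp

lemma sum_reflect: "periodic f \<Longrightarrow> (\<Sum>x\<in>F. f (v - x)) = (\<Sum>x\<in>F. f x)"
  using sum_affine[of f "-1" v] by simp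

lemma sum_pairs_diagonals:
  assumes "periodic2 h"
  shows "(\<Sum>q\<in>F \<times> F. h q) = (\<Sum>d\<in>F. \<Sum>x\<in>F. h (x, x + d))"
proof -
  have "(\<Sum>q\<in>F \<times> F. h q) = (\<Sum>x\<in>F. \<Sum>d\<in>F. h (x, d + x))"
    unfolding sum.cartesian_product'
    by (intro sum.cong refl sum_shift[symmetric] periodicI periodic2D[OF assms]) auto
  also have "\<dots> = (\<Sum>d\<in>F. \<Sum>x\<in>F. h (x, x + d))"
    by (subst sum.swap) (simp add: add.commute)
  finally show ?thesis .
qed


subsection \<open>Additive characters\<close>

definition add_char :: "int \<Rightarrow> complex" where
  "add_char n = cis (2 * pi * (of_int n / of_nat p))"

lemma add_char_add: "add_char (a + b) = add_char a * add_char b"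
  by (simp add: add_char_def cis_mult add_divide_distrib ring_distribs)

lemma add_char_0 [simp]: "add_char 0 = 1"
  by (simp add: add_char_def)

lemma cnj_add_char: "cnj (add_char a) = add_char (- a)"
  by (simp add: add_char_def cis_cnj)

lemma add_char_eq_1_iff: "add_char n = 1 \<longleftrightarrow> P dvd n"
proof
  assume "P dvd n"
  then obtain k where "n = P * k" ..
  then show "add_char n = 1"
    using p_pos by (simp add: add_char_def)
next
  assume "add_char n = 1"
  then obtain k :: int where "2 * pi * (of_int n / of_nat p) = of_int (2 * k) * pi"
    by (auto simp: add_char_def cis_conv_exp exp_eq_1)
  then have "real_of_int n = real_of_int (k * P)"
    using p_pos by (simp add: field_simps)
  then show "P dvd n"
    by (simp only: of_int_eq_iff) simp
qed

lemma add_char_cong: "[a = b] (mod P) \<Longrightarrow> add_char a = add_char b"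
  using add_char_add[of b "a - b"] add_char_eq_1_iff[of "a - b"] by (simp add: cong_iff_dvd_diff)

lemma sum_add_char: "(\<Sum>w\<in>F. add_char (w * k)) = (if P dvd k then of_nat p else 0)"
proof (cases "P dvd k")
  case True
  then have "add_char (w * k) = 1" for w
    by (simp add: add_char_eq_1_iff)
  then show ?thesis
    using True by simp
next
  case False
  have "(\<Sum>w\<in>F. add_char (w * k)) * add_char k = (\<Sum>w\<in>F. add_char ((w + 1) * k))"
    by (simp add: ring_distribs add_char_add sum_distrib_right)
  also have "\<dots> = (\<Sum>w\<in>F. add_char (w * k))"
    by (intro sum_shift[of "\<lambda>w. add_char (w * k)"] periodicI add_char_cong cong_intros)
  finally show ?thesis
    using False by (simp add: add_char_eq_1_iff mult_cancel_left1)
qed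

lemma parseval:
  "(\<Sum>w\<in>F. (cmod (\<Sum>x\<in>F. a x * add_char (w * x)))\<^sup>2) = real p * (\<Sum>x\<in>F. (cmod (a x))\<^sup>2)"
proof -
  have square: "of_real ((cmod (\<Sum>x\<in>F. a x * add_char (w * x)))\<^sup>2)
      = (\<Sum>x\<in>F. \<Sum>y\<in>F. a x * cnj (a y) * add_char (w * (x - y)))" for w
  proof -
    have "add_char (w * (x - y)) = add_char (w * x) * cnj (add_char (w * y))" for x y
      using add_char_add[of "w * x" "- (w * y)"] by (simp add: cnj_add_char right_diff_distrib)
    then show ?thesis
      by (simp only: complex_norm_square cnj_sum sum_product complex_cnj_mult mult_ac)
  qed
  have "of_real (\<Sum>w\<in>F. (cmod (\<Sum>x\<in>F. a x * add_char (w * x)))\<^sup>2)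
      = (\<Sum>w\<in>F. \<Sum>x\<in>F. \<Sum>y\<in>F. a x * cnj (a y) * add_char (w * (x - y)))"
    by (simp only: of_real_sum square)
  also have "\<dots> = (\<Sum>x\<in>F. \<Sum>w\<in>F. \<Sum>y\<in>F. a x * cnj (a y) * add_char (w * (x - y)))"
    by (rule sum.swap)
  also have "\<dots> = (\<Sum>x\<in>F. \<Sum>y\<in>F. \<Sum>w\<in>F. a x * cnj (a y) * add_char (w * (x - y)))"
    by (intro sum.cong refl sum.swap)
  also have "\<dots> = (\<Sum>x\<in>F. \<Sum>y\<in>F. of_nat p * a x * cnj (a y) * of_bool (y = x))"
  proof (intro sum.cong refl)
    fix x y assume "x \<in> F" "y \<in> F"
    then have "P dvd x - y \<longleftrightarrow> y = x"
      using eq_if_cong_F[of x y] by (auto simp: cong_iff_dvd_diff)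
    then show "(\<Sum>w\<in>F. a x * cnj (a y) * add_char (w * (x - y)))
        = of_nat p * a x * cnj (a y) * of_bool (y = x)"
      by (simp add: sum_add_char flip: sum_distrib_left)
  qed
  also have "\<dots> = (\<Sum>x\<in>F. of_nat p * a x * cnj (a x))"
    by (intro sum.cong refl sum_mult_of_bool_delta) auto
  also have "\<dots> = of_real (real p * (\<Sum>x\<in>F. (cmod (a x))\<^sup>2))"
    by (simp add: sum_distrib_left mult.assoc flip: complex_norm_square)
  finally show ?thesis
    by (simp only: of_real_eq_iff)
qed


subsection \<open>Correlations of affine images\<close>

definition diag_fourier :: "(int \<times> int \<Rightarrow> real) \<Rightarrow> int \<Rightarrow> int \<Rightarrow> complex" where
  "diag_fourier b d w = (\<Sum>x\<in>F. of_real (b (x, x + d)) * add_char (w * x))"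

definition energy :: "(int \<times> int \<Rightarrow> real) \<Rightarrow> int \<Rightarrow> real" where
  "energy b w = (\<Sum>d\<in>F. (cmod (diag_fourier b d w))\<^sup>2)"

lemma energy_nonneg: "0 \<le> energy b w"
  by (simp add: energy_def sum_nonneg)

lemma periodic_energy: "periodic (energy b)"
proof (rule periodicI)
  fix v w assume "[v = w] (mod P)"
  then have "add_char (v * x) = add_char (w * x)" for x
    by (intro add_char_cong cong_intros)
  then show "energy b v = energy b w"
    by (simp add: energy_def diag_fourier_def)
qed

lemma sum_energy:
  assumes "periodic2 b"
  shows "(\<Sum>w\<in>F. energy b w) = real p * (L2_set b (F \<times> F))\<^sup>2"
proof -
  have "(\<Sum>w\<in>F. energy b w) = (\<Sum>d\<in>F. \<Sum>w\<in>F. (cmod (diag_fourier b d w))\<^sup>2)"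
    unfolding energy_def by (rule sum.swap)
  also have "\<dots> = real p * (\<Sum>d\<in>F. \<Sum>x\<in>F. (b (x, x + d))\<^sup>2)"
    by (simp add: diag_fourier_def parseval sum_distrib_left)
  also have "\<dots> = real p * (L2_set b (F \<times> F))\<^sup>2"
    unfolding L2_set_power2 using assms by (subst sum_pairs_diagonals) (auto simp: periodic2_def)
  finally show ?thesis .
qed

lemma diag_fourier_cong:
  assumes periodic_b: "periodic2 b" and cong_d: "[d = d'] (mod P)"
  shows "diag_fourier b d w = diag_fourier b d' w"
  unfolding diag_fourier_def
proof (intro sum.cong refl)
  fix x
  have "b (x, x + d) = b (x, x + d')"
    by (intro periodic2D[OF periodic_b] cong_intros cong_d)
  then show "of_real (b (x, x + d)) * add_char (w * x) = of_real (b (x, x + d')) * add_char (w * x)"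
    by simp
qed

lemma diag_fourier_shift:
  assumes periodic_b: "periodic2 b"
  shows "(\<Sum>v\<in>F. of_real (b (v + s, v + s + d)) * add_char (w * v))
    = add_char (- (w * s)) * diag_fourier b d w"
proof -
  have shift: "add_char (w * v) = add_char (- (w * s)) * add_char (w * (v + s))" for v
    by (simp flip: add_char_add) (simp add: algebra_simps)
  have "periodic (\<lambda>v. of_real (b (v, v + d)) * add_char (w * v) :: complex)"
  proof (rule periodicI)
    fix x y assume xy: "[x = y] (mod P)"
    then have "b (x, x + d) = b (y, y + d)"
      by (intro periodic2D[OF periodic_b] cong_intros)
    moreover have "add_char (w * x) = add_char (w * y)"
      using xy by (intro add_char_cong cong_intros)
    ultimately show "of_real (b (x, x + d)) * add_char (w * x)
        = of_real (b (y, y + d)) * add_char (w * y)"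
      by simp
  qed
  from sum_shift[OF this, of s]
  have "diag_fourier b d w = (\<Sum>v\<in>F. of_real (b (v + s, v + s + d)) * add_char (w * (v + s)))"
    by (simp add: diag_fourier_def)
  moreover have "of_real (b (v + s, v + s + d)) * add_char (w * v)
      = add_char (- (w * s)) * (of_real (b (v + s, v + s + d)) * add_char (w * (v + s)))" for v
    by (subst shift) (simp add: mult_ac)
  ultimately show ?thesis
    by (simp only: sum_distrib_left)
qed

definition affine_pair :: "int \<Rightarrow> int \<Rightarrow> int \<times> int \<Rightarrow> int \<times> int" where
  "affine_pair u v = map_prod (\<lambda>x. (u * x + v) mod P) (\<lambda>x. (u * x + v) mod P)"

lemma bij_betw_affine_pair: "coprime u P \<Longrightarrow> bij_betw (affine_pair u v) (F \<times> F) (F \<times> F)"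
  unfolding affine_pair_def by (intro bij_betw_map_prod bij_betw_affine)

lemma periodic2_affine_pair: "periodic2 (\<lambda>q. b (affine_pair u v q))"
proof (rule periodic2I)
  fix x x' y y' assume "[x = x'] (mod P)" "[y = y'] (mod P)"
  then have "[u * x + v = u * x' + v] (mod P)" "[u * y + v = u * y' + v] (mod P)"
    by (auto intro: cong_intros)
  then show "b (affine_pair u v (x, y)) = b (affine_pair u v (x', y'))"
    by (simp add: affine_pair_def cong_def)
qed

lemma periodic2_at_affine_pair: "periodic2 b \<Longrightarrow> b (affine_pair u v (x, y)) = b (u * x + v, u * y + v)"
  by (simp add: affine_pair_def periodic2D)

lemma fourier_correlation:
  assumes periodic_b: "periodic2 b" and periodic_c: "periodic2 c"
  shows "(\<Sum>v\<in>F. of_real (\<Sum>q\<in>F \<times> F. c q * b (affine_pair u v q)) * add_char (w * v))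
    = (\<Sum>d\<in>F. diag_fourier b (u * d) w * diag_fourier c d (- u * w))"
proof -
  let ?c = "\<lambda>x d. of_real (c (x, x + d)) :: complex"
    and ?b = "\<lambda>x d v. of_real (b (v + u * x, v + u * x + u * d)) * add_char (w * v) :: complex"
  have "(\<Sum>q\<in>F \<times> F. c q * b (affine_pair u v q))
      = (\<Sum>d\<in>F. \<Sum>x\<in>F. c (x, x + d) * b (v + u * x, v + u * x + u * d))" for v
  proof -
    have "periodic2 (\<lambda>q. c q * b (affine_pair u v q))"
      using periodic_c periodic2_affine_pair[of b u v] by (simp add: periodic2_def)
    then show ?thesis
      by (simp add: sum_pairs_diagonals periodic2_at_affine_pair[OF periodic_b] algebra_simps)
  qed
  then have "(\<Sum>v\<in>F. of_real (\<Sum>q\<in>F \<times> F. c q * b (affine_pair u v q)) * add_char (w * v))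
      = (\<Sum>v\<in>F. \<Sum>d\<in>F. \<Sum>x\<in>F. ?c x d * ?b x d v)"
    by (simp add: sum_distrib_right mult.assoc)
  also have "\<dots> = (\<Sum>d\<in>F. \<Sum>v\<in>F. \<Sum>x\<in>F. ?c x d * ?b x d v)"
    by (rule sum.swap)
  also have "\<dots> = (\<Sum>d\<in>F. \<Sum>x\<in>F. \<Sum>v\<in>F. ?c x d * ?b x d v)"
    by (intro sum.cong refl sum.swap)
  also have "\<dots> = (\<Sum>d\<in>F. \<Sum>x\<in>F. ?c x d * (add_char (- (w * (u * x))) * diag_fourier b (u * d) w))"
    by (simp only: diag_fourier_shift[OF periodic_b] flip: sum_distrib_left)
  also have "\<dots> = (\<Sum>d\<in>F. diag_fourier b (u * d) w * diag_fourier c d (- u * w))"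
    by (simp add: diag_fourier_def[of c] sum_distrib_left mult_ac)
  finally show ?thesis .
qed

lemma sum_correlation_square_le:
  assumes periodic_b: "periodic2 b" and periodic_c: "periodic2 c" and coprime_u: "coprime u P"
  shows "real p * (\<Sum>v\<in>F. (\<Sum>q\<in>F \<times> F. c q * b (affine_pair u v q))\<^sup>2)
    \<le> (\<Sum>w\<in>F. energy b w * energy c (- u * w))"
proof -
  let ?z = "\<lambda>w. \<Sum>d\<in>F. diag_fourier b (u * d) w * diag_fourier c d (- u * w)"
  have "real p * (\<Sum>v\<in>F. (\<Sum>q\<in>F \<times> F. c q * b (affine_pair u v q))\<^sup>2) = (\<Sum>w\<in>F. (cmod (?z w))\<^sup>2)"
    using parseval[of "\<lambda>v. of_real (\<Sum>q\<in>F \<times> F. c q * b (affine_pair u v q))"]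
    by (simp only: fourier_correlation[OF periodic_b periodic_c] norm_of_real power2_abs)
  also have "\<dots> \<le> (\<Sum>w\<in>F. energy b w * energy c (- u * w))"
  proof (rule sum_mono)
    fix w
    have "cmod (?z w) \<le> (\<Sum>d\<in>F. cmod (diag_fourier b (u * d) w) * cmod (diag_fourier c d (- u * w)))"
      by (rule order_trans[OF norm_sum]) (simp add: norm_mult)
    then have "(cmod (?z w))\<^sup>2
        \<le> (\<Sum>d\<in>F. cmod (diag_fourier b (u * d) w) * cmod (diag_fourier c d (- u * w)))\<^sup>2"
      by (rule power_mono) simp
    also have "\<dots> \<le> (\<Sum>d\<in>F. (cmod (diag_fourier b (u * d) w))\<^sup>2) * energy c (- u * w)"
      unfolding energy_def by (rule Cauchy_Schwarz_ineq_sum)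
    also have "(\<Sum>d\<in>F. (cmod (diag_fourier b (u * d) w))\<^sup>2) = energy b w"
      using sum_affine[of "\<lambda>d. (cmod (diag_fourier b d w))\<^sup>2" u 0] coprime_u
        diag_fourier_cong[OF periodic_b]
      by (simp add: energy_def periodic_def)
    finally show "(cmod (?z w))\<^sup>2 \<le> energy b w * energy c (- u * w)" .
  qed
  finally show ?thesis .
qed

end

locale prime_modulus =
  fixes p :: nat
  assumes prime_p: "prime p"

sublocale prime_modulus \<subseteq> modulus
  by unfold_locales (rule prime_gt_0_nat[OF prime_p])

context prime_modulus
begin

lemma prime_P: "prime P"
  using prime_p by simp

lemma coprime_P_iff: "coprime x P \<longleftrightarrow> \<not> P dvd x"
  using prime_P by (auto simp: coprime_commute[of x] prime_imp_coprime coprime_absorb_left not_prime_unit)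

lemma dvd_mult_iff: "P dvd x * y \<longleftrightarrow> P dvd x \<or> P dvd y"
  by (rule prime_dvd_mult_iff[OF prime_P])

lemma dvd_F_iff: "x \<in> F \<Longrightarrow> P dvd x \<longleftrightarrow> x = 0"
  using eq_if_cong_F[of x 0] p_pos by (auto simp: cong_0_iff)

lemma not_dvd_if_nonzero: "x \<in> F - {0} \<Longrightarrow> \<not> P dvd x"
  using dvd_F_iff[of x] by blast

lemma cong_mult_cancel: "\<not> P dvd z \<Longrightarrow> [z * x = z * y] (mod P) \<longleftrightarrow> [x = y] (mod P)"
  by (simp add: cong_mult_lcancel coprime_P_iff)

lemma sum_F_split_0: "(\<Sum>x\<in>F. f x) = f 0 + (\<Sum>x\<in>F - {0}. f x)"
  using p_pos by (subst sum.remove[of _ 0]) auto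

abbreviation recip :: "int \<Rightarrow> int" where "recip \<equiv> modular_inverse P"

lemma recip_in_F: "recip x \<in> F"
  using p_pos by (simp add: modular_inverse_int_nonneg modular_inverse_int_less)

lemma mult_recip_cong: "\<not> P dvd x \<Longrightarrow> [x * recip x = 1] (mod P)"
  by (rule cong_modular_inverse1) (simp add: coprime_P_iff)

lemma recip_dvd_iff: "P dvd recip x \<longleftrightarrow> P dvd x"
  using coprime_modular_inverse[of x P] mult_modular_inverse_of_not_coprime[of x P] coprime_P_iff
  by (metis dvd_0_right)

lemma recip_cong:
  assumes "[x = y] (mod P)"
  shows "recip x = recip y"
proof (cases "P dvd y")
  case True
  then show ?thesis
    using cong_dvd_iff[OF assms] by (simp add: coprime_P_iff)
next
  case False
  have "[x * recip y = y * recip y] (mod P)"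
    by (intro cong_intros assms)
  then have "[x * recip y = 1] (mod P)"
    using mult_recip_cong[OF False] by (rule cong_trans)
  then show ?thesis
    by (intro modular_inverse_int_eqI recip_in_F)
qed

lemma recip_recip:
  assumes "x \<in> F"
  shows "recip (recip x) = x"
proof (cases "P dvd x")
  case True
  then show ?thesis
    using assms by (simp add: dvd_F_iff coprime_P_iff)
next
  case False
  then show ?thesis
    using assms mult_recip_cong[of x] by (intro modular_inverse_int_eqI) (simp_all add: mult.commute)
qed

lemma sum_recip: "(\<Sum>x\<in>F. f (recip x)) = (\<Sum>x\<in>F. f x)"
  by (rule sum.reindex_bij_witness[of _ recip recip])
    (auto simp: recip_recip recip_in_F simp del: atLeastLessThan_iff)

text \<open>The dilations move every nonzero frequency through all nonzero frequencies.\<close>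

lemma affine_near_orthogonality:
  assumes periodic_b: "periodic2 b" and periodic_c: "periodic2 c" and mean: "\<And>d. (\<Sum>x\<in>F. b (x, x + d)) = 0"
  shows "(\<Sum>u\<in>F - {0}. \<Sum>v\<in>F. (\<Sum>q\<in>F \<times> F. c q * b (affine_pair u v q))\<^sup>2)
    \<le> real p * (L2_set b (F \<times> F))\<^sup>2 * (L2_set c (F \<times> F))\<^sup>2"
proof -
  have "energy b 0 = 0"
    by (simp add: energy_def diag_fourier_def mean flip: of_real_sum)
  have dilate: "(\<Sum>u\<in>F - {0}. energy c (- u * w)) \<le> (\<Sum>s\<in>F. energy c s)" if "w \<in> F" "w \<noteq> 0" for w
  proof -
    have "coprime (- w) P"
      using that by (simp add: coprime_P_iff dvd_F_iff)
    from sum_affine[OF periodic_energy this, of c 0]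
    show ?thesis
      using sum_F_split_0[of "\<lambda>u. energy c (- u * w)"] energy_nonneg[of c 0] by (simp add: mult.commute)
  qed
  have "real p * (\<Sum>u\<in>F - {0}. \<Sum>v\<in>F. (\<Sum>q\<in>F \<times> F. c q * b (affine_pair u v q))\<^sup>2)
      = (\<Sum>u\<in>F - {0}. real p * (\<Sum>v\<in>F. (\<Sum>q\<in>F \<times> F. c q * b (affine_pair u v q))\<^sup>2))"
    by (rule sum_distrib_left)
  also have "\<dots> \<le> (\<Sum>u\<in>F - {0}. \<Sum>w\<in>F. energy b w * energy c (- u * w))"
    by (intro sum_mono sum_correlation_square_le periodic_b periodic_c)
      (auto simp: coprime_P_iff dvd_F_iff)
  also have "\<dots> = (\<Sum>w\<in>F. energy b w * (\<Sum>u\<in>F - {0}. energy c (- u * w)))"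
    by (subst sum.swap) (simp add: sum_distrib_left)
  also have "\<dots> \<le> (\<Sum>w\<in>F. energy b w * (\<Sum>s\<in>F. energy c s))"
  proof (rule sum_mono)
    fix w assume "w \<in> F"
    then show "energy b w * (\<Sum>u\<in>F - {0}. energy c (- u * w)) \<le> energy b w * (\<Sum>s\<in>F. energy c s)"
      using dilate[of w] \<open>energy b 0 = 0\<close> energy_nonneg[of b w]
      by (cases "w = 0") (auto intro: mult_left_mono)
  qed
  also have "\<dots> = real p * (real p * (L2_set b (F \<times> F))\<^sup>2 * (L2_set c (F \<times> F))\<^sup>2)"
    by (simp add: sum_energy periodic_b periodic_c flip: sum_distrib_right)
  finally show ?thesis
    using p_pos by simp
qed

end


section \<open>The quadratic character\<close>

locale odd_prime = prime_modulus +
  assumes odd_p: "odd p"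
begin

lemma p_ge_3: "3 \<le> p"
proof -
  have "p \<noteq> 2"
    using odd_p by auto
  then show ?thesis
    using prime_ge_2_nat[OF prime_p] by simp
qed

lemma not_dvd_2: "\<not> P dvd 2"
  using p_ge_3 zdvd_imp_le[of P 2] by auto

lemma not_dvd_4: "\<not> P dvd 4"
  using not_dvd_2 dvd_mult_iff[of 2 2] by simp

definition chi :: "int \<Rightarrow> real" where
  "chi a = real_of_int (Legendre a P)"

lemma Legendre_values: "Legendre a P \<in> {-1, 0, 1}"
  by (simp add: Legendre_def)

lemma Legendre_eqI:
  assumes "[Legendre a P = c] (mod P)" "c \<in> {-1, 0, 1}"
  shows "Legendre a P = c"
  using assms Legendre_values[of a] p_ge_3 zdvd_imp_le[of P 1] zdvd_imp_le[of P 2]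
  by (auto simp: cong_iff_dvd_diff)

lemma Legendre_cong_power: "[Legendre a P = a ^ ((p - 1) div 2)] (mod P)"
  using euler_criterion[OF prime_p, of a] p_ge_3 by simp

lemma chi_mult: "chi (a * b) = chi a * chi b"
proof -
  have "[Legendre (a * b) P = a ^ ((p - 1) div 2) * b ^ ((p - 1) div 2)] (mod P)"
    using Legendre_cong_power[of "a * b"] by (simp add: power_mult_distrib)
  also have "[a ^ ((p - 1) div 2) * b ^ ((p - 1) div 2) = Legendre a P * Legendre b P] (mod P)"
    by (rule cong_sym) (intro cong_mult Legendre_cong_power)
  finally have "Legendre (a * b) P = Legendre a P * Legendre b P"
    using Legendre_values[of a] Legendre_values[of b] by (intro Legendre_eqI) auto
  then show ?thesis
    by (simp add: chi_def)
qed

lemma chi_cong: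
  assumes "[a = b] (mod P)"
  shows "chi a = chi b"
proof -
  have "[Legendre a P = b ^ ((p - 1) div 2)] (mod P)"
    using Legendre_cong_power cong_pow[OF assms] by (rule cong_trans)
  then have "[Legendre a P = Legendre b P] (mod P)"
    using cong_sym[OF Legendre_cong_power] by (rule cong_trans)
  then show ?thesis
    using Legendre_values[of b] by (simp add: chi_def Legendre_eqI)
qed

lemma chi_eq_0_iff: "chi a = 0 \<longleftrightarrow> P dvd a"
  by (auto simp: chi_def Legendre_def cong_0_iff)

lemma chi_0 [simp]: "chi 0 = 0"
  by (simp add: chi_eq_0_iff)

lemma chi_mult_self: "chi a * chi a = of_bool (\<not> P dvd a)"
  using chi_eq_0_iff[of a] Legendre_values[of a] by (auto simp: chi_def)

lemma chi_1 [simp]: "chi 1 = 1"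
  using chi_mult[of 1 1] chi_mult_self[of 1] p_ge_3 by (simp add: zdvd1_eq)

lemma abs_chi_le_1: "\<bar>chi a\<bar> \<le> 1"
  using Legendre_values[of a] by (auto simp: chi_def)

lemma chi_recip: "chi (recip x) = chi x"
proof (cases "P dvd x")
  case True
  then show ?thesis
    using chi_eq_0_iff recip_dvd_iff by metis
next
  case False
  have "chi x * (chi x * chi (recip x)) = chi x"
    using chi_cong[OF mult_recip_cong[OF False]] by (simp add: chi_mult)
  then show ?thesis
    using False by (simp add: chi_mult_self flip: mult.assoc)
qed

lemma card_square_roots:
  assumes not_dvd: "\<not> P dvd z"
  shows "card {y \<in> F. [y\<^sup>2 = z\<^sup>2] (mod P)} = 2"
proof -
  have "[y\<^sup>2 = z\<^sup>2] (mod P) \<longleftrightarrow> [y = z] (mod P) \<or> [y = - z] (mod P)" for y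
    by (simp add: cong_iff_dvd_diff power2_eq_square square_diff_square_factored dvd_mult_iff
      disj_commute)
  then have "{y \<in> F. [y\<^sup>2 = z\<^sup>2] (mod P)} = {y \<in> F. y = z mod P \<or> y = - z mod P}"
    using cong_iff_eq_mod by blast
  also have "\<dots> = {z mod P, - z mod P}"
    using mod_in_F by blast
  finally have "{y \<in> F. [y\<^sup>2 = z\<^sup>2] (mod P)} = \<dots>" .
  moreover have "z mod P \<noteq> - z mod P"
    using not_dvd not_dvd_2 dvd_mult_iff[of 2 z] by (simp add: mod_eq_dvd_iff)
  ultimately show ?thesis
    by simp
qed

lemma sum_square_roots: "(\<Sum>y\<in>F. of_bool [y\<^sup>2 = a] (mod P)) = 1 + chi a"
proof -
  let ?R = "{y \<in> F. [y\<^sup>2 = a] (mod P)}"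
  consider (zero) "P dvd a" | (square) "\<not> P dvd a" "QuadRes P a" | (nonsquare) "\<not> P dvd a" "\<not> QuadRes P a"
    by blast
  then have "real (card ?R) = 1 + chi a"
  proof cases
    case zero
    have "[y\<^sup>2 = a] (mod P) \<longleftrightarrow> P dvd y" for y
      using zero dvd_add_left_iff[of P "- a" "y\<^sup>2"]
      by (simp add: cong_iff_dvd_diff power2_eq_square dvd_mult_iff)
    then have "?R = {0}"
      using p_pos dvd_F_iff by auto
    then show ?thesis
      using zero by (simp add: chi_eq_0_iff)
  next
    case square
    then obtain z where z: "[z\<^sup>2 = a] (mod P)"
      by (auto simp: QuadRes_def)
    then have "?R = {y \<in> F. [y\<^sup>2 = z\<^sup>2] (mod P)}"
      by (simp add: cong_def)
    moreover have "\<not> P dvd z"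
      using square cong_dvd_iff[OF z] by (auto simp: power2_eq_square)
    ultimately show ?thesis
      using square card_square_roots by (simp add: chi_def Legendre_def cong_0_iff)
  next
    case nonsquare
    then have "?R = {}"
      by (auto simp: QuadRes_def)
    then show ?thesis
      using nonsquare by (simp only: card.empty) (simp add: chi_def Legendre_def cong_0_iff)
  qed
  then show ?thesis
    by (simp add: Int_def)
qed

lemma sum_roots_quadratic:
  assumes "\<not> P dvd a"
  shows "(\<Sum>x\<in>F. of_bool [a * x\<^sup>2 + b * x + c = 0] (mod P)) = 1 + chi (b\<^sup>2 - 4 * a * c)"
proof -
  have "[a * x\<^sup>2 + b * x + c = 0] (mod P) \<longleftrightarrow> [(2 * a * x + b)\<^sup>2 = b\<^sup>2 - 4 * a * c] (mod P)" for x
  proof -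
    have "(2 * a * x + b)\<^sup>2 - (b\<^sup>2 - 4 * a * c) = 4 * (a * (a * x\<^sup>2 + b * x + c))"
      by (simp add: power2_eq_square algebra_simps)
    then show ?thesis
      using assms not_dvd_4 by (simp only: cong_0_iff cong_iff_dvd_diff dvd_mult_iff) simp
  qed
  then have "(\<Sum>x\<in>F. of_bool [a * x\<^sup>2 + b * x + c = 0] (mod P))
      = (\<Sum>x\<in>F. of_bool [(2 * a * x + b)\<^sup>2 = b\<^sup>2 - 4 * a * c] (mod P) :: real)"
    by simp
  also have "\<dots> = (\<Sum>y\<in>F. of_bool [y\<^sup>2 = b\<^sup>2 - 4 * a * c] (mod P))"
  proof (rule sum_affine)
    show "periodic (\<lambda>y. of_bool [y\<^sup>2 = b\<^sup>2 - 4 * a * c] (mod P))"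
    proof (rule periodicI)
      fix x y assume "[x = y] (mod P)"
      then have "[x\<^sup>2 = y\<^sup>2] (mod P)"
        by (rule cong_pow)
      then show "of_bool [x\<^sup>2 = b\<^sup>2 - 4 * a * c] (mod P) = of_bool [y\<^sup>2 = b\<^sup>2 - 4 * a * c] (mod P)"
        by (simp add: cong_def)
    qed
    show "coprime (2 * a) P"
      using assms not_dvd_2 by (simp add: coprime_P_iff dvd_mult_iff)
  qed
  finally show ?thesis
    by (simp add: sum_square_roots)
qed

lemma sum_chi: "(\<Sum>x\<in>F. chi x) = 0"
proof -
  have "real p + (\<Sum>x\<in>F. chi x) = (\<Sum>a\<in>F. \<Sum>y\<in>F. of_bool [y\<^sup>2 = a] (mod P))"
    by (simp only: sum_square_roots sum.distrib) simp
  also have "\<dots> = (\<Sum>y\<in>F. \<Sum>a\<in>F. 1 * of_bool (a = y\<^sup>2 mod P))"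
    by (subst sum.swap, intro sum.cong refl) (auto simp: cong_def)
  also have "\<dots> = (\<Sum>y\<in>F. 1)"
    by (intro sum.cong refl sum_mult_of_bool_delta) (simp_all add: mod_in_F p_pos)
  finally show ?thesis
    by simp
qed

lemma periodic_chi_affine: "periodic (\<lambda>x. chi (u * x + v))"
  by (intro periodicI chi_cong cong_intros)

lemma sum_chi_affine: "\<not> P dvd u \<Longrightarrow> (\<Sum>x\<in>F. chi (u * x + v)) = 0"
  using sum_affine[of chi u v] periodic_chi_affine[of 1 0] by (simp add: sum_chi coprime_P_iff)

lemma sum_chi_mult_chi:
  "(\<Sum>x\<in>F. chi (x - a) * chi (x - b)) = (if [a = b] (mod P) then real p - 1 else - 1)"
proof -
  have "(\<Sum>x\<in>F. chi (x - a) * chi (x - b)) = (\<Sum>x\<in>F. chi x * chi (x + (a - b)))"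
  proof -
    have "periodic (\<lambda>x. chi x * chi (x + (a - b)))"
      by (intro periodicI arg_cong2[of _ _ _ _ "(*)"] chi_cong cong_intros)
    from sum_shift[OF this, of "- a"] show ?thesis
      by simp
  qed
  also have "\<dots> = (\<Sum>x\<in>F - {0}. chi x * chi (x + (a - b)))"
    by (simp add: sum_F_split_0)
  also have "\<dots> = (\<Sum>x\<in>F - {0}. chi ((a - b) * recip x + 1))"
  proof (rule sum.cong[OF refl])
    fix x assume "x \<in> F - {0}"
    then have "\<not> P dvd x"
      by (rule not_dvd_if_nonzero)
    then have "[recip x * (x + (a - b)) = (a - b) * recip x + 1] (mod P)"
      using cong_add[OF mult_recip_cong cong_refl[of "(a - b) * recip x"], of x]
      by (simp add: algebra_simps)
    from chi_cong[OF this] show "chi x * chi (x + (a - b)) = chi ((a - b) * recip x + 1)"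
      by (simp add: chi_mult chi_recip)
  qed
  also have "\<dots> = (\<Sum>x\<in>F. chi ((a - b) * recip x + 1)) - 1"
    by (simp add: sum_F_split_0 coprime_P_iff)
  also have "(\<Sum>x\<in>F. chi ((a - b) * recip x + 1)) = (\<Sum>x\<in>F. chi ((a - b) * x + 1))"
    by (rule sum_recip)
  also have "\<dots> = (if [a = b] (mod P) then real p else 0)"
  proof (cases "[a = b] (mod P)")
    case True
    then have "chi ((a - b) * x + 1) = 1" for x
      using chi_cong[of "(a - b) * x + 1" 1] by (simp add: cong_iff_dvd_diff)
    then show ?thesis
      using True by simp
  qed (simp add: sum_chi_affine cong_iff_dvd_diff)
  finally show ?thesis
    by simp
qed

lemma sum_chi_mult_chi_reflected:
  "(\<Sum>x\<in>F. chi (a - x) * chi (b - x)) = (if [a = b] (mod P) then real p - 1 else - 1)"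
proof -
  have "chi (a - x) * chi (b - x) = chi (x - a) * chi (x - b)" for x
    by (simp add: algebra_simps flip: chi_mult)
  then show ?thesis
    by (simp only: sum_chi_mult_chi)
qed

lemma L2_set_chi_op_le:
  "L2_set (kernel_op (\<lambda>y x. chi (x - y)) F a) F \<le> sqrt (real p) * L2_set a F"
proof (rule power2_le_imp_le)
  have "(L2_set (kernel_op (\<lambda>y x. chi (x - y)) F a) F)\<^sup>2
      = (real p - 1 - (- 1)) * (L2_set a F)\<^sup>2 + (- 1) * (\<Sum>x\<in>F. a x)\<^sup>2"
    unfolding L2_set_kernel_op_power2
    using eq_if_cong_F by (intro kernel_form_two_valued) (auto simp: sum_chi_mult_chi_reflected)
  then show "(L2_set (kernel_op (\<lambda>y x. chi (x - y)) F a) F)\<^sup>2 \<le> (sqrt (real p) * L2_set a F)\<^sup>2"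
    by (simp add: power_mult_distrib)
qed simp

lemma L2_set_chi_mult_chi_op_le:
  "L2_set (kernel_op (\<lambda>q i. chi (i - fst q) * chi (i - snd q)) F a) (F \<times> F) \<le> real p * L2_set a F"
proof (rule power2_le_imp_le)
  let ?K = "\<lambda>q i. chi (i - fst q) * chi (i - snd q)"
  have Gram: "(\<Sum>q\<in>F \<times> F. ?K q i * ?K q i') = (if i = i' then (real p - 1)\<^sup>2 else 1)"
    if "i \<in> F" "i' \<in> F" for i i'
  proof -
    have "(\<Sum>q\<in>F \<times> F. ?K q i * ?K q i') = (\<Sum>x\<in>F. chi (i - x) * chi (i' - x))\<^sup>2"
      unfolding sum.cartesian_product' power2_eq_square sum_product
      by (intro sum.cong refl) (simp add: mult_ac)
    then show ?thesis
      using eq_if_cong_F[OF that] by (auto simp: sum_chi_mult_chi_reflected)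
  qed
  have "(L2_set (kernel_op ?K F a) (F \<times> F))\<^sup>2
      = ((real p - 1)\<^sup>2 - 1) * (L2_set a F)\<^sup>2 + 1 * (\<Sum>x\<in>F. a x)\<^sup>2"
    unfolding L2_set_kernel_op_power2 using Gram by (intro kernel_form_two_valued) auto
  also have "\<dots> \<le> ((real p - 1)\<^sup>2 - 1) * (L2_set a F)\<^sup>2 + real p * (L2_set a F)\<^sup>2"
    using sum_squared_le_sum_of_squares[of a F] by (simp add: L2_set_power2 mult.commute)
  also have "\<dots> = ((real p)\<^sup>2 - real p) * (L2_set a F)\<^sup>2"
    by (simp add: power2_eq_square algebra_simps)
  also have "\<dots> \<le> (real p * L2_set a F)\<^sup>2"
    unfolding power_mult_distrib by (intro mult_right_mono) auto
  finally show "(L2_set (kernel_op ?K F a) (F \<times> F))\<^sup>2 \<le> (real p * L2_set a F)\<^sup>2" .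
qed simp

end


section \<open>A fourth moment of character sums\<close>

context modulus
begin

abbreviation F4 :: "(int \<times> int \<times> int \<times> int) set" where
  "F4 \<equiv> F \<times> F \<times> F \<times> F"

lemma sum_F4_shift:
  assumes periodic: "\<And>b c d. periodic (\<lambda>a. G (a, b, c, d))" "\<And>a c d. periodic (\<lambda>b. G (a, b, c, d))"
    "\<And>a b d. periodic (\<lambda>c. G (a, b, c, d))" "\<And>a b c. periodic (\<lambda>d. G (a, b, c, d))"
  shows "(\<Sum>(a, b, c, d)\<in>F4. G (a + s, b + t, c + u, d + v)) = (\<Sum>c\<in>F4. G c)"
proof -
  have "(\<Sum>(a, b, c, d)\<in>F4. G (a + s, b + t, c + u, d + v))
      = (\<Sum>a\<in>F. \<Sum>b\<in>F. \<Sum>c\<in>F. \<Sum>d\<in>F. G (a + s, b + t, c + u, d))"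
    unfolding sum.cartesian_product' prod.case by (intro sum.cong refl sum_shift periodic)
  also have "\<dots> = (\<Sum>a\<in>F. \<Sum>b\<in>F. \<Sum>c\<in>F. \<Sum>d\<in>F. G (a + s, b + t, c, d))"
    by (intro sum.cong refl sum_shift[of "\<lambda>c. \<Sum>d\<in>F. G (_, _, c, d)"] periodic_sum periodic)
  also have "\<dots> = (\<Sum>a\<in>F. \<Sum>b\<in>F. \<Sum>c\<in>F. \<Sum>d\<in>F. G (a + s, b, c, d))"
    by (intro sum.cong refl sum_shift[of "\<lambda>b. \<Sum>c\<in>F. \<Sum>d\<in>F. G (_, b, c, d)"] periodic_sum periodic)
  also have "\<dots> = (\<Sum>a\<in>F. \<Sum>b\<in>F. \<Sum>c\<in>F. \<Sum>d\<in>F. G (a, b, c, d))"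
    by (intro sum_shift[of "\<lambda>a. \<Sum>b\<in>F. \<Sum>c\<in>F. \<Sum>d\<in>F. G (a, b, c, d)"] periodic_sum periodic)
  finally show ?thesis
    by (simp add: sum.cartesian_product')
qed

end

context odd_prime
begin

definition quartic :: "int \<times> int \<times> int \<times> int \<Rightarrow> int \<Rightarrow> int" where
  "quartic = (\<lambda>(a, b, c, d) x. x ^ 4 + a * x ^ 3 + b * x ^ 2 + c * x + d)"

definition chi_quartic4 :: "int \<times> int \<times> int \<times> int \<Rightarrow> int \<times> int \<times> int \<times> int \<Rightarrow> real" where
  "chi_quartic4 = (\<lambda>c (x, y, z, w). chi (quartic c x * quartic c y * quartic c z * quartic c w))"

text \<open>Adding a multiple of \<open>(X - x) (X - y) (X - z)\<close> permutes the monic quartics and keeps their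
  values at \<open>x\<close>, \<open>y\<close>, \<open>z\<close>, while the value at \<open>w\<close> runs through the whole field.\<close>

lemma sum_chi_quartic4_eq_0:
  assumes in_F: "x \<in> F" "y \<in> F" "z \<in> F" "w \<in> F" and ne: "w \<noteq> x" "w \<noteq> y" "w \<noteq> z"
  shows "(\<Sum>c\<in>F4. chi_quartic4 c (x, y, z, w)) = 0"
proof -
  let ?G = "\<lambda>c. chi_quartic4 c (x, y, z, w)"
  let ?c = "\<lambda>s (a, b, c, d). (a + s, b + s * (- (x + y + z)),
      c + s * (x * y + y * z + z * x), d + s * (- (x * y * z)))"
  define u where "u = (w - x) * (w - y) * (w - z)"
  have not_dvd_u: "\<not> P dvd u"
    using eq_if_cong_F[of w] in_F ne by (auto simp: u_def dvd_mult_iff cong_iff_dvd_diff)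
  have shifted: "quartic (?c s c) v = s * ((v - x) * (v - y) * (v - z)) + quartic c v" for c s v
    by (cases c) (simp add: quartic_def algebra_simps power2_eq_square power3_eq_cube)
  have shifted_value: "?G (?c s c)
      = chi (quartic c x * quartic c y * quartic c z) * chi (u * s + quartic c w)" for c s
    unfolding chi_quartic4_def prod.case shifted by (simp add: u_def mult.commute flip: chi_mult)
  have translate: "(\<Sum>c\<in>F4. ?G c) = (\<Sum>c\<in>F4. ?G (?c s c))" for s
    unfolding case_prod_unfold
    by (rule sum_F4_shift[of ?G, unfolded case_prod_unfold, symmetric])
      (auto simp: chi_quartic4_def quartic_def intro!: periodicI chi_cong cong_intros)
  have "real p * (\<Sum>c\<in>F4. ?G c) = (\<Sum>s\<in>F. \<Sum>c\<in>F4. ?G c)"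
    by simp
  also have "\<dots> = (\<Sum>s\<in>F. \<Sum>c\<in>F4. ?G (?c s c))"
    by (intro sum.cong refl translate)
  also have "\<dots> = (\<Sum>c\<in>F4. \<Sum>s\<in>F. ?G (?c s c))"
    by (rule sum.swap)
  also have "\<dots> = 0"
    unfolding shifted_value by (simp add: sum_chi_affine[OF not_dvd_u] flip: sum_distrib_left)
  finally show ?thesis
    using p_pos by simp
qed

definition paired :: "(int \<times> int \<times> int \<times> int) set" where
  "paired = {(x, y, z, w). (x = y \<and> z = w) \<or> (x = z \<and> y = w) \<or> (x = w \<and> y = z)}"

lemma sum_chi_quartic4_unpaired:
  assumes "v \<in> F4" "v \<notin> paired"
  shows "(\<Sum>c\<in>F4. chi_quartic4 c v) = 0"
proof -
  obtain x y z w where v: "v = (x, y, z, w)"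
    by (cases v)
  have in_F: "x \<in> F" "y \<in> F" "z \<in> F" "w \<in> F"
    using assms(1) v by auto
  have swap: "chi_quartic4 c (x, y, z, w) = chi_quartic4 c (x, y, w, z)"
    "chi_quartic4 c (x, y, z, w) = chi_quartic4 c (x, w, z, y)"
    "chi_quartic4 c (x, y, z, w) = chi_quartic4 c (w, y, z, x)" for c
    by (simp_all add: chi_quartic4_def mult_ac)
  consider (lone_w) "w \<noteq> x" "w \<noteq> y" "w \<noteq> z" | (lone_z) "z \<noteq> x" "z \<noteq> y" "z \<noteq> w"
    | (lone_y) "y \<noteq> x" "y \<noteq> w" "y \<noteq> z" | (lone_x) "x \<noteq> w" "x \<noteq> y" "x \<noteq> z"
    using assms(2) v by (auto simp: paired_def)
  then show ?thesis
  proof cases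
    case lone_w
    then show ?thesis
      unfolding v by (intro sum_chi_quartic4_eq_0 in_F)
  next
    case lone_z
    then show ?thesis
      unfolding v swap(1) by (intro sum_chi_quartic4_eq_0 in_F)
  next
    case lone_y
    then show ?thesis
      unfolding v swap(2) by (intro sum_chi_quartic4_eq_0 in_F)
  next
    case lone_x
    then show ?thesis
      unfolding v swap(3) by (intro sum_chi_quartic4_eq_0 in_F)
  qed
qed

lemma sum_chi_quartic4_le: "(\<Sum>c\<in>F4. chi_quartic4 c v) \<le> real p ^ 4"
proof -
  have "(\<Sum>c\<in>F4. chi_quartic4 c v) \<le> (\<Sum>c\<in>F4. 1)"
    by (intro sum_mono)
      (auto simp: chi_quartic4_def case_prod_unfold intro: order_trans[OF abs_ge_self abs_chi_le_1])
  also have "\<dots> = real p ^ 4"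
    by (simp add: card_cartesian_product power4_eq_xxxx)
  finally show ?thesis .
qed

lemma card_paired_le: "real (card (F4 \<inter> paired)) \<le> 3 * real p ^ 2"
proof -
  let ?f = "\<lambda>(a, b). (a, a, b, b)" and ?g = "\<lambda>(a, b). (a, b, a, b)" and ?h = "\<lambda>(a, b). (a, b, b, a)"
  have "F4 \<inter> paired \<subseteq> (?f ` (F \<times> F) \<union> ?g ` (F \<times> F)) \<union> ?h ` (F \<times> F)"
    by (auto simp: paired_def)
  then have "card (F4 \<inter> paired) \<le> card ((?f ` (F \<times> F) \<union> ?g ` (F \<times> F)) \<union> ?h ` (F \<times> F))"
    by (intro card_mono) auto
  also have "\<dots> \<le> (card (F \<times> F) + card (F \<times> F)) + card (F \<times> F)"
    by (intro order_trans[OF card_Un_le] add_mono card_image_le) auto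
  also have "\<dots> = 3 * p ^ 2"
    by (simp add: card_cartesian_product power2_eq_square)
  finally show ?thesis
    by (simp flip: of_nat_le_iff[where 'a = real])
qed

lemma quartic_moment: "(\<Sum>c\<in>F4. (\<Sum>x\<in>F. chi (quartic c x)) ^ 4) \<le> 3 * real p ^ 6"
proof -
  have "(\<Sum>c\<in>F4. (\<Sum>x\<in>F. chi (quartic c x)) ^ 4) = (\<Sum>c\<in>F4. \<Sum>v\<in>F4. chi_quartic4 c v)"
    by (simp add: sum_power4 chi_quartic4_def chi_mult)
  also have "\<dots> = (\<Sum>v\<in>F4. \<Sum>c\<in>F4. chi_quartic4 c v)"
    by (rule sum.swap)
  also have "\<dots> = (\<Sum>v\<in>F4 \<inter> paired. \<Sum>c\<in>F4. chi_quartic4 c v)"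
    using sum_chi_quartic4_unpaired by (intro sum.mono_neutral_right) auto
  also have "\<dots> \<le> real (card (F4 \<inter> paired)) * real p ^ 4"
    by (intro sum_bounded_above sum_chi_quartic4_le)
  also have "\<dots> \<le> (3 * real p ^ 2) * real p ^ 4"
    by (intro mult_right_mono card_paired_le) simp
  finally show ?thesis
    by (simp add: eval_nat_numeral)
qed

definition char_sum :: "int \<times> int \<times> int \<times> int \<Rightarrow> real" where
  "char_sum = (\<lambda>(i, j, k, l). \<Sum>x\<in>F. chi ((x - i) * (x - j) * (x - k) * (x - l)))"

definition quartic_coeffs :: "int \<times> int \<times> int \<times> int \<Rightarrow> int \<times> int \<times> int \<times> int" where
  "quartic_coeffs = (\<lambda>(i, j, k, l). (- (i + j + k + l) mod P, (i*j + i*k + i*l + j*k + j*l + k*l) mod P,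
      - (i*j*k + i*j*l + i*k*l + j*k*l) mod P, (i*j*k*l) mod P))"

lemma quartic_quartic_coeffs:
  "[quartic (quartic_coeffs (i, j, k, l)) x = (x - i) * (x - j) * (x - k) * (x - l)] (mod P)"
proof -
  let ?a = "- (i + j + k + l)" and ?b = "i*j + i*k + i*l + j*k + j*l + k*l"
    and ?c = "- (i*j*k + i*j*l + i*k*l + j*k*l)" and ?d = "i*j*k*l"
  have "[quartic (quartic_coeffs (i, j, k, l)) x = quartic (?a, ?b, ?c, ?d) x] (mod P)"
    unfolding quartic_coeffs_def quartic_def prod.case
    by (intro cong_add cong_mult cong_refl cong_mod_leftI)
  also have "quartic (?a, ?b, ?c, ?d) x = (x - i) * (x - j) * (x - k) * (x - l)"
    by (simp add: quartic_def algebra_simps power2_eq_square power3_eq_cube power4_eq_xxxx)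
  finally show ?thesis .
qed

lemma char_sum_quartic: "char_sum v = (\<Sum>x\<in>F. chi (quartic (quartic_coeffs v) x))"
  by (cases v) (simp add: char_sum_def chi_cong[OF quartic_quartic_coeffs])

lemma card_quartic_coeffs_fibre_le: "card {v \<in> F4. quartic_coeffs v = c} \<le> 256"
proof (cases "{v \<in> F4. quartic_coeffs v = c} = {}")
  case False
  then obtain i j k l where ijkl: "i \<in> F" "j \<in> F" "k \<in> F" "l \<in> F" "quartic_coeffs (i, j, k, l) = c"
    by auto
  let ?R = "{i, j, k, l}"
  have root: "r \<in> ?R" if "r \<in> F" "P dvd quartic c r" for r
  proof -
    have "P dvd (r - i) * (r - j) * (r - k) * (r - l)"
      using quartic_quartic_coeffs[of i j k l r] that ijkl by (simp add: cong_dvd_iff)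
    then show ?thesis
      using eq_if_cong_F[OF \<open>r \<in> F\<close>] ijkl by (auto simp: dvd_mult_iff cong_iff_dvd_diff)
  qed
  have "{v \<in> F4. quartic_coeffs v = c} \<subseteq> ?R \<times> ?R \<times> ?R \<times> ?R"
  proof (rule subsetI)
    fix v assume "v \<in> {v \<in> F4. quartic_coeffs v = c}"
    then obtain x y z w where v: "v = (x, y, z, w)" "x \<in> F" "y \<in> F" "z \<in> F" "w \<in> F"
      "quartic_coeffs (x, y, z, w) = c"
      by auto
    have "P dvd quartic c r" if "r \<in> {x, y, z, w}" for r
      using quartic_quartic_coeffs[of x y z w r] that v by (auto simp: cong_dvd_iff)
    then have "x \<in> ?R" "y \<in> ?R" "z \<in> ?R" "w \<in> ?R"
      using root v by blast+
    then show "v \<in> ?R \<times> ?R \<times> ?R \<times> ?R"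
      unfolding v by blast
  qed
  then have "card {v \<in> F4. quartic_coeffs v = c} \<le> card (?R \<times> ?R \<times> ?R \<times> ?R)"
    by (intro card_mono finite_cartesian_product finite.intros)
  also have "\<dots> = card ?R ^ 4"
    by (simp only: card_cartesian_product power4_eq_xxxx mult.assoc)
  also have "\<dots> \<le> 4 ^ 4"
    by (intro power_mono) (simp_all add: card_insert_if)
  finally show ?thesis
    by simp
qed (simp only: card.empty)

lemma char_sum_moment: "(\<Sum>v\<in>F4. char_sum v ^ 4) \<le> 768 * real p ^ 6"
proof -
  let ?g = "\<lambda>c. (\<Sum>x\<in>F. chi (quartic c x)) ^ 4"
  have "(\<Sum>v\<in>F4. char_sum v ^ 4) = (\<Sum>v\<in>F4. ?g (quartic_coeffs v))"
    by (simp add: char_sum_quartic)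
  also have "\<dots> = (\<Sum>c\<in>F4. \<Sum>v | v \<in> F4 \<and> quartic_coeffs v = c. ?g (quartic_coeffs v))"
    using mod_in_F by (intro sum.group[symmetric]) (auto simp: quartic_coeffs_def)
  also have "\<dots> = (\<Sum>c\<in>F4. real (card {v \<in> F4. quartic_coeffs v = c}) * ?g c)"
    by (intro sum.cong refl) (simp del: mem_Sigma_iff)
  also have "\<dots> \<le> (\<Sum>c\<in>F4. 256 * ?g c)"
    using card_quartic_coeffs_fibre_le
    by (intro sum_mono mult_right_mono) (simp_all add: zero_le_even_power)
  also have "\<dots> \<le> 768 * real p ^ 6"
    using quartic_moment by (simp flip: sum_distrib_left)
  finally show ?thesis .
qed

end


section \<open>The cross-ratio operator\<close>

context odd_prime
begin

definition cross_kernel :: "int \<times> int \<Rightarrow> int \<times> int \<Rightarrow> real" where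
  "cross_kernel = (\<lambda>(i, j) (k, l). chi ((i - k) * (i - l) * (j - k) * (j - l)))"

abbreviation cross_op :: "(int \<times> int \<Rightarrow> real) \<Rightarrow> int \<times> int \<Rightarrow> real" where
  "cross_op \<equiv> kernel_op cross_kernel (F \<times> F)"

abbreviation cross_form :: "(int \<times> int \<Rightarrow> real) \<Rightarrow> (int \<times> int \<Rightarrow> real) \<Rightarrow> real" where
  "cross_form \<equiv> kernel_form (F \<times> F) (F \<times> F) cross_kernel"

abbreviation pair_norm :: "(int \<times> int \<Rightarrow> real) \<Rightarrow> real" where
  "pair_norm b \<equiv> L2_set b (F \<times> F)"

definition pair_char_sum :: "int \<times> int \<Rightarrow> int \<times> int \<Rightarrow> real" where
  "pair_char_sum = (\<lambda>(i, j) (k, l). char_sum (i, j, k, l))"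

lemma cross_kernel_commute: "cross_kernel q r = cross_kernel r q"
  by (cases q, cases r) (simp add: cross_kernel_def algebra_simps)

lemma cross_form_commute: "cross_form b c = cross_form c b"
  by (subst kernel_form_transpose) (simp add: cross_kernel_commute)

lemma cross_form_add_diag:
  "cross_form (\<lambda>q. b q + c q) (\<lambda>q. b q + c q)
    = cross_form b b + cross_form b c + cross_form (\<lambda>q. b q + c q) c"
  using cross_form_commute[of c b] by (simp add: kernel_form_add_left kernel_form_add_right)

lemma cross_kernel_Gram:
  "(\<Sum>r\<in>F \<times> F. cross_kernel r q * cross_kernel r q') = (pair_char_sum q q')\<^sup>2"
proof -
  obtain i j k l where q: "q = (i, j)" "q' = (k, l)"
    by (cases q, cases q')
  show ?thesis
    unfolding q sum.cartesian_product' cross_kernel_def pair_char_sum_def char_sum_def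
      power2_eq_square sum_product prod.case
    by (intro sum.cong refl) (simp add: chi_mult mult_ac)
qed

lemma pair_norm_cross_op_power2:
  "(pair_norm (cross_op b))\<^sup>2 = kernel_form (F \<times> F) (F \<times> F) (\<lambda>q r. (pair_char_sum q r)\<^sup>2) b b"
  by (simp only: L2_set_kernel_op_power2 cross_kernel_Gram)

lemma pair_char_sum_moment: "(\<Sum>q\<in>F \<times> F. \<Sum>r\<in>F \<times> F. ((pair_char_sum q r)\<^sup>2)\<^sup>2) \<le> 768 * real p ^ 6"
  using char_sum_moment by (simp add: sum.cartesian_product' pair_char_sum_def flip: power_mult)

lemma pair_char_sum_affine_pair:
  assumes not_dvd_u: "\<not> P dvd u"
  shows "pair_char_sum (affine_pair u v q) (affine_pair u v r) = pair_char_sum q r"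
proof -
  obtain i j k l where q: "q = (i, j)" "r = (k, l)"
    by (cases q, cases r)
  let ?\<phi> = "\<lambda>x. (u * x + v) mod P"
  let ?g = "\<lambda>x. chi ((x - ?\<phi> i) * (x - ?\<phi> j) * (x - ?\<phi> k) * (x - ?\<phi> l))"
  have "periodic ?g"
    by (intro periodicI chi_cong cong_intros)
  then have "(\<Sum>x\<in>F. ?g x) = (\<Sum>x\<in>F. ?g (u * x + v))"
    using sum_affine[of ?g u v] not_dvd_u by (simp add: coprime_P_iff)
  also have "\<dots> = (\<Sum>x\<in>F. chi ((x - i) * (x - j) * (x - k) * (x - l)))"
  proof (rule sum.cong[OF refl])
    fix x
    have "chi (u * x + v - ?\<phi> y) = chi u * chi (x - y)" for y
    proof -
      have "[u * x + v - ?\<phi> y = u * x + v - (u * y + v)] (mod P)"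
        by (intro cong_diff cong_refl cong_mod_leftI)
      then have "[u * x + v - ?\<phi> y = u * (x - y)] (mod P)"
        by (simp add: right_diff_distrib)
      then show ?thesis
        by (simp add: chi_cong chi_mult)
    qed
    then have "?g (u * x + v)
        = (chi u * chi u) * (chi u * chi u) * chi ((x - i) * (x - j) * (x - k) * (x - l))"
      by (simp add: chi_mult mult_ac)
    then show "?g (u * x + v) = chi ((x - i) * (x - j) * (x - k) * (x - l))"
      using not_dvd_u by (simp add: chi_mult_self)
  qed
  finally show ?thesis
    by (simp add: q pair_char_sum_def affine_pair_def char_sum_def)
qed

lemma kernel_form_affine_pair:
  assumes "\<not> P dvd u"
  shows "kernel_form (F \<times> F) (F \<times> F) (\<lambda>q r. (pair_char_sum q r)\<^sup>2)
    (\<lambda>q. b (affine_pair u v q)) (\<lambda>q. b (affine_pair u v q)) = (pair_norm (cross_op b))\<^sup>2"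
proof -
  have bij: "bij_betw (affine_pair u v) (F \<times> F) (F \<times> F)"
    using assms by (intro bij_betw_affine_pair) (simp add: coprime_P_iff)
  from kernel_form_reindex[OF bij bij, of "\<lambda>q r. (pair_char_sum q r)\<^sup>2" b b] show ?thesis
    by (simp add: pair_norm_cross_op_power2 pair_char_sum_affine_pair[OF assms])
qed

lemma pair_norm_cross_op_power4_le: "pair_norm (cross_op b) ^ 4 \<le> 768 * real p ^ 6 * pair_norm b ^ 4"
proof -
  have "real (card {()}) * ((pair_norm (cross_op b))\<^sup>2)\<^sup>2
      \<le> pair_norm b ^ 4 * (\<Sum>q\<in>F \<times> F. \<Sum>r\<in>F \<times> F. ((pair_char_sum q r)\<^sup>2)\<^sup>2)"
  proof (rule card_mult_kernel_form_power2_le)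
    show "(\<Sum>h\<in>{()}. (\<Sum>q\<in>F \<times> F. b q * b q)\<^sup>2) \<le> pair_norm b ^ 4"
      by (simp add: L2_set_mult_self eval_nat_numeral flip: mult.assoc)
  qed (simp_all add: pair_norm_cross_op_power2)
  also have "\<dots> \<le> pair_norm b ^ 4 * (768 * real p ^ 6)"
    by (intro mult_left_mono pair_char_sum_moment) simp
  finally show ?thesis
    by (simp add: mult.commute flip: power_mult)
qed

lemma affine_images_near_orthogonal:
  assumes periodic_b: "periodic2 b" and mean: "\<And>d. (\<Sum>x\<in>F. b (x, x + d)) = 0" and not_dvd_u: "\<not> P dvd u"
  shows "(\<Sum>(u', v')\<in>(F - {0}) \<times> F. (\<Sum>q\<in>F \<times> F. b (affine_pair u v q) * b (affine_pair u' v' q))\<^sup>2)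
    \<le> real p * pair_norm b ^ 4"
proof -
  let ?c = "\<lambda>q. b (affine_pair u v q)"
  have "(\<Sum>u'\<in>F - {0}. \<Sum>v'\<in>F. (\<Sum>q\<in>F \<times> F. ?c q * b (affine_pair u' v' q))\<^sup>2)
      \<le> real p * (pair_norm b)\<^sup>2 * (pair_norm ?c)\<^sup>2"
    by (rule affine_near_orthogonality[OF periodic_b periodic2_affine_pair mean])
  also have "pair_norm ?c = pair_norm b"
    using not_dvd_u by (simp add: L2_set_reindex_bij_betw[OF bij_betw_affine_pair] coprime_P_iff)
  finally show ?thesis
    by (simp add: sum.cartesian_product' eval_nat_numeral)
qed

text \<open>Averaging over the affine group replaces the multiplicity, about \<open>p\<close>, of the singular values
  of the operator outside the translation-invariant functions.\<close>

lemma pair_norm_cross_op_mean_zero_power4_le: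
  assumes periodic_b: "periodic2 b" and mean: "\<And>d. (\<Sum>x\<in>F. b (x, x + d)) = 0"
  shows "pair_norm (cross_op b) ^ 4 \<le> 1152 * real p ^ 5 * pair_norm b ^ 4"
proof -
  define G where "G = (F - {0}) \<times> F"
  define f where "f = (\<lambda>(u, v) q. b (affine_pair u v q))"
  have card_G: "real (card G) = (real p - 1) * real p"
    using p_ge_3 by (simp add: G_def card_cartesian_product of_nat_diff)
  have "real (card G) * ((pair_norm (cross_op b))\<^sup>2)\<^sup>2 \<le> (real p * pair_norm b ^ 4)
      * (\<Sum>q\<in>F \<times> F. \<Sum>r\<in>F \<times> F. ((pair_char_sum q r)\<^sup>2)\<^sup>2)"
  proof (rule card_mult_kernel_form_power2_le)
    show "finite G"
      by (simp add: G_def)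
    show "G \<noteq> {}"
      using card_G p_ge_3 by auto
  next
    fix g assume "g \<in> G"
    then obtain u v where g: "g = (u, v)" "\<not> P dvd u"
      using not_dvd_if_nonzero unfolding G_def by blast
    show "kernel_form (F \<times> F) (F \<times> F) (\<lambda>q r. (pair_char_sum q r)\<^sup>2) (f g) (f g)
        = (pair_norm (cross_op b))\<^sup>2"
      using g by (simp add: f_def kernel_form_affine_pair)
    show "(\<Sum>h\<in>G. (\<Sum>q\<in>F \<times> F. f g q * f h q)\<^sup>2) \<le> real p * pair_norm b ^ 4"
      using affine_images_near_orthogonal[OF periodic_b mean g(2)]
      by (simp add: G_def f_def g(1) case_prod_unfold)
  qed
  also have "\<dots> \<le> (real p * pair_norm b ^ 4) * (768 * real p ^ 6)"
    by (intro mult_left_mono pair_char_sum_moment) simp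
  finally have "real (card G) * pair_norm (cross_op b) ^ 4 \<le> 768 * real p ^ 7 * pair_norm b ^ 4"
    by (simp add: eval_nat_numeral mult_ac)
  moreover have "2 / 3 * (real p)\<^sup>2 * pair_norm (cross_op b) ^ 4
      \<le> real (card G) * pair_norm (cross_op b) ^ 4"
  proof (intro mult_right_mono)
    have "3 * real p \<le> real p * real p"
      using p_ge_3 by (intro mult_right_mono) auto
    then show "2 / 3 * (real p)\<^sup>2 \<le> real (card G)"
      unfolding card_G by (simp add: power2_eq_square algebra_simps)
  qed simp
  ultimately have "(real p)\<^sup>2 * pair_norm (cross_op b) ^ 4
      \<le> (real p)\<^sup>2 * (1152 * real p ^ 5 * pair_norm b ^ 4)"
    by (simp add: eval_nat_numeral mult_ac)
  then show ?thesis
    using p_pos by (simp add: mult_le_cancel_left_pos)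
qed

lemma pair_norm_cross_op_le: "pair_norm (cross_op b) \<le> 6 * real p powr (3 / 2) * pair_norm b"
proof -
  have "pair_norm (cross_op b) ^ 4 \<le> 6 ^ 4 * real p ^ 6 * pair_norm b ^ 4"
    by (rule order_trans[OF pair_norm_cross_op_power4_le]) (intro mult_right_mono, auto)
  from le_powr_if_power4_le[OF this] show ?thesis
    using p_pos by simp
qed

lemma pair_norm_cross_op_mean_zero_le:
  assumes "periodic2 b" "\<And>d. (\<Sum>x\<in>F. b (x, x + d)) = 0"
  shows "pair_norm (cross_op b) \<le> 6 * real p powr (5 / 4) * pair_norm b"
proof -
  have "pair_norm (cross_op b) ^ 4 \<le> 6 ^ 4 * real p ^ 5 * pair_norm b ^ 4"
    by (rule order_trans[OF pair_norm_cross_op_mean_zero_power4_le[OF assms]])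
      (intro mult_right_mono, auto)
  from le_powr_if_power4_le[OF this] show ?thesis
    using p_pos by simp
qed


subsection \<open>Translation-invariant functions\<close>

definition diag_avg :: "(int \<times> int \<Rightarrow> real) \<Rightarrow> int \<Rightarrow> real" where
  "diag_avg b d = (\<Sum>x\<in>F. b (x, x + d)) / real p"

definition toeplitz :: "(int \<Rightarrow> real) \<Rightarrow> int \<times> int \<Rightarrow> real" where
  "toeplitz f = (\<lambda>(x, y). f (y - x))"

lemma periodic_diag_avg:
  assumes "periodic2 b"
  shows "periodic (diag_avg b)"
  unfolding diag_avg_def
  by (intro periodicI arg_cong2[of _ _ _ _ "(/)"] sum.cong refl periodic2D[OF assms] cong_intros)

lemma periodic2_toeplitz: "periodic f \<Longrightarrow> periodic2 (toeplitz f)"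
  unfolding toeplitz_def by (rule periodic2I) (auto intro: periodicD cong_intros)

lemma pair_norm_toeplitz:
  assumes "periodic f"
  shows "pair_norm (toeplitz f) = sqrt (real p) * L2_set f F"
proof -
  have "periodic2 (\<lambda>q. (toeplitz f q)\<^sup>2)"
    using periodic2_toeplitz[OF assms] by (simp add: periodic2_def)
  then have "(\<Sum>q\<in>F \<times> F. (toeplitz f q)\<^sup>2) = real p * (\<Sum>d\<in>F. (f d)\<^sup>2)"
    by (simp add: sum_pairs_diagonals toeplitz_def sum_distrib_left)
  then show ?thesis
    by (simp add: L2_set_def real_sqrt_mult)
qed

lemma pair_norm_diag_avg_power2:
  assumes periodic_b: "periodic2 b"
  shows "(pair_norm (\<lambda>q. b q - toeplitz (diag_avg b) q))\<^sup>2 + (pair_norm (toeplitz (diag_avg b)))\<^sup>2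
    = (pair_norm b)\<^sup>2"
proof -
  let ?m = "diag_avg b"
  have diagonal: "(\<Sum>x\<in>F. (b (x, x + d) - ?m d)\<^sup>2 + (?m d)\<^sup>2) = (\<Sum>x\<in>F. (b (x, x + d))\<^sup>2)" for d
  proof -
    have "(\<Sum>x\<in>F. (b (x, x + d) - ?m d)\<^sup>2 + (?m d)\<^sup>2)
        = (\<Sum>x\<in>F. (b (x, x + d))\<^sup>2) - 2 * ?m d * ((\<Sum>x\<in>F. b (x, x + d)) - real p * ?m d)"
      by (simp add: power2_eq_square algebra_simps sum.distrib sum_subtractf flip: sum_distrib_left)
    then show ?thesis
      using p_pos by (simp add: diag_avg_def)
  qed
  have "periodic2 (\<lambda>q. (b q - toeplitz ?m q)\<^sup>2 + (toeplitz ?m q)\<^sup>2)" "periodic2 (\<lambda>q. (b q)\<^sup>2)"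
    using periodic_b periodic2_toeplitz[OF periodic_diag_avg[OF periodic_b]]
    by (simp_all add: periodic2_def)
  then have "(\<Sum>q\<in>F \<times> F. (b q - toeplitz ?m q)\<^sup>2 + (toeplitz ?m q)\<^sup>2) = (\<Sum>q\<in>F \<times> F. (b q)\<^sup>2)"
    by (simp add: sum_pairs_diagonals toeplitz_def diagonal)
  then show ?thesis
    by (simp add: L2_set_power2 sum.distrib)
qed

lemma pair_norm_toeplitz_diag_avg_le: "periodic2 b \<Longrightarrow> pair_norm (toeplitz (diag_avg b)) \<le> pair_norm b"
  by (rule power2_le_imp_le) (simp_all flip: pair_norm_diag_avg_power2)

lemma abs_cross_form_centered_le:
  assumes periodic_b: "periodic2 b"
  shows "\<bar>cross_form c (\<lambda>q. b q - toeplitz (diag_avg b) q)\<bar>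
    \<le> 6 * real p powr (5 / 4) * (pair_norm c * pair_norm b)"
proof -
  let ?b = "\<lambda>q. b q - toeplitz (diag_avg b) q"
  have "periodic2 ?b"
    using periodic_b periodic2_toeplitz[OF periodic_diag_avg[OF periodic_b]] by (simp add: periodic2_def)
  moreover have "(\<Sum>x\<in>F. ?b (x, x + d)) = 0" for d
    using p_pos by (simp add: toeplitz_def sum_subtractf diag_avg_def)
  ultimately have "pair_norm (cross_op ?b) \<le> 6 * real p powr (5 / 4) * pair_norm ?b"
    by (rule pair_norm_cross_op_mean_zero_le)
  also have "pair_norm ?b \<le> pair_norm b"
    by (rule power2_le_imp_le) (simp_all flip: pair_norm_diag_avg_power2[OF periodic_b])
  finally have "pair_norm (cross_op ?b) \<le> 6 * real p powr (5 / 4) * pair_norm b"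
    by (simp add: mult_left_mono)
  from abs_kernel_form_le_op_bound[OF this, of c] show ?thesis
    by (simp add: mult_ac)
qed

lemma abs_cross_form_small_le:
  assumes norm_c: "pair_norm c \<le> sqrt (real p) * s" and norm_d: "pair_norm d \<le> 3 / 2 * s"
  shows "\<bar>cross_form c d\<bar> \<le> 9 * real p powr (5 / 4) * (real p * s\<^sup>2)"
proof -
  have "0 \<le> s"
    using order_trans[OF L2_set_nonneg norm_d] by simp
  have powers: "sqrt (real p) * real p powr (3 / 2) = real p * real p"
    using p_pos by (simp add: power2_eq_square flip: powr_half_sqrt powr_add)
  have "\<bar>cross_form c d\<bar> \<le> pair_norm c * (6 * real p powr (3 / 2) * pair_norm d)"
    by (rule abs_kernel_form_le_op_bound[OF pair_norm_cross_op_le])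
  also have "\<dots> \<le> (sqrt (real p) * s) * (6 * real p powr (3 / 2) * (3 / 2 * s))"
    using \<open>0 \<le> s\<close> by (intro mult_mono norm_c norm_d) auto
  also have "\<dots> = 9 * (sqrt (real p) * real p powr (3 / 2)) * s\<^sup>2"
    by (simp add: power2_eq_square)
  also have "\<dots> = 9 * real p * (real p * s\<^sup>2)"
    by (simp add: powers)
  also have "\<dots> \<le> 9 * real p powr (5 / 4) * (real p * s\<^sup>2)"
    using p_pos powr_mono[of 1 "5 / 4" "real p"] by (intro mult_right_mono mult_left_mono) auto
  finally show ?thesis .
qed

definition punctured :: "(int \<Rightarrow> real) \<Rightarrow> int \<times> int \<Rightarrow> real" where
  "punctured f = (\<lambda>(x, y). of_bool (\<not> P dvd x \<and> \<not> P dvd y) * f (y - x))"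

definition inverted :: "(int \<Rightarrow> real) \<Rightarrow> int \<times> int \<Rightarrow> real" where
  "inverted f q = punctured f (map_prod recip recip q)"

lemma pair_norm_punctured_le: "pair_norm (punctured f) \<le> pair_norm (toeplitz f)"
proof -
  have "punctured f = (\<lambda>q. of_bool (\<not> P dvd fst q \<and> \<not> P dvd snd q) * toeplitz f q)"
    by (simp add: fun_eq_iff punctured_def toeplitz_def)
  then show ?thesis
    by (simp only: L2_set_mult_le) (simp add: L2_set_mult_le)
qed

lemma pair_norm_toeplitz_minus_punctured_le:
  assumes periodic: "periodic f"
  shows "pair_norm (\<lambda>q. toeplitz f q - punctured f q) \<le> 3 / 2 * L2_set f F"
proof (rule L2_set_leI)
  have "(\<Sum>q\<in>F \<times> F. (toeplitz f q - punctured f q)\<^sup>2)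
      \<le> (\<Sum>x\<in>F. \<Sum>y\<in>F. (f (y - x))\<^sup>2 * of_bool (x = 0) + (f (y - x))\<^sup>2 * of_bool (y = 0))"
    unfolding sum.cartesian_product' by (intro sum_mono) (auto simp: toeplitz_def punctured_def dvd_F_iff)
  also have "\<dots> = (\<Sum>y\<in>F. \<Sum>x\<in>F. (f (y - x))\<^sup>2 * of_bool (x = 0))
      + (\<Sum>x\<in>F. \<Sum>y\<in>F. (f (y - x))\<^sup>2 * of_bool (y = 0))"
    unfolding sum.distrib by (subst (1) sum.swap) (rule refl)
  also have "\<dots> = (\<Sum>y\<in>F. (f (y - 0))\<^sup>2) + (\<Sum>x\<in>F. (f (0 - x))\<^sup>2)"
    using p_pos by (intro arg_cong2[of _ _ _ _ "(+)"] sum.cong refl sum_mult_of_bool_delta) auto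
  also have "(\<Sum>x\<in>F. (f (0 - x))\<^sup>2) = (\<Sum>x\<in>F. (f x)\<^sup>2)"
    using periodic by (intro sum_reflect[of "\<lambda>x. (f x)\<^sup>2"]) (simp add: periodic_def)
  finally have "(\<Sum>q\<in>F \<times> F. (toeplitz f q - punctured f q)\<^sup>2) \<le> 2 * (L2_set f F)\<^sup>2"
    by (simp add: L2_set_power2)
  also have "\<dots> \<le> (3 / 2 * L2_set f F)\<^sup>2"
    by (simp add: power_mult_distrib power_divide)
  finally show "(\<Sum>q\<in>F \<times> F. (toeplitz f q - punctured f q)\<^sup>2) \<le> (3 / 2 * L2_set f F)\<^sup>2" .
qed simp

lemma bij_betw_recip_pair: "bij_betw (map_prod recip recip) (F \<times> F) (F \<times> F)"
proof -
  have "bij_betw recip F F"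
    using recip_recip recip_in_F by (intro bij_betw_byWitness[of F recip]) blast+
  from bij_betw_map_prod[OF this this] show ?thesis .
qed

lemma pair_norm_inverted_le: "pair_norm (inverted f) \<le> pair_norm (toeplitz f)"
  unfolding inverted_def L2_set_reindex_bij_betw[OF bij_betw_recip_pair] by (rule pair_norm_punctured_le)

lemma periodic2_inverted: "periodic2 (inverted f)"
  by (rule periodic2I) (simp add: inverted_def recip_cong)

lemma chi_recip_diff:
  assumes "\<not> P dvd x" "\<not> P dvd y"
  shows "chi (recip x - recip y) = chi x * chi y * chi (y - x)"
proof -
  have "[y * (x * recip x) - x * (y * recip y) = y * 1 - x * 1] (mod P)"
    by (intro cong_diff cong_mult cong_refl mult_recip_cong assms)
  then have "chi (x * y * (recip x - recip y)) = chi (y - x)"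
    by (intro chi_cong) (simp add: algebra_simps)
  then have "(chi x * chi x) * (chi y * chi y) * chi (recip x - recip y) = chi x * chi y * chi (y - x)"
    by (simp add: chi_mult mult_ac)
  then show ?thesis
    by (simp add: chi_mult_self assms)
qed

text \<open>The kernel is a function of the cross ratio of its four arguments, hence invariant under all
  Moebius transformations and not only under affine maps.\<close>

lemma cross_kernel_recip:
  assumes "\<not> P dvd i" "\<not> P dvd j" "\<not> P dvd k" "\<not> P dvd l"
  shows "cross_kernel (recip i, recip j) (recip k, recip l) = cross_kernel (i, j) (k, l)"
proof -
  have "cross_kernel (recip i, recip j) (recip k, recip l)
      = (chi i * chi i) * (chi j * chi j) * (chi k * chi k) * (chi l * chi l)
        * chi ((k - i) * (l - i) * (k - j) * (l - j))"
    by (simp add: cross_kernel_def chi_mult chi_recip_diff assms mult_ac)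
  also have "(k - i) * (l - i) * (k - j) * (l - j) = (i - k) * (i - l) * (j - k) * (j - l)"
    by (simp add: algebra_simps)
  finally show ?thesis
    by (simp add: chi_mult_self assms cross_kernel_def)
qed

lemma cross_form_inverted: "cross_form (inverted f) (inverted f) = cross_form (punctured f) (punctured f)"
proof -
  let ?R = "map_prod recip recip"
  have "cross_form (inverted f) (inverted f)
      = kernel_form (F \<times> F) (F \<times> F) (\<lambda>q r. cross_kernel (?R q) (?R r)) (inverted f) (inverted f)"
    by (rule kernel_form_cong)
      (auto simp: inverted_def punctured_def recip_dvd_iff cross_kernel_recip)
  also have "\<dots> = cross_form (punctured f) (punctured f)"
    unfolding inverted_def by (rule kernel_form_reindex[OF bij_betw_recip_pair bij_betw_recip_pair])
  finally show ?thesis .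
qed

lemma recip_diff_cong_iff:
  assumes "\<not> P dvd x" "\<not> P dvd y"
  shows "[recip y - recip x = s] (mod P) \<longleftrightarrow> [s * x * y = x - y] (mod P)"
proof -
  have "[x * (y * recip y) - y * (x * recip x) = x * 1 - y * 1] (mod P)"
    by (intro cong_diff cong_mult cong_refl mult_recip_cong assms)
  then have diff: "[x * y * (recip y - recip x) = x - y] (mod P)"
    by (simp add: algebra_simps)
  have "[recip y - recip x = s] (mod P) \<longleftrightarrow> [x * y * (recip y - recip x) = x * y * s] (mod P)"
    using assms by (simp add: cong_mult_cancel dvd_mult_iff)
  also have "\<dots> \<longleftrightarrow> [x - y = x * y * s] (mod P)"
    using diff by (simp add: cong_def)
  finally show ?thesis
    by (simp add: cong_sym_eq mult_ac)
qed

lemma inverted_as_sum: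
  assumes periodic: "periodic f" and zero: "f 0 = 0" and not_dvd_d: "\<not> P dvd d"
  shows "inverted f (x, x + d) = (\<Sum>s\<in>F. f s * of_bool [s * x\<^sup>2 + s * d * x + d = 0] (mod P))"
proof -
  have root_iff: "[s * x\<^sup>2 + s * d * x + d = 0] (mod P) \<longleftrightarrow> [s * x * (x + d) = x - (x + d)] (mod P)" for s
    by (simp add: cong_iff_dvd_diff power2_eq_square algebra_simps)
  show ?thesis
  proof (cases "P dvd x \<or> P dvd x + d")
    case True
    then have "\<not> [s * x * (x + d) = x - (x + d)] (mod P)" for s
      using not_dvd_d cong_dvd_iff[of "s * x * (x + d)" "x - (x + d)" P] by auto
    then show ?thesis
      using True by (auto simp: root_iff inverted_def punctured_def recip_dvd_iff)
  next
    case False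
    let ?t = "recip (x + d) - recip x"
    have "(\<Sum>s\<in>F. f s * of_bool [s * x\<^sup>2 + s * d * x + d = 0] (mod P))
        = (\<Sum>s\<in>F. f s * of_bool (s = ?t mod P))"
    proof (intro sum.cong refl)
      fix s assume "s \<in> F"
      have "[s * x\<^sup>2 + s * d * x + d = 0] (mod P) \<longleftrightarrow> [?t = s] (mod P)"
        unfolding root_iff using False by (intro recip_diff_cong_iff[symmetric]) auto
      also have "\<dots> \<longleftrightarrow> s = ?t mod P"
        unfolding cong_sym_eq[of ?t s] by (rule cong_iff_eq_mod[OF \<open>s \<in> F\<close>])
      finally show "f s * of_bool [s * x\<^sup>2 + s * d * x + d = 0] (mod P) = f s * of_bool (s = ?t mod P)"
        by simp
    qed
    also have "\<dots> = f (?t mod P)"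
      by (rule sum_mult_of_bool_delta) (simp_all only: mod_in_F finite_atLeastLessThan_int)
    also have "\<dots> = f ?t"
      by (rule periodicD[OF periodic]) simp
    finally show ?thesis
      using False by (simp add: inverted_def punctured_def recip_dvd_iff)
  qed
qed

text \<open>The number of \<open>x\<close> with \<open>1 / (x + d) - 1 / x = s\<close> is one plus the character of the discriminant
  of the quadratic equation for \<open>x\<close>.\<close>

lemma sum_inverted_diagonal:
  assumes periodic: "periodic f" and zero: "f 0 = 0" and not_dvd_d: "\<not> P dvd d"
  shows "(\<Sum>x\<in>F. inverted f (x, x + d)) = (\<Sum>s\<in>F. f s) + (\<Sum>s\<in>F. f s * chi s * chi (s - 4 * recip d))"
proof -
  have roots: "(\<Sum>x\<in>F. of_bool [s * x\<^sup>2 + s * d * x + d = 0] (mod P)) = 1 + chi s * chi (s - 4 * recip d)"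
    if s: "\<not> P dvd s" for s
  proof -
    have "[(s * d)\<^sup>2 - 4 * s * d * 1 = (s * d)\<^sup>2 - 4 * s * d * (d * recip d)] (mod P)"
      by (intro cong_diff cong_mult cong_refl cong_sym[OF mult_recip_cong[OF not_dvd_d]])
    also have "(s * d)\<^sup>2 - 4 * s * d * (d * recip d) = d * d * (s * (s - 4 * recip d))"
      by (simp add: power2_eq_square algebra_simps)
    finally have "chi ((s * d)\<^sup>2 - 4 * s * d) = (chi d * chi d) * (chi s * chi (s - 4 * recip d))"
      by (simp add: chi_cong chi_mult)
    then show ?thesis
      using not_dvd_d by (simp add: sum_roots_quadratic[OF s] chi_mult_self)
  qed
  have "(\<Sum>x\<in>F. inverted f (x, x + d))
      = (\<Sum>s\<in>F. \<Sum>x\<in>F. f s * of_bool [s * x\<^sup>2 + s * d * x + d = 0] (mod P))"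
    unfolding inverted_as_sum[OF periodic zero not_dvd_d] by (rule sum.swap)
  also have "\<dots> = (\<Sum>s\<in>F. f s + f s * chi s * chi (s - 4 * recip d))"
  proof (rule sum.cong[OF refl])
    fix s assume "s \<in> F"
    then show "(\<Sum>x\<in>F. f s * of_bool [s * x\<^sup>2 + s * d * x + d = 0] (mod P))
        = f s + f s * chi s * chi (s - 4 * recip d)"
      using zero roots[of s] dvd_F_iff[of s]
      by (cases "s = 0") (simp_all add: algebra_simps flip: sum_distrib_left)
  qed
  finally show ?thesis
    by (simp add: sum.distrib)
qed

lemma diag_avg_inverted:
  assumes "periodic f" "f 0 = 0" "\<not> P dvd d"
  shows "diag_avg (inverted f) d
    = (\<Sum>s\<in>F. f s) / real p + kernel_op (\<lambda>y s. chi (s - y)) F (\<lambda>s. chi s * f s) (4 * recip d) / real p"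
  by (simp add: diag_avg_def sum_inverted_diagonal[OF assms] kernel_op_def add_divide_distrib mult_ac)

lemma sum_chi_op_recip_power2_le:
  "(\<Sum>d\<in>F - {0}. (kernel_op (\<lambda>y s. chi (s - y)) F (\<lambda>s. chi s * f s) (4 * recip d))\<^sup>2)
    \<le> real p * (L2_set f F)\<^sup>2"
proof -
  define w where "w = kernel_op (\<lambda>y s. chi (s - y)) F (\<lambda>s. chi s * f s)"
  have "periodic w"
    unfolding w_def kernel_op_def
    by (intro periodic_sum periodicI arg_cong2[of _ _ _ _ "(*)"] chi_cong cong_intros refl)
  then have periodic_w2: "periodic (\<lambda>y. (w y)\<^sup>2)"
    by (simp add: periodic_def)
  have "(\<Sum>d\<in>F - {0}. (w (4 * recip d))\<^sup>2) \<le> (\<Sum>d\<in>F. (w (4 * recip d))\<^sup>2)"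
    by (intro sum_mono2) auto
  also have "\<dots> = (\<Sum>d\<in>F. (w (4 * d))\<^sup>2)"
    by (rule sum_recip)
  also have "\<dots> = (L2_set w F)\<^sup>2"
    using sum_affine[OF periodic_w2, of 4 0] not_dvd_4 by (simp add: coprime_P_iff L2_set_power2)
  also have "\<dots> \<le> (sqrt (real p) * L2_set f F)\<^sup>2"
  proof (intro power_mono)
    show "L2_set w F \<le> sqrt (real p) * L2_set f F"
      unfolding w_def using L2_set_mult_le[of F chi f] abs_chi_le_1
      by (intro order_trans[OF L2_set_chi_op_le] mult_left_mono) auto
  qed simp
  finally show ?thesis
    by (simp add: w_def power_mult_distrib)
qed

lemma L2_set_diag_avg_inverted_le:
  assumes periodic: "periodic f" and zero: "f 0 = 0"
  defines "m \<equiv> (\<Sum>s\<in>F. f s) / real p"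
  shows "sqrt (real p) * L2_set (\<lambda>d. diag_avg (inverted f) d - m) F \<le> 3 / 2 * L2_set f F"
proof (rule power2_le_imp_le)
  let ?\<delta> = "\<lambda>d. diag_avg (inverted f) d - m"
    and ?w = "kernel_op (\<lambda>y s. chi (s - y)) F (\<lambda>s. chi s * f s)"
  have "(\<Sum>d\<in>F - {0}. (?\<delta> d)\<^sup>2) = (\<Sum>d\<in>F - {0}. (?w (4 * recip d))\<^sup>2) / (real p)\<^sup>2"
    unfolding sum_divide_distrib
  proof (rule sum.cong[OF refl])
    fix d assume "d \<in> F - {0}"
    from diag_avg_inverted[OF periodic zero not_dvd_if_nonzero[OF this]]
    show "(?\<delta> d)\<^sup>2 = (?w (4 * recip d))\<^sup>2 / (real p)\<^sup>2"
      by (simp add: m_def power_divide)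
  qed
  also have "\<dots> \<le> real p * (L2_set f F)\<^sup>2 / (real p)\<^sup>2"
    by (intro divide_right_mono sum_chi_op_recip_power2_le) simp
  also have "\<dots> = (L2_set f F)\<^sup>2 / real p"
    by (simp add: power2_eq_square[of "real p"])
  finally have nonzero: "(\<Sum>d\<in>F - {0}. (?\<delta> d)\<^sup>2) \<le> (L2_set f F)\<^sup>2 / real p" .
  have "?\<delta> 0 = - m"
    by (simp add: diag_avg_def inverted_def punctured_def zero)
  moreover have "(\<Sum>s\<in>F. f s)\<^sup>2 \<le> real p * (L2_set f F)\<^sup>2"
    using sum_squared_le_sum_of_squares[of f F] by (simp add: L2_set_power2 mult.commute)
  then have "m\<^sup>2 \<le> (L2_set f F)\<^sup>2 / real p"
    using p_pos by (simp add: m_def power_divide divide_simps power2_eq_square mult.commute)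
  ultimately have "(\<Sum>d\<in>F. (?\<delta> d)\<^sup>2) \<le> 2 * (L2_set f F)\<^sup>2 / real p"
    using nonzero by (simp add: sum_F_split_0)
  then have "(sqrt (real p) * L2_set ?\<delta> F)\<^sup>2 \<le> 2 * (L2_set f F)\<^sup>2"
    using p_pos by (simp add: power_mult_distrib L2_set_power2 divide_simps mult_ac)
  then show "(sqrt (real p) * L2_set ?\<delta> F)\<^sup>2 \<le> (3 / 2 * L2_set f F)\<^sup>2"
    by (rule order_trans) (simp add: power_mult_distrib power_divide)
qed simp

lemma abs_cross_form_const_le:
  assumes "\<And>x. b (x, x) = 0"
  shows "\<bar>cross_form b (\<lambda>_. r)\<bar> \<le> \<bar>r\<bar> * real p * pair_norm b"
proof -
  have row_sum: "(\<Sum>s\<in>F \<times> F. cross_kernel q s) = 1" if "q \<in> F \<times> F" "b q \<noteq> 0" for q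
  proof -
    obtain i j where q: "q = (i, j)"
      by (cases q)
    have "(\<Sum>s\<in>F \<times> F. cross_kernel q s) = (\<Sum>k\<in>F. chi (i - k) * chi (j - k))\<^sup>2"
      unfolding q sum.cartesian_product' cross_kernel_def power2_eq_square sum_product prod.case
      by (intro sum.cong refl) (simp add: chi_mult mult_ac)
    moreover have "\<not> [i = j] (mod P)"
      using that assms q eq_if_cong_F[of i j] by auto
    ultimately show ?thesis
      by (simp add: sum_chi_mult_chi_reflected)
  qed
  have "cross_form b (\<lambda>_. r) = (\<Sum>q\<in>F \<times> F. r * (b q * (\<Sum>s\<in>F \<times> F. cross_kernel q s)))"
    by (simp add: kernel_form_def sum_distrib_left mult_ac)
  also have "\<dots> = (\<Sum>q\<in>F \<times> F. r * b q)"
  proof (rule sum.cong[OF refl])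
    fix q assume "q \<in> F \<times> F"
    then show "r * (b q * (\<Sum>s\<in>F \<times> F. cross_kernel q s)) = r * b q"
      using row_sum[of q] by (cases "b q = 0") simp_all
  qed
  also have "\<dots> = r * (\<Sum>q\<in>F \<times> F. b q)"
    by (rule sum_distrib_left[symmetric])
  finally show ?thesis
    using abs_sum_le_L2_set[of b "F \<times> F"]
    by (simp add: abs_mult card_cartesian_product mult_left_mono mult.assoc)
qed

lemma abs_cross_form_inverted_const_le:
  assumes periodic: "periodic f" and zero: "f 0 = 0"
  shows "\<bar>cross_form (inverted f) (\<lambda>_. (\<Sum>s\<in>F. f s) / real p)\<bar>
    \<le> real p powr (5 / 4) * (real p * (L2_set f F)\<^sup>2)"
proof -
  let ?m = "(\<Sum>s\<in>F. f s) / real p" and ?s = "L2_set f F"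
  have mean: "\<bar>?m\<bar> * real p \<le> sqrt (real p) * ?s"
    using abs_sum_le_L2_set[of f F] p_pos by simp
  have inverted: "pair_norm (inverted f) \<le> sqrt (real p) * ?s"
    using pair_norm_inverted_le[of f] by (simp add: pair_norm_toeplitz[OF periodic])
  have "\<bar>cross_form (inverted f) (\<lambda>_. ?m)\<bar> \<le> (\<bar>?m\<bar> * real p) * pair_norm (inverted f)"
    by (rule abs_cross_form_const_le) (simp add: inverted_def punctured_def zero)
  also have "\<dots> \<le> (sqrt (real p) * ?s) * (sqrt (real p) * ?s)"
    by (rule mult_mono[OF mean inverted]) simp_all
  also have "\<dots> = 1 * (real p * ?s\<^sup>2)"
    by (simp add: power_mult_distrib flip: power2_eq_square)
  also have "\<dots> \<le> real p powr (5 / 4) * (real p * ?s\<^sup>2)"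
    using p_pos by (intro mult_right_mono ge_one_powr_ge_zero) auto
  finally show ?thesis .
qed

lemma abs_cross_form_inverted_le:
  assumes periodic: "periodic f" and zero: "f 0 = 0"
  shows "\<bar>cross_form (inverted f) (inverted f)\<bar> \<le> 16 * real p powr (5 / 4) * (real p * (L2_set f F)\<^sup>2)"
proof -
  let ?\<rho> = "real p powr (5 / 4)" and ?s = "L2_set f F" and ?c = "inverted f"
  define m where "m = (\<Sum>s\<in>F. f s) / real p"
  define \<delta> where "\<delta> = (\<lambda>d. diag_avg ?c d - m)"
  let ?centered = "\<lambda>q. ?c q - toeplitz (diag_avg ?c) q"
  have norm: "pair_norm ?c \<le> sqrt (real p) * ?s"
    using pair_norm_inverted_le[of f] by (simp add: pair_norm_toeplitz[OF periodic])
  have norm_square: "pair_norm ?c * pair_norm ?c \<le> real p * ?s\<^sup>2"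
    using power_mono[OF norm, of 2] by (simp add: power_mult_distrib flip: power2_eq_square)
  have "?c = (\<lambda>q. ?centered q + (m + toeplitz \<delta> q))"
    by (auto simp: \<delta>_def toeplitz_def)
  from arg_cong[OF this, of "cross_form ?c"]
  have "cross_form ?c ?c = cross_form ?c ?centered + (cross_form ?c (\<lambda>_. m) + cross_form ?c (toeplitz \<delta>))"
    by (simp only: kernel_form_add_right)
  moreover have "\<bar>cross_form ?c ?centered\<bar> \<le> 6 * ?\<rho> * (real p * ?s\<^sup>2)"
    by (intro order_trans[OF abs_cross_form_centered_le[OF periodic2_inverted]] mult_left_mono
      norm_square) simp
  moreover have "\<bar>cross_form ?c (\<lambda>_. m)\<bar> \<le> ?\<rho> * (real p * ?s\<^sup>2)"
    unfolding m_def by (rule abs_cross_form_inverted_const_le[OF periodic zero])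
  moreover have "\<bar>cross_form ?c (toeplitz \<delta>)\<bar> \<le> 9 * ?\<rho> * (real p * ?s\<^sup>2)"
  proof (rule abs_cross_form_small_le[OF norm])
    have "periodic \<delta>"
      using periodic_diag_avg[OF periodic2_inverted[of f]] by (simp add: \<delta>_def periodic_def)
    then have "pair_norm (toeplitz \<delta>) = sqrt (real p) * L2_set \<delta> F"
      by (rule pair_norm_toeplitz)
    also have "\<dots> \<le> 3 / 2 * ?s"
      unfolding \<delta>_def m_def by (rule L2_set_diag_avg_inverted_le[OF periodic zero])
    finally show "pair_norm (toeplitz \<delta>) \<le> 3 / 2 * ?s" .
  qed
  ultimately show ?thesis
    by linarith
qed

lemma abs_cross_form_toeplitz_le:
  assumes periodic: "periodic f" and zero: "f 0 = 0"
  shows "\<bar>cross_form (toeplitz f) (toeplitz f)\<bar> \<le> 34 * real p powr (5 / 4) * (pair_norm (toeplitz f))\<^sup>2"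
proof -
  let ?\<rho> = "real p powr (5 / 4)" and ?s = "L2_set f F"
  let ?t = "toeplitz f" and ?t' = "punctured f"
  let ?r = "\<lambda>q. ?t q - ?t' q"
  have toeplitz: "pair_norm ?t = sqrt (real p) * ?s"
    by (rule pair_norm_toeplitz[OF periodic])
  have punctured: "pair_norm ?t' \<le> sqrt (real p) * ?s"
    using pair_norm_punctured_le[of f] by (simp add: toeplitz)
  have remainder: "pair_norm ?r \<le> 3 / 2 * ?s"
    by (rule pair_norm_toeplitz_minus_punctured_le[OF periodic])
  have "cross_form ?t ?t = cross_form ?t' ?t' + cross_form ?t' ?r + cross_form ?t ?r"
    using cross_form_add_diag[of ?t' ?r] by simp
  moreover have "\<bar>cross_form ?t' ?t'\<bar> \<le> 16 * ?\<rho> * (real p * ?s\<^sup>2)"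
    using abs_cross_form_inverted_le[OF periodic zero] by (simp only: cross_form_inverted)
  moreover have "\<bar>cross_form ?t' ?r\<bar> \<le> 9 * ?\<rho> * (real p * ?s\<^sup>2)"
    by (rule abs_cross_form_small_le[OF punctured remainder])
  moreover have "\<bar>cross_form ?t ?r\<bar> \<le> 9 * ?\<rho> * (real p * ?s\<^sup>2)"
    by (rule abs_cross_form_small_le[OF eq_refl[OF toeplitz] remainder])
  ultimately have "\<bar>cross_form ?t ?t\<bar> \<le> 34 * ?\<rho> * (real p * ?s\<^sup>2)"
    by linarith
  then show ?thesis
    by (simp add: toeplitz power_mult_distrib)
qed

lemma abs_cross_form_le:
  assumes periodic_b: "periodic2 b" and diagonal: "\<And>x. b (x, x) = 0"
  shows "\<bar>cross_form b b\<bar> \<le> 46 * real p powr (5 / 4) * (pair_norm b)\<^sup>2"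
proof -
  let ?\<rho> = "real p powr (5 / 4)" and ?t = "toeplitz (diag_avg b)"
  let ?centered = "\<lambda>q. b q - ?t q"
  have toeplitz: "pair_norm ?t \<le> pair_norm b"
    by (rule pair_norm_toeplitz_diag_avg_le[OF periodic_b])
  have centered: "\<bar>cross_form c ?centered\<bar> \<le> 6 * ?\<rho> * (pair_norm b)\<^sup>2" if "pair_norm c \<le> pair_norm b" for c
    unfolding power2_eq_square using that
    by (intro order_trans[OF abs_cross_form_centered_le[OF periodic_b]] mult_left_mono
      mult_right_mono) auto
  have "cross_form b b = cross_form ?t ?t + cross_form ?t ?centered + cross_form b ?centered"
    using cross_form_add_diag[of ?t ?centered] by simp
  moreover have "\<bar>cross_form ?t ?t\<bar> \<le> 34 * ?\<rho> * (pair_norm b)\<^sup>2"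
  proof -
    have "\<bar>cross_form ?t ?t\<bar> \<le> 34 * ?\<rho> * (pair_norm ?t)\<^sup>2"
      by (rule abs_cross_form_toeplitz_le[OF periodic_diag_avg[OF periodic_b]])
        (simp add: diag_avg_def diagonal)
    also have "\<dots> \<le> 34 * ?\<rho> * (pair_norm b)\<^sup>2"
      by (intro mult_left_mono power_mono toeplitz) auto
    finally show ?thesis .
  qed
  ultimately show ?thesis
    using centered[OF toeplitz] centered[OF order_refl] by linarith
qed

end


section \<open>Quadratic forms on pairs\<close>

definition vertex_pair_form ::
  "'a set \<Rightarrow> ('a \<Rightarrow> real) \<Rightarrow> ('a \<times> 'a \<Rightarrow> real) \<Rightarrow> ('a \<Rightarrow> 'a \<Rightarrow> 'a \<Rightarrow> real) \<Rightarrow> real" where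
  "vertex_pair_form A a b G = kernel_form A (A \<times> A) (\<lambda>i q. G i (fst q) (snd q)) a b"

definition pair_form ::
  "'a set \<Rightarrow> ('a \<times> 'a \<Rightarrow> real) \<Rightarrow> ('a \<Rightarrow> 'a \<Rightarrow> 'a \<Rightarrow> 'a \<Rightarrow> real) \<Rightarrow> real" where
  "pair_form A b G = kernel_form (A \<times> A) (A \<times> A) (\<lambda>q r. G (fst q) (snd q) (fst r) (snd r)) b b"

definition row_sum :: "'a set \<Rightarrow> ('a \<times> 'a \<Rightarrow> real) \<Rightarrow> 'a \<Rightarrow> real" where
  "row_sum A b i = (\<Sum>j\<in>A. b (i, j))"

lemma vertex_pair_form_add:
    "vertex_pair_form A a b (\<lambda>i j k. G i j k + H i j k)
      = vertex_pair_form A a b G + vertex_pair_form A a b H"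
  and vertex_pair_form_mult: "vertex_pair_form A a b (\<lambda>i j k. r * G i j k) = r * vertex_pair_form A a b G"
  and vertex_pair_form_divide: "vertex_pair_form A a b (\<lambda>i j k. G i j k / r)
      = vertex_pair_form A a b G / r"
  by (simp_all add: vertex_pair_form_def kernel_form_add kernel_form_mult kernel_form_divide)

lemma pair_form_add: "pair_form A b (\<lambda>i j k l. G i j k l + H i j k l) = pair_form A b G + pair_form A b H"
  and pair_form_mult: "pair_form A b (\<lambda>i j k l. r * G i j k l) = r * pair_form A b G"
  by (simp_all add: pair_form_def kernel_form_add kernel_form_mult kernel_form_divide)

lemma vertex_pair_form_cong:
  assumes "\<And>i j k. i \<in> A \<Longrightarrow> j \<in> A \<Longrightarrow> k \<in> A \<Longrightarrow> b (j, k) \<noteq> 0 \<Longrightarrow> G i j k = H i j k"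
  shows "vertex_pair_form A a b G = vertex_pair_form A a b H"
  unfolding vertex_pair_form_def by (rule kernel_form_cong) (auto intro: assms)

lemma pair_form_cong:
  assumes "\<And>i j k l. i \<in> A \<Longrightarrow> j \<in> A \<Longrightarrow> k \<in> A \<Longrightarrow> l \<in> A \<Longrightarrow> b (i, j) \<noteq> 0 \<Longrightarrow> b (k, l) \<noteq> 0 \<Longrightarrow>
    G i j k l = H i j k l"
  shows "pair_form A b G = pair_form A b H"
  unfolding pair_form_def by (rule kernel_form_cong) (auto intro: assms)

lemma vertex_pair_form_1: "vertex_pair_form A a b (\<lambda>_ _ _. 1) = (\<Sum>i\<in>A. a i) * (\<Sum>q\<in>A \<times> A. b q)"
  by (simp add: vertex_pair_form_def kernel_form_1)

lemma pair_form_1: "pair_form A b (\<lambda>_ _ _ _. 1) = (\<Sum>q\<in>A \<times> A. b q)\<^sup>2"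
  by (simp add: pair_form_def kernel_form_1 power2_eq_square)

lemma vertex_pair_form_row_sum: "vertex_pair_form A a b (\<lambda>i j k. H i j)
  = kernel_form A A H a (row_sum A b)"
  by (simp add: vertex_pair_form_def kernel_form_def sum.cartesian_product' row_sum_def
    sum_distrib_left sum_distrib_right)

lemma pair_form_row_sum: "pair_form A b (\<lambda>i j k l. H i k l) = vertex_pair_form A (row_sum A b) b H"
proof -
  have "pair_form A b (\<lambda>i j k l. H i k l) = (\<Sum>i\<in>A. \<Sum>j\<in>A. \<Sum>r\<in>A \<times> A. b (i, j) * b r * H i (fst r) (snd r))"
    by (simp add: pair_form_def kernel_form_def sum.cartesian_product'[of _ A A])
  also have "\<dots> = (\<Sum>i\<in>A. \<Sum>r\<in>A \<times> A. \<Sum>j\<in>A. b (i, j) * b r * H i (fst r) (snd r))"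
    by (intro sum.cong refl sum.swap)
  finally show ?thesis
    by (simp add: vertex_pair_form_def kernel_form_def row_sum_def sum_distrib_right)
qed

lemma L2_set_row_sum_le: "L2_set (row_sum A b) A \<le> sqrt (card A) * L2_set b (A \<times> A)"
proof (rule L2_set_leI)
  have "(\<Sum>i\<in>A. (row_sum A b i)\<^sup>2) \<le> (\<Sum>i\<in>A. (\<Sum>j\<in>A. (b (i, j))\<^sup>2) * card A)"
    unfolding row_sum_def by (intro sum_mono sum_squared_le_sum_of_squares)
  also have "\<dots> = (sqrt (card A) * L2_set b (A \<times> A))\<^sup>2"
    by (simp add: power_mult_distrib L2_set_power2 sum.cartesian_product' sum_distrib_left mult.commute)
  finally show "(\<Sum>i\<in>A. (row_sum A b i)\<^sup>2) \<le> (sqrt (card A) * L2_set b (A \<times> A))\<^sup>2" .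
qed simp

lemma abs_sum_mult_swap_le:
  assumes "\<And>q. q \<in> A \<times> A \<Longrightarrow> \<bar>g q\<bar> \<le> 1"
  shows "\<bar>\<Sum>q\<in>A \<times> A. g q * h q * h (prod.swap q)\<bar> \<le> (L2_set h (A \<times> A))\<^sup>2"
proof -
  have "\<bar>\<Sum>q\<in>A \<times> A. g q * h q * h (prod.swap q)\<bar>
      \<le> L2_set (\<lambda>q. g q * h q) (A \<times> A) * L2_set (\<lambda>q. h (prod.swap q)) (A \<times> A)"
    by (rule abs_sum_mult_le_L2_set)
  also have "\<dots> \<le> L2_set h (A \<times> A) * L2_set h (A \<times> A)"
    using L2_set_reindex_bij_betw[OF bij_betw_swap[of A A], of h]
    by (intro mult_mono L2_set_mult_le assms) auto
  finally show ?thesis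
    by (simp add: power2_eq_square)
qed

definition swap_invariant :: "('a \<times> 'a \<Rightarrow> 'b) \<Rightarrow> bool" where
  "swap_invariant b \<longleftrightarrow> (\<forall>q. b (prod.swap q) = b q)"

lemma swap_invariant_swap: "swap_invariant b \<Longrightarrow> b (prod.swap q) = b q"
  by (simp only: swap_invariant_def)

lemma swap_invariantD: "swap_invariant b \<Longrightarrow> b (x, y) = b (y, x)"
  unfolding swap_invariant_def by (metis prod.swap_def fst_conv snd_conv)

lemma swap_invariant_abs: "swap_invariant b \<Longrightarrow> swap_invariant (\<lambda>q. \<bar>b q\<bar>)"
  by (simp add: swap_invariant_def)

lemma vertex_pair_form_swap:
  assumes "swap_invariant b"
  shows "vertex_pair_form A a b G = vertex_pair_form A a b (\<lambda>i j k. G i k j)"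
  using kernel_form_reindex[OF bij_betw_id[of A] bij_betw_swap[of A A],
      where K = "\<lambda>i q. G i (fst q) (snd q)" and f = a and g = b]
  by (simp add: vertex_pair_form_def swap_invariant_swap[OF assms])

lemma pair_form_swap_left:
  assumes "swap_invariant b"
  shows "pair_form A b G = pair_form A b (\<lambda>i j k l. G j i k l)"
  using kernel_form_reindex[OF bij_betw_swap[of A A] bij_betw_id[of "A \<times> A"],
      where K = "\<lambda>q r. G (fst q) (snd q) (fst r) (snd r)" and f = b and g = b]
  by (simp add: pair_form_def swap_invariant_swap[OF assms])

lemma pair_form_swap_right:
  assumes "swap_invariant b"
  shows "pair_form A b G = pair_form A b (\<lambda>i j k l. G i j l k)"
  using kernel_form_reindex[OF bij_betw_id[of "A \<times> A"] bij_betw_swap[of A A],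
      where K = "\<lambda>q r. G (fst q) (snd q) (fst r) (snd r)" and f = b and g = b]
  by (simp add: pair_form_def swap_invariant_swap[OF assms])

lemma pair_form_transpose: "pair_form A b G = pair_form A b (\<lambda>i j k l. G k l i j)"
  unfolding pair_form_def by (rule kernel_form_transpose)


subsection \<open>Forms in the quadratic character\<close>

context odd_prime
begin

lemma abs_chi_form_le:
  "\<bar>kernel_form F F (\<lambda>x y. chi (x - y)) a c\<bar> \<le> sqrt (real p) * (L2_set a F * L2_set c F)"
  unfolding kernel_form_transpose[of F F _ a c]
  using abs_kernel_form_le_op_bound[OF L2_set_chi_op_le, of c a] by (simp add: mult_ac)

lemma abs_chi_vertex_pair_form_le:
  "\<bar>vertex_pair_form F a b (\<lambda>i j k. chi (i - j) * chi (i - k))\<bar> \<le> real p * (L2_set a F * pair_norm b)"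
  unfolding vertex_pair_form_def kernel_form_transpose[of F _ _ a b]
  using abs_kernel_form_le_op_bound[OF L2_set_chi_mult_chi_op_le, of b a] by (simp add: mult_ac)

text \<open>The factors \<open>chi (i - k)\<close>, \<open>chi (i - l)\<close>, \<open>chi (j - k)\<close>, \<open>chi (j - l)\<close> correspond to the edges of a
  four-cycle. The bounds are named after the subgraph formed by the factors that occur.\<close>

lemma abs_chi_edge_form_le:
  "\<bar>pair_form F b (\<lambda>i j k l. chi (i - k))\<bar> \<le> sqrt (real p) * (L2_set (row_sum F b) F)\<^sup>2"
  using abs_chi_form_le[of "row_sum F b" "row_sum F b"]
  by (simp add: pair_form_row_sum vertex_pair_form_row_sum power2_eq_square)

lemma abs_chi_cherry_form_le:
  "\<bar>pair_form F b (\<lambda>i j k l. chi (i - k) * chi (i - l))\<bar>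
    \<le> real p * (L2_set (row_sum F b) F * pair_norm b)"
  using abs_chi_vertex_pair_form_le[of "row_sum F b" b] by (simp add: pair_form_row_sum)

lemma abs_chi_cycle_form_le:
  assumes "periodic2 b" "\<And>x. b (x, x) = 0"
  shows "\<bar>pair_form F b (\<lambda>i j k l. chi (i - k) * chi (i - l) * chi (j - k) * chi (j - l))\<bar>
    \<le> 46 * real p powr (5 / 4) * (pair_norm b)\<^sup>2"
proof -
  have "pair_form F b (\<lambda>i j k l. chi (i - k) * chi (i - l) * chi (j - k) * chi (j - l)) = cross_form b b"
    by (simp add: pair_form_def cross_kernel_def case_prod_unfold chi_mult)
  then show ?thesis
    using abs_cross_form_le[OF assms] by simp
qed

end

locale paley = prime_modulus +
  assumes p_mod_4: "[p = 1] (mod 4)"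

sublocale paley \<subseteq> odd_prime
proof unfold_locales
  show "odd p"
    using p_mod_4 unfolding cong_def by presburger
qed

context paley
begin

lemma chi_commute: "chi (a - b) = chi (b - a)"
proof -
  have "even ((p - 1) div 2)"
    using p_mod_4 unfolding cong_def by presburger
  then have "[Legendre (- 1) P = 1] (mod P)"
    using Legendre_cong_power[of "- 1"] by simp
  then have "chi (- 1) = 1"
    by (simp add: chi_def Legendre_eqI)
  then show ?thesis
    using chi_mult[of "- 1" "b - a"] by simp
qed

definition chi_slices :: "(int \<times> int \<Rightarrow> real) \<Rightarrow> int \<times> int \<Rightarrow> real" where
  "chi_slices b = (\<lambda>(i, k). \<Sum>j\<in>F. chi (j - k) * b (i, j))"

lemma pair_norm_chi_slices_power2_le: "(pair_norm (chi_slices b))\<^sup>2 \<le> real p * (pair_norm b)\<^sup>2"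
proof -
  have "pair_norm (chi_slices b) \<le> sqrt (real p) * pair_norm b"
    using L2_set_kernel_op_slices_le[OF L2_set_chi_op_le, where A = F and b = b]
    by (simp add: chi_slices_def kernel_op_def)
  from power_mono[OF this, of 2] show ?thesis
    by (simp add: power_mult_distrib)
qed

lemma abs_chi_matching_form_le:
  assumes sym: "swap_invariant b"
  shows "\<bar>pair_form F b (\<lambda>i j k l. chi (i - k) * chi (j - l))\<bar> \<le> real p * (pair_norm b)\<^sup>2"
proof -
  have "pair_form F b (\<lambda>i j k l. chi (i - k) * chi (j - l))
      = (\<Sum>i\<in>F. \<Sum>j\<in>F. \<Sum>l\<in>F. \<Sum>k\<in>F. b (i, j) * b (k, l) * (chi (i - k) * chi (j - l)))"
    unfolding pair_form_def kernel_form_def sum.cartesian_product' fst_conv snd_conv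
    by (intro sum.cong refl sum.swap)
  also have "\<dots> = (\<Sum>i\<in>F. \<Sum>l\<in>F. \<Sum>j\<in>F. \<Sum>k\<in>F. b (i, j) * b (k, l) * (chi (i - k) * chi (j - l)))"
    by (intro sum.cong refl sum.swap)
  also have "\<dots> = (\<Sum>q\<in>F \<times> F. 1 * chi_slices b q * chi_slices b (prod.swap q))"
    unfolding sum.cartesian_product' chi_slices_def prod.case prod.swap_def fst_conv snd_conv mult_1
      sum_product
    by (intro sum.cong refl) (simp add: swap_invariantD[OF sym] chi_commute mult_ac)
  finally show ?thesis
    using abs_sum_mult_swap_le[of F "\<lambda>_. 1" "chi_slices b"] pair_norm_chi_slices_power2_le[of b] by simp
qed

lemma abs_chi_path_form_le:
  "\<bar>pair_form F b (\<lambda>i j k l. chi (i - k) * chi (i - l) * chi (j - k))\<bar> \<le> real p * (pair_norm b)\<^sup>2"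
proof -
  have "pair_form F b (\<lambda>i j k l. chi (i - k) * chi (i - l) * chi (j - k))
      = (\<Sum>i\<in>F. \<Sum>k\<in>F. \<Sum>j\<in>F. \<Sum>l\<in>F. b (i, j) * b (k, l) * (chi (i - k) * chi (i - l) * chi (j - k)))"
    unfolding pair_form_def kernel_form_def sum.cartesian_product' fst_conv snd_conv
    by (intro sum.cong refl sum.swap)
  also have "\<dots> = (\<Sum>q\<in>F \<times> F. chi (fst q - snd q) * chi_slices b q * chi_slices b (prod.swap q))"
    unfolding sum.cartesian_product' chi_slices_def prod.case prod.swap_def fst_conv snd_conv
      mult.assoc sum_product
    unfolding sum_distrib_left
    by (intro sum.cong refl) (simp add: chi_commute mult_ac)
  finally show ?thesis
    using abs_sum_mult_swap_le[of F "\<lambda>q. chi (fst q - snd q)" "chi_slices b"] abs_chi_le_1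
      pair_norm_chi_slices_power2_le[of b] by simp
qed


subsection \<open>Forms in the adjacency matrix\<close>

definition edge :: "int \<Rightarrow> int \<Rightarrow> real" where
  "edge i j = of_bool (chi (i - j) = 1)"

definition half_chi :: "int \<Rightarrow> int \<Rightarrow> real" where
  "half_chi i j = (1 + chi (i - j)) / 2"

lemma half_chi_bounds: "0 \<le> half_chi i j" "half_chi i j \<le> 1"
  using abs_chi_le_1[of "i - j"] by (auto simp: half_chi_def)

lemma edge_bounds: "0 \<le> edge i j" "edge i j \<le> 1"
  by (simp_all add: edge_def)

lemma edge_commute: "edge i j = edge j i"
  by (simp add: edge_def chi_commute[of i j])

lemma edge_self [simp]: "edge i i = 0"
  by (simp add: edge_def)

lemma edge_eq_half_chi:
  assumes "i \<in> F" "j \<in> F" "i \<noteq> j"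
  shows "edge i j = half_chi i j"
proof -
  have "\<not> P dvd i - j"
    using eq_if_cong_F[OF assms(1,2)] assms(3) by (auto simp: cong_iff_dvd_diff)
  then have "chi (i - j) = 1 \<or> chi (i - j) = - 1"
    using chi_mult_self[of "i - j"] by (simp add: square_eq_1_iff)
  then show ?thesis
    by (auto simp: edge_def half_chi_def)
qed

lemma edge_form_ge:
  "kernel_form F F edge a a \<ge> (\<Sum>i\<in>F. a i)\<^sup>2 / 2 - sqrt (real p) * (L2_set a F)\<^sup>2"
proof -
  let ?C = "kernel_form F F (\<lambda>i j. chi (i - j)) a a"
  have "kernel_form F F edge a a
      = kernel_form F F (\<lambda>i j. 1 / 2 + chi (i - j) / 2 - of_bool (i = j) / 2) a a"
    by (rule kernel_form_cong) (simp add: edge_eq_half_chi half_chi_def add_divide_distrib)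
  also have "\<dots> = (\<Sum>i\<in>F. a i)\<^sup>2 / 2 + ?C / 2 - (L2_set a F)\<^sup>2 / 2"
    by (simp add: kernel_form_add kernel_form_diff kernel_form_divide kernel_form_1 kernel_form_diagonal
        L2_set_mult_self power2_eq_square)
  finally show ?thesis
    using abs_chi_form_le[of a a] mult_right_mono[OF one_le_sqrt_p, of "(L2_set a F)\<^sup>2"]
    by (simp add: power2_eq_square abs_le_iff)
qed

lemma abs_edge_vertex_pair_form_diff_half_chi_le:
  assumes sym: "swap_invariant b"
  shows "\<bar>vertex_pair_form F a b (\<lambda>i j k. edge i j * edge i k)
      - vertex_pair_form F a b (\<lambda>i j k. half_chi i j * half_chi i k)\<bar>
    \<le> 2 * sqrt (real p) * (L2_set a F * pair_norm b)"
proof -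
  let ?a = "\<lambda>i. \<bar>a i\<bar>" and ?b = "\<lambda>q. \<bar>b q\<bar>"
  have pointwise: "\<bar>edge i j * edge i k - half_chi i j * half_chi i k\<bar>
      \<le> of_bool (i = j) + of_bool (i = k)"
    if "i \<in> F" "j \<in> F" "k \<in> F" for i j k
  proof (cases "i = j \<or> i = k")
    case True
    have pointwise: "\<bar>edge i j * edge i k - half_chi i j * half_chi i k\<bar> \<le> 1"
      by (intro abs_diff_le_1 mult_nonneg_nonneg mult_le_one edge_bounds half_chi_bounds)
    then show ?thesis
      using True by auto
  qed (use that in \<open>simp add: edge_eq_half_chi\<close>)
  have "\<bar>vertex_pair_form F a b (\<lambda>i j k. edge i j * edge i k)
      - vertex_pair_form F a b (\<lambda>i j k. half_chi i j * half_chi i k)\<bar>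
      \<le> vertex_pair_form F ?a ?b (\<lambda>i j k. of_bool (i = j) + of_bool (i = k))"
    unfolding vertex_pair_form_def by (rule abs_kernel_form_diff_le) (rule pointwise, auto)
  also have "\<dots> = 2 * vertex_pair_form F ?a ?b (\<lambda>i j k. of_bool (i = j))"
    using vertex_pair_form_swap[OF swap_invariant_abs[OF sym], of F ?a "\<lambda>i j k. of_bool (i = k)"]
    by (simp add: vertex_pair_form_add)
  also have "\<dots> = 2 * (\<Sum>i\<in>F. ?a i * row_sum F ?b i)"
    by (simp add: vertex_pair_form_row_sum kernel_form_diagonal)
  also have "\<dots> \<le> 2 * (L2_set ?a F * L2_set (row_sum F ?b) F)"
    using abs_sum_mult_le_L2_set[of ?a "row_sum F ?b" F] by simp
  also have "\<dots> \<le> 2 * (L2_set a F * (sqrt (real p) * pair_norm b))"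
    using L2_set_row_sum_le[of F ?b] by (intro mult_left_mono) (auto intro: mult_left_mono)
  finally show ?thesis
    by (simp add: mult_ac)
qed

lemma edge_vertex_pair_form_ge:
  assumes sym: "swap_invariant b"
  shows "vertex_pair_form F a b (\<lambda>i j k. edge i j * edge i k)
    \<ge> (\<Sum>i\<in>F. a i) * (\<Sum>q\<in>F \<times> F. b q) / 4
      - (sqrt (real p) * (L2_set a F * L2_set (row_sum F b) F) / 2
        + 9 / 4 * (real p * (L2_set a F * pair_norm b)))"
proof -
  let ?V = "vertex_pair_form F a b"
  have "?V (\<lambda>i j k. half_chi i j * half_chi i k)
      = ?V (\<lambda>i j k. (1 + chi (i - j) + chi (i - k) + chi (i - j) * chi (i - k)) / 4)"
    by (simp add: half_chi_def field_simps)
  also have "\<dots> = ((\<Sum>i\<in>F. a i) * (\<Sum>q\<in>F \<times> F. b q) + ?V (\<lambda>i j k. chi (i - j))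
      + ?V (\<lambda>i j k. chi (i - k)) + ?V (\<lambda>i j k. chi (i - j) * chi (i - k))) / 4"
    by (simp only: vertex_pair_form_divide vertex_pair_form_add vertex_pair_form_1)
  also have "?V (\<lambda>i j k. chi (i - k)) = ?V (\<lambda>i j k. chi (i - j))"
    by (rule vertex_pair_form_swap[OF sym])
  also have "?V (\<lambda>i j k. chi (i - j)) = kernel_form F F (\<lambda>i j. chi (i - j)) a (row_sum F b)"
    by (rule vertex_pair_form_row_sum)
  finally show ?thesis
    using abs_edge_vertex_pair_form_diff_half_chi_le[OF sym, of a] abs_chi_form_le[of a "row_sum F b"]
      abs_chi_vertex_pair_form_le[of a b] mult_right_mono[OF sqrt_p_le, of "L2_set a F * pair_norm b"]
    by (simp add: abs_le_iff field_simps)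
qed

lemma edge_shared_vertex_form_ge:
  "pair_form F b (\<lambda>i j k l. of_bool (i = k) * edge j l)
    \<ge> (L2_set (row_sum F b) F)\<^sup>2 / 2 - sqrt (real p) * (pair_norm b)\<^sup>2"
proof -
  have "(L2_set (row_sum F b) F)\<^sup>2 / 2 - sqrt (real p) * (pair_norm b)\<^sup>2
      = (\<Sum>i\<in>F. (\<Sum>j\<in>F. b (i, j))\<^sup>2 / 2 - sqrt (real p) * (L2_set (\<lambda>j. b (i, j)) F)\<^sup>2)"
    by (simp add: L2_set_power2 row_sum_def sum.cartesian_product' sum_subtractf
        flip: sum_divide_distrib sum_distrib_left)
  also have "\<dots> \<le> (\<Sum>i\<in>F. kernel_form F F edge (\<lambda>j. b (i, j)) (\<lambda>j. b (i, j)))"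
    by (intro sum_mono edge_form_ge)
  also have "\<dots> = pair_form F b (\<lambda>i j k l. of_bool (i = k) * edge j l)"
  proof -
    have "(\<Sum>k\<in>F. \<Sum>l\<in>F. b (i, j) * b (k, l) * (of_bool (i = k) * edge j l))
        = (\<Sum>l\<in>F. b (i, j) * b (i, l) * edge j l)" if "i \<in> F" for i j
    proof -
      have "(\<Sum>k\<in>F. \<Sum>l\<in>F. b (i, j) * b (k, l) * (of_bool (i = k) * edge j l))
          = (\<Sum>k\<in>F. (\<Sum>l\<in>F. b (i, j) * b (k, l) * edge j l) * of_bool (i = k))"
        unfolding sum_distrib_right by (intro sum.cong refl) (simp add: mult_ac)
      then show ?thesis
        using that by (simp only: sum_mult_of_bool_delta finite_atLeastLessThan_int)
    qed
    then show ?thesis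
      by (simp add: kernel_form_def pair_form_def sum.cartesian_product')
  qed
  finally show ?thesis .
qed

lemma abs_edge_pair_form_diff_half_chi_le:
  assumes sym: "swap_invariant b"
  shows "\<bar>pair_form F b (\<lambda>i j k l. edge i k * edge i l * edge j k * edge j l)
      - pair_form F b (\<lambda>i j k l. half_chi i k * half_chi i l * half_chi j k * half_chi j l)\<bar>
    \<le> 4 * (real p * (pair_norm b)\<^sup>2)"
proof -
  let ?b = "\<lambda>q. \<bar>b q\<bar>"
  let ?G = "\<lambda>i j k l. edge i k * edge i l * edge j k * edge j l"
  let ?H = "\<lambda>i j k l. half_chi i k * half_chi i l * half_chi j k * half_chi j l"
  have pointwise: "\<bar>?G i j k l - ?H i j k l\<bar>
      \<le> of_bool (i = k) + of_bool (i = l) + of_bool (j = k) + of_bool (j = l)"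
    if "i \<in> F" "j \<in> F" "k \<in> F" "l \<in> F" for i j k l
  proof (cases "i = k \<or> i = l \<or> j = k \<or> j = l")
    case True
    have "\<bar>?G i j k l - ?H i j k l\<bar> \<le> 1"
      by (intro abs_diff_le_1 mult_nonneg_nonneg mult_le_one edge_bounds half_chi_bounds)
    then show ?thesis
      using True by auto
  qed (use that in \<open>simp add: edge_eq_half_chi\<close>)
  have "\<bar>pair_form F b ?G - pair_form F b ?H\<bar>
      \<le> pair_form F ?b (\<lambda>i j k l. of_bool (i = k) + of_bool (i = l) + of_bool (j = k) + of_bool (j = l))"
    unfolding pair_form_def by (rule abs_kernel_form_diff_le) (rule pointwise, auto)
  also have "\<dots> = 4 * pair_form F ?b (\<lambda>i j k l. of_bool (i = k))"
    using pair_form_swap_right[OF swap_invariant_abs[OF sym], of F "\<lambda>i j k l. of_bool (i = l)"]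
      pair_form_swap_right[OF swap_invariant_abs[OF sym], of F "\<lambda>i j k l. of_bool (j = l)"]
      pair_form_swap_left[OF swap_invariant_abs[OF sym], of F "\<lambda>i j k l. of_bool (j = k)"]
    by (simp add: pair_form_add)
  also have "\<dots> = 4 * (L2_set (row_sum F ?b) F)\<^sup>2"
    by (simp add: pair_form_row_sum vertex_pair_form_row_sum kernel_form_diagonal L2_set_mult_self
      power2_eq_square)
  also have "\<dots> \<le> 4 * (sqrt (real p) * pair_norm b)\<^sup>2"
    using L2_set_row_sum_le[of F ?b] by (intro mult_left_mono power_mono) auto
  finally show ?thesis
    by (simp add: power_mult_distrib)
qed

lemma half_chi_pair_form_eq:
  assumes sym: "swap_invariant b"
  shows "16 * pair_form F b (\<lambda>i j k l. half_chi i k * half_chi i l * half_chi j k * half_chi j l)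
    = (\<Sum>q\<in>F \<times> F. b q)\<^sup>2 + 4 * pair_form F b (\<lambda>i j k l. chi (i - k))
      + 4 * pair_form F b (\<lambda>i j k l. chi (i - k) * chi (i - l))
      + 2 * pair_form F b (\<lambda>i j k l. chi (i - k) * chi (j - l))
      + 4 * pair_form F b (\<lambda>i j k l. chi (i - k) * chi (i - l) * chi (j - k))
      + pair_form F b (\<lambda>i j k l. chi (i - k) * chi (i - l) * chi (j - k) * chi (j - l))"
proof -
  let ?Q = "pair_form F b"
  note left = pair_form_swap_left[OF sym] and right = pair_form_swap_right[OF sym]
  have edges: "?Q (\<lambda>i j k l. chi (i - l)) = ?Q (\<lambda>i j k l. chi (i - k))"
    "?Q (\<lambda>i j k l. chi (j - k)) = ?Q (\<lambda>i j k l. chi (i - k))"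
    "?Q (\<lambda>i j k l. chi (j - l)) = ?Q (\<lambda>i j k l. chi (i - k))"
    by (rule right, rule left, rule trans[OF left right])
  have column: "?Q (\<lambda>i j k l. chi (i - k) * chi (j - k)) = ?Q (\<lambda>i j k l. chi (i - k) * chi (i - l))"
    by (rule trans[OF pair_form_transpose]) (simp add: chi_commute)
  have cherries: "?Q (\<lambda>i j k l. chi (j - k) * chi (j - l)) = ?Q (\<lambda>i j k l. chi (i - k) * chi (i - l))"
    "?Q (\<lambda>i j k l. chi (i - l) * chi (j - l)) = ?Q (\<lambda>i j k l. chi (i - k) * chi (i - l))"
    by (rule left, rule trans[OF right column])
  have matchings: "?Q (\<lambda>i j k l. chi (i - l) * chi (j - k)) = ?Q (\<lambda>i j k l. chi (i - k) * chi (j - l))"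
    by (rule right)
  have paths:
    "?Q (\<lambda>i j k l. chi (i - k) * chi (i - l) * chi (j - l))
      = ?Q (\<lambda>i j k l. chi (i - k) * chi (i - l) * chi (j - k))"
    "?Q (\<lambda>i j k l. chi (i - k) * chi (j - k) * chi (j - l))
      = ?Q (\<lambda>i j k l. chi (i - k) * chi (i - l) * chi (j - k))"
    "?Q (\<lambda>i j k l. chi (i - l) * chi (j - k) * chi (j - l))
      = ?Q (\<lambda>i j k l. chi (i - k) * chi (i - l) * chi (j - k))"
    by (rule trans[OF right], simp add: mult_ac, rule trans[OF left], simp add: mult_ac,
        rule trans[OF left trans[OF right]], simp add: mult_ac)
  have "16 * (half_chi i k * half_chi i l * half_chi j k * half_chi j l)
      = 1 + chi (i - k) + chi (i - l) + chi (j - k) + chi (j - l)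
        + chi (i - k) * chi (i - l) + chi (j - k) * chi (j - l) + chi (i - k) * chi (j - k)
        + chi (i - l) * chi (j - l) + chi (i - k) * chi (j - l) + chi (i - l) * chi (j - k)
        + chi (i - k) * chi (i - l) * chi (j - k) + chi (i - k) * chi (i - l) * chi (j - l)
        + chi (i - k) * chi (j - k) * chi (j - l) + chi (i - l) * chi (j - k) * chi (j - l)
        + chi (i - k) * chi (i - l) * chi (j - k) * chi (j - l)" for i j k l
    by (simp add: half_chi_def field_simps)
  then show ?thesis
    by (simp only: pair_form_add pair_form_1 edges cherries column matchings paths
      pair_form_mult[symmetric, of 16])
qed

lemma half_chi_pair_form_ge:
  assumes sym: "swap_invariant b" and periodic: "periodic2 b" and diagonal: "\<And>x. b (x, x) = 0"
  shows "pair_form F b (\<lambda>i j k l. half_chi i k * half_chi i l * half_chi j k * half_chi j l)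
    \<ge> (\<Sum>q\<in>F \<times> F. b q)\<^sup>2 / 16 - (4 * (sqrt (real p) * (L2_set (row_sum F b) F)\<^sup>2)
        + 4 * (real p * (L2_set (row_sum F b) F * pair_norm b))
        + (6 * real p + 46 * real p powr (5 / 4)) * (pair_norm b)\<^sup>2) / 16"
  using half_chi_pair_form_eq[OF sym] abs_chi_edge_form_le[of b] abs_chi_cherry_form_le[of b]
    abs_chi_matching_form_le[OF sym] abs_chi_path_form_le[of b]
    abs_chi_cycle_form_le[OF periodic diagonal]
  by (simp add: abs_le_iff field_simps)

lemma edge_pair_form_ge:
  assumes sym: "swap_invariant b" and periodic: "periodic2 b" and diagonal: "\<And>x. b (x, x) = 0"
  shows "pair_form F b (\<lambda>i j k l. edge i k * edge i l * edge j k * edge j l)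
    \<ge> (\<Sum>q\<in>F \<times> F. b q)\<^sup>2 / 16 - (sqrt (real p) * (L2_set (row_sum F b) F)\<^sup>2 / 4
        + real p * (L2_set (row_sum F b) F * pair_norm b) / 4
        + 29 / 4 * (real p powr (5 / 4) * (pair_norm b)\<^sup>2))"
proof -
  have "real p * (pair_norm b)\<^sup>2 \<le> real p powr (5 / 4) * (pair_norm b)\<^sup>2"
    using powr_mono[of 1 "5 / 4" "real p"] p_pos by (intro mult_right_mono) auto
  then show ?thesis
    using abs_edge_pair_form_diff_half_chi_le[OF sym] half_chi_pair_form_ge[OF assms]
    by (simp add: abs_le_iff field_simps)
qed

end


subsection \<open>Positivity\<close>

text \<open>The left-hand side collects the error terms of the moment form after rescaling the norms of \<open>a\<close>, of
  the row sums of \<open>b\<close> and of \<open>b\<close> to \<open>X\<close>, \<open>Y\<close>, \<open>Z\<close>.\<close>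

lemma rescaled_errors_le:
  fixes X Y Z \<alpha> \<beta> \<gamma> :: real
  assumes nonneg: "0 \<le> X" "0 \<le> Y" "0 \<le> Z" and small: "\<alpha> \<le> 1 / 20000" "\<beta> \<le> 1 / 20000" "\<gamma> \<le> 1 / 20000"
  shows "4 * (\<alpha> * X\<^sup>2) + 16 * (X * Y) + 128 * (\<alpha> * (X * Y)) + 576 * (\<beta> * (X * Z)) + 512 * (\<alpha> * Z\<^sup>2)
      + 4096 * (\<alpha> * Y\<^sup>2) + 4096 * (\<beta> * (Y * Z)) + 118784 * (\<gamma> * Z\<^sup>2)
    \<le> X\<^sup>2 + 8 * Z\<^sup>2 + 256 * Y\<^sup>2"
proof -
  have "\<alpha> * X\<^sup>2 \<le> 1 / 20000 * X\<^sup>2" "\<alpha> * (X * Y) \<le> 1 / 20000 * (X * Y)" "\<beta> * (X * Z) \<le> 1 / 20000 * (X * Z)"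
    "\<alpha> * Z\<^sup>2 \<le> 1 / 20000 * Z\<^sup>2" "\<alpha> * Y\<^sup>2 \<le> 1 / 20000 * Y\<^sup>2" "\<beta> * (Y * Z) \<le> 1 / 20000 * (Y * Z)"
    "\<gamma> * Z\<^sup>2 \<le> 1 / 20000 * Z\<^sup>2"
    by (intro mult_right_mono small; simp add: nonneg)+
  moreover have "2 * (X * Z) \<le> X\<^sup>2 + Z\<^sup>2" "2 * (Y * Z) \<le> Y\<^sup>2 + Z\<^sup>2" "32 * (X * Y) \<le> X\<^sup>2 + 256 * Y\<^sup>2"
    using sum_squares_bound[of X Z] sum_squares_bound[of Y Z] sum_squares_bound[of X "16 * Y"]
    by (simp_all add: power_mult_distrib mult.assoc)
  moreover have "0 \<le> X\<^sup>2" "0 \<le> Y\<^sup>2" "0 \<le> Z\<^sup>2"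
    by simp_all
  ultimately show ?thesis
    by linarith
qed

context paley
begin

context
  fixes a :: "int \<Rightarrow> real" and b :: "int \<times> int \<Rightarrow> real" and t :: real
  assumes sym: "swap_invariant b" and periodic: "periodic2 b" and diagonal: "\<And>x. b (x, x) = 0"
    and t: "0 < t"
begin

private definition s where "s = t * (\<Sum>i\<in>F. a i)"
private definition B where "B = t\<^sup>2 * (\<Sum>q\<in>F \<times> F. b q)"

private definition X where "X = sqrt t * L2_set a F"
private definition Y where "Y = t * sqrt t * L2_set (row_sum F b) F"
private definition Z where "Z = t * pair_norm b"

private definition \<alpha> where "\<alpha> = t * sqrt (real p)"
private definition \<beta> where "\<beta> = t * sqrt t * real p"
private definition \<gamma> where "\<gamma> = t\<^sup>2 * real p powr (5 / 4)"

private lemma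
  shows X_power2: "X\<^sup>2 = t * (L2_set a F)\<^sup>2"
    and Y_power2: "Y\<^sup>2 = t ^ 3 * (L2_set (row_sum F b) F)\<^sup>2"
    and Z_power2: "Z\<^sup>2 = t\<^sup>2 * (pair_norm b)\<^sup>2"
    and X_Y: "X * Y = t\<^sup>2 * (L2_set a F * L2_set (row_sum F b) F)"
    and \<beta>_X_Z: "\<beta> * (X * Z) = t ^ 3 * (real p * (L2_set a F * pair_norm b))"
    and \<beta>_Y_Z: "\<beta> * (Y * Z) = t ^ 4 * (real p * (L2_set (row_sum F b) F * pair_norm b))"
proof -
  have "sqrt t * sqrt t = t"
    using t by simp
  then show "X\<^sup>2 = t * (L2_set a F)\<^sup>2" "Y\<^sup>2 = t ^ 3 * (L2_set (row_sum F b) F)\<^sup>2" "Z\<^sup>2 = t\<^sup>2 * (pair_norm b)\<^sup>2"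
    "X * Y = t\<^sup>2 * (L2_set a F * L2_set (row_sum F b) F)"
    "\<beta> * (X * Z) = t ^ 3 * (real p * (L2_set a F * pair_norm b))"
    "\<beta> * (Y * Z) = t ^ 4 * (real p * (L2_set (row_sum F b) F * pair_norm b))"
    by (simp_all add: X_def Y_def Z_def \<beta>_def eval_nat_numeral)
qed

private lemma rescaled_edge_form_ge: "2 * s\<^sup>2 - 4 * (\<alpha> * X\<^sup>2) \<le> 4 * t\<^sup>2 * kernel_form F F edge a a"
proof -
  have "2 * s\<^sup>2 - 4 * (\<alpha> * X\<^sup>2) = 4 * t\<^sup>2 * ((\<Sum>i\<in>F. a i)\<^sup>2 / 2 - sqrt (real p) * (L2_set a F)\<^sup>2)"
    unfolding X_power2 s_def \<alpha>_def by (simp add: power2_eq_square algebra_simps)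
  also have "\<dots> \<le> 4 * t\<^sup>2 * kernel_form F F edge a a"
    by (intro mult_left_mono edge_form_ge) simp
  finally show ?thesis .
qed

private lemma rescaled_incidence_form_ge: "- (8 * (X * Y)) \<le> 8 * t\<^sup>2 * (\<Sum>i\<in>F. a i * row_sum F b i)"
proof -
  have "- (8 * (X * Y)) = 8 * t\<^sup>2 * (- (L2_set a F * L2_set (row_sum F b) F))"
    unfolding X_Y by simp
  also have "\<dots> \<le> 8 * t\<^sup>2 * (\<Sum>i\<in>F. a i * row_sum F b i)"
    using abs_sum_mult_le_L2_set[of a "row_sum F b" F] by (intro mult_left_mono) auto
  finally show ?thesis .
qed

private lemma rescaled_edge_vertex_pair_form_ge:
  "32 * (s * B) - (64 * (\<alpha> * (X * Y)) + 288 * (\<beta> * (X * Z)))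
    \<le> 128 * t ^ 3 * vertex_pair_form F a b (\<lambda>i j k. edge i j * edge i k)"
proof -
  have "32 * (s * B) - (64 * (\<alpha> * (X * Y)) + 288 * (\<beta> * (X * Z)))
      = 128 * t ^ 3 * ((\<Sum>i\<in>F. a i) * (\<Sum>q\<in>F \<times> F. b q) / 4
        - (sqrt (real p) * (L2_set a F * L2_set (row_sum F b) F) / 2
          + 9 / 4 * (real p * (L2_set a F * pair_norm b))))"
    unfolding \<beta>_X_Z X_Y s_def B_def \<alpha>_def by (simp add: eval_nat_numeral algebra_simps)
  also have "\<dots> \<le> 128 * t ^ 3 * vertex_pair_form F a b (\<lambda>i j k. edge i j * edge i k)"
    using t by (intro mult_left_mono edge_vertex_pair_form_ge sym) simp
  finally show ?thesis .
qed

private lemma rescaled_edge_shared_vertex_form_ge: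
  "256 * Y\<^sup>2 - 512 * (\<alpha> * Z\<^sup>2) \<le> 512 * t ^ 3 * pair_form F b (\<lambda>i j k l. of_bool (i = k) * edge j l)"
proof -
  have "256 * Y\<^sup>2 - 512 * (\<alpha> * Z\<^sup>2)
      = 512 * t ^ 3 * ((L2_set (row_sum F b) F)\<^sup>2 / 2 - sqrt (real p) * (pair_norm b)\<^sup>2)"
    unfolding Y_power2 Z_power2 \<alpha>_def by (simp add: eval_nat_numeral algebra_simps)
  also have "\<dots> \<le> 512 * t ^ 3 * pair_form F b (\<lambda>i j k l. of_bool (i = k) * edge j l)"
    using t by (intro mult_left_mono edge_shared_vertex_form_ge) simp
  finally show ?thesis .
qed

private lemma rescaled_edge_pair_form_ge:
  "1024 * B\<^sup>2 - (4096 * (\<alpha> * Y\<^sup>2) + 4096 * (\<beta> * (Y * Z)) + 118784 * (\<gamma> * Z\<^sup>2))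
    \<le> 16384 * t ^ 4 * pair_form F b (\<lambda>i j k l. edge i k * edge i l * edge j k * edge j l)"
proof -
  have "1024 * B\<^sup>2 - (4096 * (\<alpha> * Y\<^sup>2) + 4096 * (\<beta> * (Y * Z)) + 118784 * (\<gamma> * Z\<^sup>2))
      = 16384 * t ^ 4 * ((\<Sum>q\<in>F \<times> F. b q)\<^sup>2 / 16 - (sqrt (real p) * (L2_set (row_sum F b) F)\<^sup>2 / 4
        + real p * (L2_set (row_sum F b) F * pair_norm b) / 4
        + 29 / 4 * (real p powr (5 / 4) * (pair_norm b)\<^sup>2)))"
    unfolding \<beta>_Y_Z Y_power2 Z_power2 B_def \<alpha>_def \<gamma>_def by (simp add: eval_nat_numeral algebra_simps)
  also have "\<dots> \<le> 16384 * t ^ 4 * pair_form F b (\<lambda>i j k l. edge i k * edge i l * edge j k * edge j l)"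
    using t by (intro mult_left_mono edge_pair_form_ge sym periodic diagonal) simp
  finally show ?thesis .
qed

lemma moment_form_nonneg:
  assumes small: "t * sqrt (real p) \<le> 1 / 20000" "t * sqrt t * real p \<le> 1 / 20000"
    "t\<^sup>2 * real p powr (5 / 4) \<le> 1 / 20000"
  shows "0 \<le> c\<^sup>2 + 2 * c * (t * (\<Sum>i\<in>F. a i)) + 2 * c * (4 * t\<^sup>2 * (\<Sum>q\<in>F \<times> F. b q))
    + (t * (L2_set a F)\<^sup>2 + 4 * t\<^sup>2 * kernel_form F F edge a a)
    + 2 * (8 * t\<^sup>2 * (\<Sum>i\<in>F. a i * row_sum F b i)
        + 128 * t ^ 3 * vertex_pair_form F a b (\<lambda>i j k. edge i j * edge i k))
    + (8 * t\<^sup>2 * (pair_norm b)\<^sup>2 + 512 * t ^ 3 * pair_form F b (\<lambda>i j k l. of_bool (i = k) * edge j l)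
        + 16384 * t ^ 4 * pair_form F b (\<lambda>i j k l. edge i k * edge i l * edge j k * edge j l))"
proof -
  have "0 \<le> (c + s + 4 * B)\<^sup>2 + (s + 28 * B)\<^sup>2 + 224 * B\<^sup>2"
    by simp
  also have "\<dots> = c\<^sup>2 + 2 * c * s + 2 * c * (4 * B) + 2 * s\<^sup>2 + 64 * (s * B) + 1024 * B\<^sup>2"
    by (simp add: power2_eq_square algebra_simps)
  finally have main_part: "0 \<le> \<dots>" .
  have "0 \<le> X" "0 \<le> Y" "0 \<le> Z"
    using t by (simp_all add: X_def Y_def Z_def)
  from rescaled_errors_le[OF this small[folded \<alpha>_def \<beta>_def \<gamma>_def]] main_part
  have "0 \<le> c\<^sup>2 + 2 * c * s + 2 * c * (4 * B) + (X\<^sup>2 + 4 * t\<^sup>2 * kernel_form F F edge a a)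
    + 2 * (8 * t\<^sup>2 * (\<Sum>i\<in>F. a i * row_sum F b i)
        + 128 * t ^ 3 * vertex_pair_form F a b (\<lambda>i j k. edge i j * edge i k))
    + (8 * Z\<^sup>2 + 512 * t ^ 3 * pair_form F b (\<lambda>i j k l. of_bool (i = k) * edge j l)
        + 16384 * t ^ 4 * pair_form F b (\<lambda>i j k l. edge i k * edge i l * edge j k * edge j l))"
    using rescaled_edge_form_ge rescaled_incidence_form_ge rescaled_edge_vertex_pair_form_ge
      rescaled_edge_shared_vertex_form_ge rescaled_edge_pair_form_ge by argo
  then show ?thesis
    unfolding X_power2 Z_power2 s_def B_def by (simp add: mult.assoc)
qed

end

end


section \<open>Pseudo-expectations\<close>

definition pseudo_expectation :: "('v set \<Rightarrow> real) \<Rightarrow> 'v mpoly \<Rightarrow> real" where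
  "pseudo_expectation \<Phi> f = (\<Sum>m\<in>Poly_Mapping.keys f. Poly_Mapping.lookup f m * \<Phi> (Poly_Mapping.keys m))"

lemma pseudo_expectation_superset:
  assumes "finite A" "Poly_Mapping.keys f \<subseteq> A"
  shows "pseudo_expectation \<Phi> f = (\<Sum>m\<in>A. Poly_Mapping.lookup f m * \<Phi> (Poly_Mapping.keys m))"
  unfolding pseudo_expectation_def using assms by (intro sum.mono_neutral_left) (auto simp: in_keys_iff)

lemma pseudo_expectation_add: "pseudo_expectation \<Phi> (f + g)
  = pseudo_expectation \<Phi> f + pseudo_expectation \<Phi> g"
proof -
  let ?A = "Poly_Mapping.keys f \<union> Poly_Mapping.keys g"
  have "pseudo_expectation \<Phi> (f + g) = (\<Sum>m\<in>?A. Poly_Mapping.lookup (f + g) m * \<Phi> (Poly_Mapping.keys m))"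
    by (intro pseudo_expectation_superset Poly_Mapping.keys_add) auto
  also have "\<dots> = (\<Sum>m\<in>?A. Poly_Mapping.lookup f m * \<Phi> (Poly_Mapping.keys m))
      + (\<Sum>m\<in>?A. Poly_Mapping.lookup g m * \<Phi> (Poly_Mapping.keys m))"
    by (simp add: lookup_add ring_distribs sum.distrib)
  also have "\<dots> = pseudo_expectation \<Phi> f + pseudo_expectation \<Phi> g"
    by (simp add: pseudo_expectation_superset[of ?A])
  finally show ?thesis .
qed

lemma pseudo_expectation_diff: "pseudo_expectation \<Phi> (f - g)
  = pseudo_expectation \<Phi> f - pseudo_expectation \<Phi> g"
  using pseudo_expectation_add[of \<Phi> "f - g" g] by simp

lemma pseudo_expectation_sum: "pseudo_expectation \<Phi> (\<Sum>x\<in>A. g x) = (\<Sum>x\<in>A. pseudo_expectation \<Phi> (g x))"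
  by (induction A rule: infinite_finite_induct)
    (auto simp: pseudo_expectation_add pseudo_expectation_def[of _ 0])

lemma pseudo_expectation_single: "pseudo_expectation \<Phi> (Poly_Mapping.single m r)
  = r * \<Phi> (Poly_Mapping.keys m)"
  by (simp add: pseudo_expectation_def)

lemma pseudo_expectation_mult:
  "pseudo_expectation \<Phi> (f * g) = pseudo_expectation (\<lambda>K. pseudo_expectation (\<lambda>L. \<Phi> (K \<union> L)) g) f"
proof -
  let ?s = "\<lambda>h m. Poly_Mapping.single m (Poly_Mapping.lookup h m)"
  have "f * g = (\<Sum>m\<in>Poly_Mapping.keys f. ?s f m) * (\<Sum>n\<in>Poly_Mapping.keys g. ?s g n)"
    by (simp only: poly_as_sum[symmetric])
  also have "\<dots> = (\<Sum>m\<in>Poly_Mapping.keys f. \<Sum>n\<in>Poly_Mapping.keys g.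
      Poly_Mapping.single (m + n) (Poly_Mapping.lookup f m * Poly_Mapping.lookup g n))"
    by (simp add: sum_product mult_single)
  finally have "pseudo_expectation \<Phi> (f * g) = (\<Sum>m\<in>Poly_Mapping.keys f. \<Sum>n\<in>Poly_Mapping.keys g.
      Poly_Mapping.lookup f m * Poly_Mapping.lookup g n * \<Phi> (Poly_Mapping.keys m \<union> Poly_Mapping.keys n))"
    by (simp add: pseudo_expectation_sum pseudo_expectation_single keys_add_nat)
  then show ?thesis
    by (simp add: pseudo_expectation_def sum_distrib_left mult_ac)
qed

lemma pseudo_expectation_const_mult: "pseudo_expectation \<Phi> (const_poly c * f)
  = c * pseudo_expectation \<Phi> f"
  by (simp add: pseudo_expectation_mult const_poly_def pseudo_expectation_single)

lemma pseudo_expectation_1: "pseudo_expectation \<Phi> 1 = \<Phi> {}"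
  using pseudo_expectation_single[of \<Phi> 0 1] by simp

lemma pseudo_expectation_var: "pseudo_expectation \<Phi> (var_poly i) = \<Phi> {i}"
  by (simp add: var_poly_def pseudo_expectation_single)

lemma pseudo_expectation_var_mult:
  "pseudo_expectation \<Phi> (var_poly i * f) = pseudo_expectation (\<lambda>K. \<Phi> (insert i K)) f"
  by (simp add: pseudo_expectation_mult var_poly_def pseudo_expectation_single)

lemma pseudo_expectation_boolean: "pseudo_expectation \<Phi> ((var_poly i ^ 2 - var_poly i) * q) = 0"
  by (simp add: left_diff_distrib pseudo_expectation_diff power2_eq_square mult.assoc
    pseudo_expectation_var_mult)

lemma sum_pseudo_expectation:
    "(\<Sum>x\<in>A. pseudo_expectation (\<Phi> x) f) = pseudo_expectation (\<lambda>K. \<Sum>x\<in>A. \<Phi> x K) f"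
  unfolding pseudo_expectation_def sum_distrib_left by (rule sum.swap)

lemma add_pseudo_expectation:
    "pseudo_expectation \<Phi> f + pseudo_expectation \<Psi> f = pseudo_expectation (\<lambda>K. \<Phi> K + \<Psi> K) f"
  and mult_pseudo_expectation: "r * pseudo_expectation \<Phi> f = pseudo_expectation (\<lambda>K. r * \<Phi> K) f"
  by (simp_all add: pseudo_expectation_def ring_distribs sum.distrib sum_distrib_left mult_ac)

text \<open>Each functional \<open>\<lambda>L. \<Phi> (K \<union> L)\<close> sees \<open>q\<close> as \<open>c + \<Sum> a i x i + \<Sum> b i j x i x j\<close>.\<close>

lemma pseudo_expectation_square:
  assumes expectation_q: "\<And>K. pseudo_expectation (\<lambda>L. \<Phi> (K \<union> L)) q
    = c * \<Phi> K + (\<Sum>i\<in>V. a i * \<Phi> (K \<union> {i})) + (\<Sum>r\<in>V \<times> V. b r * \<Phi> (K \<union> {fst r, snd r}))"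
  shows "pseudo_expectation \<Phi> (q * q) = c\<^sup>2 * \<Phi> {} + 2 * c * (\<Sum>i\<in>V. a i * \<Phi> {i})
    + 2 * c * (\<Sum>r\<in>V \<times> V. b r * \<Phi> {fst r, snd r}) + kernel_form V V (\<lambda>i j. \<Phi> {i, j}) a a
    + 2 * vertex_pair_form V a b (\<lambda>i j k. \<Phi> {i, j, k}) + pair_form V b (\<lambda>i j k l. \<Phi> {i, j, k, l})"
proof -
  define E where "E K = pseudo_expectation (\<lambda>L. \<Phi> (K \<union> L)) q" for K
  have "pseudo_expectation \<Phi> (q * q) = pseudo_expectation (\<lambda>L. c * \<Phi> ({} \<union> L) + (\<Sum>i\<in>V. a i * \<Phi> ({i} \<union> L))
      + (\<Sum>r\<in>V \<times> V. b r * \<Phi> ({fst r, snd r} \<union> L))) q"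
    by (simp add: pseudo_expectation_mult expectation_q Un_commute)
  also have "\<dots> = c * E {} + (\<Sum>i\<in>V. a i * E {i}) + (\<Sum>r\<in>V \<times> V. b r * E {fst r, snd r})"
    unfolding E_def by (simp only: mult_pseudo_expectation sum_pseudo_expectation add_pseudo_expectation)
  also have "c * E {} = c\<^sup>2 * \<Phi> {} + c * (\<Sum>i\<in>V. a i * \<Phi> {i}) + c * (\<Sum>r\<in>V \<times> V. b r * \<Phi> {fst r, snd r})"
    unfolding E_def expectation_q by (simp add: power2_eq_square ring_distribs)
  also have "(\<Sum>i\<in>V. a i * E {i}) = c * (\<Sum>i\<in>V. a i * \<Phi> {i}) + kernel_form V V (\<lambda>i j. \<Phi> {i, j}) a a
      + vertex_pair_form V a b (\<lambda>i j k. \<Phi> {i, j, k})"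
    unfolding E_def expectation_q kernel_form_def vertex_pair_form_def
    by (simp add: ring_distribs sum.distrib sum_distrib_left mult_ac insert_commute)
  also have "(\<Sum>r\<in>V \<times> V. b r * E {fst r, snd r}) = c * (\<Sum>r\<in>V \<times> V. b r * \<Phi> {fst r, snd r})
      + vertex_pair_form V a b (\<lambda>i j k. \<Phi> {i, j, k}) + pair_form V b (\<lambda>i j k l. \<Phi> {i, j, k, l})"
  proof -
    have "vertex_pair_form V a b (\<lambda>i j k. \<Phi> {i, j, k})
        = (\<Sum>r\<in>V \<times> V. \<Sum>i\<in>V. b r * (a i * \<Phi> ({fst r, snd r} \<union> {i})))"
      unfolding vertex_pair_form_def
      by (subst kernel_form_transpose, unfold kernel_form_def, intro sum.cong refl)
        (simp add: insert_commute mult_ac)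
    then show ?thesis
      unfolding E_def expectation_q pair_form_def kernel_form_def
      by (simp add: ring_distribs sum.distrib sum_distrib_left mult_ac insert_commute)
  qed
  finally show ?thesis
    by simp
qed


subsection \<open>Coefficients of multilinear quadratic polynomials\<close>

definition set_coeff :: "'v mpoly \<Rightarrow> 'v set \<Rightarrow> real" where
  "set_coeff f K = (\<Sum>m | m \<in> Poly_Mapping.keys f \<and> Poly_Mapping.keys m = K. Poly_Mapping.lookup f m)"

lemma pseudo_expectation_set_coeff:
  assumes "finite S" "\<And>m. m \<in> Poly_Mapping.keys f \<Longrightarrow> Poly_Mapping.keys m \<in> S"
  shows "pseudo_expectation \<Phi> f = (\<Sum>K\<in>S. set_coeff f K * \<Phi> K)"
proof -
  have "pseudo_expectation \<Phi> f = (\<Sum>K\<in>S. \<Sum>m | m \<in> Poly_Mapping.keys f \<and> Poly_Mapping.keys m = K.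
      Poly_Mapping.lookup f m * \<Phi> (Poly_Mapping.keys m))"
    unfolding pseudo_expectation_def using assms by (intro sum.group[symmetric]) auto
  then show ?thesis
    by (simp add: set_coeff_def sum_distrib_right)
qed

lemma card_keys_le_mon_degree: "card (Poly_Mapping.keys m) \<le> mon_degree m"
proof -
  have "card (Poly_Mapping.keys m) = (\<Sum>i\<in>Poly_Mapping.keys m. 1)"
    by simp
  also have "\<dots> \<le> mon_degree m"
    unfolding mon_degree_def by (intro sum_mono) (auto simp: in_keys_iff Suc_le_eq)
  finally show ?thesis .
qed

lemma sum_card_eq_2:
  fixes g :: "'a set \<Rightarrow> real"
  assumes finite_V: "finite V"
  shows "(\<Sum>K | K \<subseteq> V \<and> card K = 2. g K) = (\<Sum>(i, j)\<in>V \<times> V. of_bool (i \<noteq> j) * g {i, j} / 2)"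
proof -
  let ?D = "{q \<in> V \<times> V. fst q \<noteq> snd q}" and ?e = "\<lambda>q. {fst q, snd q}"
  have fibre: "(\<Sum>q | q \<in> ?D \<and> ?e q = K. g (?e q) / 2) = g K" if K: "K \<subseteq> V" "card K = 2" for K
  proof -
    obtain i j where ij: "K = {i, j}" "i \<noteq> j"
      using K(2) by (auto simp: card_2_iff)
    then have "{q. q \<in> ?D \<and> ?e q = K} = {(i, j), (j, i)}"
      using K(1) by (auto simp: doubleton_eq_iff)
    then show ?thesis
      using ij by (simp add: insert_commute)
  qed
  have "(\<Sum>(i, j)\<in>V \<times> V. of_bool (i \<noteq> j) * g {i, j} / 2) = (\<Sum>q\<in>?D. g (?e q) / 2)"
    using finite_V by (intro sum.mono_neutral_cong_right) auto
  also have "\<dots> = (\<Sum>K | K \<subseteq> V \<and> card K = 2. \<Sum>q | q \<in> ?D \<and> ?e q = K. g (?e q) / 2)"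
    using finite_V by (intro sum.group[symmetric]) auto
  also have "\<dots> = (\<Sum>K | K \<subseteq> V \<and> card K = 2. g K)"
    by (intro sum.cong refl fibre) auto
  finally show ?thesis ..
qed

lemma pseudo_expectation_quadratic:
  assumes finite_V: "finite V" and degree_f: "f \<in> polys_upto V 2"
  shows "pseudo_expectation \<Phi> f = set_coeff f {} * \<Phi> {} + (\<Sum>i\<in>V. set_coeff f {i} * \<Phi> {i})
    + (\<Sum>(i, j)\<in>V \<times> V. of_bool (i \<noteq> j) * (set_coeff f {i, j} * \<Phi> {i, j}) / 2)"
proof -
  let ?g = "\<lambda>K. set_coeff f K * \<Phi> K" and ?S = "\<lambda>n. {K. K \<subseteq> V \<and> card K = n}"
  have finite_S: "finite (?S n)" for n
    using finite_V by simp
  have "Poly_Mapping.keys m \<in> ?S 0 \<union> ?S 1 \<union> ?S 2" if "m \<in> Poly_Mapping.keys f" for m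
  proof -
    have "Poly_Mapping.keys m \<subseteq> V" "mon_degree m \<le> 2"
      using degree_f that by (auto simp: polys_upto_def)
    moreover from this card_keys_le_mon_degree[of m]
    have "card (Poly_Mapping.keys m) = 0 \<or> card (Poly_Mapping.keys m) = 1
        \<or> card (Poly_Mapping.keys m) = 2"
      by linarith
    ultimately show ?thesis
      by blast
  qed
  then have "pseudo_expectation \<Phi> f = sum ?g (?S 0 \<union> ?S 1 \<union> ?S 2)"
    using finite_S by (intro pseudo_expectation_set_coeff) blast+
  also have "\<dots> = sum ?g (?S 0) + sum ?g (?S 1) + sum ?g (?S 2)"
    using finite_S by (subst sum.union_disjoint, simp, simp, force, subst sum.union_disjoint) auto
  also have "?S 0 = {{}}"
    using finite_V by (auto dest: finite_subset)
  also have "?S 1 = (\<lambda>i. {i}) ` V"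
    by (auto simp: card_1_singleton_iff)
  also have "sum ?g ((\<lambda>i. {i}) ` V) = (\<Sum>i\<in>V. ?g {i})"
    by (simp add: sum.reindex)
  also have "sum ?g (?S 2) = (\<Sum>(i, j)\<in>V \<times> V. of_bool (i \<noteq> j) * ?g {i, j} / 2)"
    by (rule sum_card_eq_2[OF finite_V])
  finally show ?thesis
    by simp
qed


section \<open>The moments of the Paley graph\<close>

context paley
begin

definition clique :: "int set \<Rightarrow> bool" where
  "clique K \<longleftrightarrow> (\<forall>x\<in>K. \<forall>y\<in>K. x \<noteq> y \<longrightarrow> chi (x - y) = 1)"

text \<open>The natural values 1, t, 2t^2, 8t^3, 64t^4 (as for independent vertices of a random graph) make
  the main part of the moment form only semidefinite; the larger constants leave room for the errors.\<close>

definition moment :: "real \<Rightarrow> int set \<Rightarrow> real" where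
  "moment t K = (if clique K then [1, t, 4 * t\<^sup>2, 128 * t ^ 3, 16384 * t ^ 4] ! card K else 0)"

lemma moment_0: "moment t {} = 1"
  by (simp add: moment_def clique_def)

lemma moment_1: "moment t {i} = t"
  by (simp add: moment_def clique_def)

lemma moment_2: "moment t {i, j} = t * of_bool (i = j) + 4 * t\<^sup>2 * edge i j"
  by (cases "i = j") (auto simp: moment_def clique_def edge_def numeral_2_eq_2 chi_commute[of j i])

lemma moment_3:
  assumes jk: "chi (j - k) = 1"
  shows "moment t {i, j, k} = 4 * t\<^sup>2 * (of_bool (i = j) + of_bool (i = k))
    + 128 * t ^ 3 * (edge i j * edge i k)"
proof -
  have "j \<noteq> k"
    using jk by auto
  show ?thesis
  proof (cases "i = j \<or> i = k")
    case True
    then have "{i, j, k} = {j, k}"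
      by auto
    then show ?thesis
      using True \<open>j \<noteq> k\<close> jk by (auto simp: moment_2 edge_def)
  next
    case False
    then have "card {i, j, k} = 3"
      using \<open>j \<noteq> k\<close> by simp
    moreover have "clique {i, j, k} \<longleftrightarrow> chi (i - j) = 1 \<and> chi (i - k) = 1"
      using False \<open>j \<noteq> k\<close> jk
      by (auto simp: clique_def chi_commute[of j i] chi_commute[of k i] chi_commute[of k j])
    ultimately show ?thesis
      using False by (simp add: moment_def edge_def)
  qed
qed

lemma moment_4_coincident:
  assumes "chi (i - j) = 1" "chi (k - l) = 1" "i = k"
  shows "moment t {i, j, k, l} = 4 * t\<^sup>2 * (of_bool (i = k \<and> j = l) + of_bool (i = l \<and> j = k))
    + 128 * t ^ 3 * (of_bool (i = k) * edge j l + of_bool (i = l) * edge j k + of_bool (j = k) * edge i l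
      + of_bool (j = l) * edge i k)
    + 16384 * t ^ 4 * (edge i k * edge i l * edge j k * edge j l)"
proof -
  have "{i, j, k, l} = {l, k, j}"
    using assms(3) by auto
  then have "moment t {i, j, k, l}
      = 4 * t\<^sup>2 * (of_bool (l = k) + of_bool (l = j)) + 128 * t ^ 3 * (edge l k * edge l j)"
    using assms by (simp add: moment_3)
  moreover have "edge l k = 1" "j \<noteq> k" "k \<noteq> l"
    using assms by (auto simp: edge_def chi_commute[of l k])
  ultimately show ?thesis
    using assms(3) by (auto simp: edge_commute[of l j])
qed

lemma moment_4_disjoint:
  assumes ij: "chi (i - j) = 1" and kl: "chi (k - l) = 1"
    and disjoint: "i \<noteq> k" "j \<noteq> k" "i \<noteq> l" "j \<noteq> l"
  shows "moment t {i, j, k, l} = 16384 * t ^ 4 * (edge i k * edge i l * edge j k * edge j l)"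
proof -
  have ji: "chi (j - i) = 1" and lk: "chi (l - k) = 1"
    using assms by (simp_all add: chi_commute[of j i] chi_commute[of l k])
  have "i \<noteq> j" "k \<noteq> l"
    using ij kl by auto
  then have "card {i, j, k, l} = 4"
    using disjoint by simp
  moreover have "clique {i, j, k, l} \<longleftrightarrow> chi (i - k) = 1 \<and> chi (i - l) = 1
      \<and> chi (j - k) = 1 \<and> chi (j - l) = 1"
    using disjoint \<open>i \<noteq> j\<close> \<open>k \<noteq> l\<close> ij ji kl lk
    by (auto simp: clique_def chi_commute[of k i] chi_commute[of l i] chi_commute[of k j]
      chi_commute[of l j])
  ultimately show ?thesis
    by (simp add: moment_def edge_def)
qed

lemma moment_4:
  assumes ij: "chi (i - j) = 1" and kl: "chi (k - l) = 1"
  shows "moment t {i, j, k, l} = 4 * t\<^sup>2 * (of_bool (i = k \<and> j = l) + of_bool (i = l \<and> j = k))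
    + 128 * t ^ 3 * (of_bool (i = k) * edge j l + of_bool (i = l) * edge j k + of_bool (j = k) * edge i l
      + of_bool (j = l) * edge i k)
    + 16384 * t ^ 4 * (edge i k * edge i l * edge j k * edge j l)"
proof -
  have ji: "chi (j - i) = 1" and lk: "chi (l - k) = 1"
    using assms by (simp_all add: chi_commute[of j i] chi_commute[of l k])
  consider (ik) "i = k" | (jk) "j = k" | (il) "i = l" | (jl) "j = l"
    | (disjoint) "i \<noteq> k" "j \<noteq> k" "i \<noteq> l" "j \<noteq> l"
    by blast
  then show ?thesis
  proof cases
    case ik
    then show ?thesis
      by (rule moment_4_coincident[OF ij kl])
  next
    case jk
    from moment_4_coincident[OF ji kl this, of t] show ?thesis
      by (simp add: insert_commute add_ac mult_ac conj_commute)
  next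
    case il
    from moment_4_coincident[OF ij lk this, of t] show ?thesis
      by (simp add: insert_commute add_ac mult_ac conj_commute)
  next
    case jl
    from moment_4_coincident[OF ji lk this, of t] show ?thesis
      by (simp add: insert_commute add_ac mult_ac conj_commute)
  next
    case disjoint
    then show ?thesis
      by (simp add: moment_4_disjoint[OF ij kl])
  qed
qed

lemma moment_nonadjacent: "x \<in> K \<Longrightarrow> y \<in> K \<Longrightarrow> x \<noteq> y \<Longrightarrow> chi (x - y) \<noteq> 1 \<Longrightarrow> moment t K = 0"
  by (auto simp: moment_def clique_def)

lemma moment_vertex_pair_form:
  assumes sym: "swap_invariant b" and edges: "\<And>x y. b (x, y) \<noteq> 0 \<Longrightarrow> chi (x - y) = 1"
  shows "vertex_pair_form F a b (\<lambda>i j k. moment t {i, j, k}) = 8 * t\<^sup>2 * (\<Sum>i\<in>F. a i * row_sum F b i)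
    + 128 * t ^ 3 * vertex_pair_form F a b (\<lambda>i j k. edge i j * edge i k)"
proof -
  let ?V = "vertex_pair_form F a b"
  have "?V (\<lambda>i j k. moment t {i, j, k})
      = ?V (\<lambda>i j k. 4 * t\<^sup>2 * (of_bool (i = j) + of_bool (i = k)) + 128 * t ^ 3 * (edge i j * edge i k))"
    by (intro vertex_pair_form_cong moment_3 edges)
  also have "\<dots> = 4 * t\<^sup>2 * (?V (\<lambda>i j k. of_bool (i = j)) + ?V (\<lambda>i j k. of_bool (i = k)))
      + 128 * t ^ 3 * ?V (\<lambda>i j k. edge i j * edge i k)"
    by (simp only: vertex_pair_form_add vertex_pair_form_mult)
  also have "?V (\<lambda>i j k. of_bool (i = k)) = ?V (\<lambda>i j k. of_bool (i = j))"
    by (rule vertex_pair_form_swap[OF sym])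
  finally show ?thesis
    by (simp add: vertex_pair_form_row_sum kernel_form_diagonal)
qed

lemma moment_pair_form:
  assumes sym: "swap_invariant b" and edges: "\<And>x y. b (x, y) \<noteq> 0 \<Longrightarrow> chi (x - y) = 1"
  shows "pair_form F b (\<lambda>i j k l. moment t {i, j, k, l}) = 8 * t\<^sup>2 * (pair_norm b)\<^sup>2
    + 512 * t ^ 3 * pair_form F b (\<lambda>i j k l. of_bool (i = k) * edge j l)
    + 16384 * t ^ 4 * pair_form F b (\<lambda>i j k l. edge i k * edge i l * edge j k * edge j l)"
proof -
  let ?Q = "pair_form F b"
  note left = pair_form_swap_left[OF sym] and right = pair_form_swap_right[OF sym]
  have "?Q (\<lambda>i j k l. moment t {i, j, k, l})
      = ?Q (\<lambda>i j k l. 4 * t\<^sup>2 * (of_bool (i = k \<and> j = l) + of_bool (i = l \<and> j = k))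
        + 128 * t ^ 3 * (of_bool (i = k) * edge j l + of_bool (i = l) * edge j k
          + of_bool (j = k) * edge i l
          + of_bool (j = l) * edge i k)
        + 16384 * t ^ 4 * (edge i k * edge i l * edge j k * edge j l))"
    by (intro pair_form_cong moment_4 edges)
  also have "\<dots> = 4 * t\<^sup>2 * (?Q (\<lambda>i j k l. of_bool (i = k \<and> j = l))
        + ?Q (\<lambda>i j k l. of_bool (i = l \<and> j = k)))
      + 128 * t ^ 3 * (?Q (\<lambda>i j k l. of_bool (i = k) * edge j l)
        + ?Q (\<lambda>i j k l. of_bool (i = l) * edge j k)
        + ?Q (\<lambda>i j k l. of_bool (j = k) * edge i l) + ?Q (\<lambda>i j k l. of_bool (j = l) * edge i k))
      + 16384 * t ^ 4 * ?Q (\<lambda>i j k l. edge i k * edge i l * edge j k * edge j l)"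
    by (simp only: pair_form_add pair_form_mult)
  also have "?Q (\<lambda>i j k l. of_bool (i = l \<and> j = k)) = ?Q (\<lambda>i j k l. of_bool (i = k \<and> j = l))"
    by (rule right)
  also have "?Q (\<lambda>i j k l. of_bool (i = l) * edge j k) = ?Q (\<lambda>i j k l. of_bool (i = k) * edge j l)"
    by (rule right)
  also have "?Q (\<lambda>i j k l. of_bool (j = k) * edge i l) = ?Q (\<lambda>i j k l. of_bool (i = k) * edge j l)"
    by (rule left)
  also have "?Q (\<lambda>i j k l. of_bool (j = l) * edge i k) = ?Q (\<lambda>i j k l. of_bool (i = k) * edge j l)"
    by (rule trans[OF left right])
  also have "?Q (\<lambda>i j k l. of_bool (i = k \<and> j = l)) = (pair_norm b)\<^sup>2"
    by (simp add: pair_form_def kernel_form_diagonal L2_set_mult_self L2_set_power2 power2_eq_square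
      flip: prod_eq_iff)
  finally show ?thesis
    by simp
qed

text \<open>Pairs outside the edge set may be dropped since their moments vanish.\<close>

definition edge_coeff :: "int mpoly \<Rightarrow> int \<times> int \<Rightarrow> real" where
  "edge_coeff f = (\<lambda>(x, y). if chi (x - y) = 1 then set_coeff f {x mod P, y mod P} / 2 else 0)"

lemma edge_coeff_nonzero: "edge_coeff f (x, y) \<noteq> 0 \<Longrightarrow> chi (x - y) = 1"
  by (simp add: edge_coeff_def split: if_splits)

lemma swap_invariant_edge_coeff: "swap_invariant (edge_coeff f)"
  by (auto simp: swap_invariant_def edge_coeff_def chi_commute insert_commute)

lemma periodic2_edge_coeff: "periodic2 (edge_coeff f)"
proof (rule periodic2I)
  fix x x' y y' assume "[x = x'] (mod P)" "[y = y'] (mod P)"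
  moreover from this have "chi (x - y) = chi (x' - y')"
    by (intro chi_cong cong_diff)
  ultimately show "edge_coeff f (x, y) = edge_coeff f (x', y')"
    by (simp add: edge_coeff_def cong_def)
qed

lemma pseudo_expectation_edge_coeff:
  assumes "f \<in> polys_upto F 2"
  shows "pseudo_expectation (\<lambda>L. moment t (K \<union> L)) f
    = set_coeff f {} * moment t K + (\<Sum>i\<in>F. set_coeff f {i} * moment t (K \<union> {i}))
      + (\<Sum>r\<in>F \<times> F. edge_coeff f r * moment t (K \<union> {fst r, snd r}))"
proof -
  have "of_bool (i \<noteq> j) * (set_coeff f {i, j} * moment t (K \<union> {i, j})) / 2
      = edge_coeff f (i, j) * moment t (K \<union> {i, j})"
    if "i \<in> F" "j \<in> F" for i j
    using that moment_nonadjacent[of i "K \<union> {i, j}" j t] by (auto simp: edge_coeff_def)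
  then have "(\<Sum>(i, j)\<in>F \<times> F. of_bool (i \<noteq> j) * (set_coeff f {i, j} * moment t (K \<union> {i, j})) / 2)
      = (\<Sum>r\<in>F \<times> F. edge_coeff f r * moment t (K \<union> {fst r, snd r}))"
    by (intro sum.cong refl) auto
  then show ?thesis
    using pseudo_expectation_quadratic[OF _ assms, of "\<lambda>L. moment t (K \<union> L)"] by simp
qed

lemma pseudo_expectation_moment_square_nonneg:
  assumes degree_f: "f \<in> polys_upto F 2"
    and t_pos: "0 < t" and small: "t * sqrt (real p) \<le> 1 / 20000" "t * sqrt t * real p \<le> 1 / 20000"
      "t\<^sup>2 * real p powr (5 / 4) \<le> 1 / 20000"
  shows "0 \<le> pseudo_expectation (moment t) (f ^ 2)"
proof -
  let ?c = "set_coeff f {}" and ?a = "\<lambda>i. set_coeff f {i}" and ?b = "edge_coeff f"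
  have pair: "?b r * moment t {fst r, snd r} = 4 * t\<^sup>2 * ?b r" for r
    using edge_coeff_nonzero[of f "fst r" "snd r"] by (cases "?b r = 0") (auto simp: moment_2 edge_def)
  have pairs: "(\<Sum>r\<in>F \<times> F. ?b r * moment t {fst r, snd r}) = 4 * t\<^sup>2 * (\<Sum>r\<in>F \<times> F. ?b r)"
    unfolding sum_distrib_left by (intro sum.cong refl pair)
  have vertices: "kernel_form F F (\<lambda>i j. moment t {i, j}) ?a ?a
      = t * (L2_set ?a F)\<^sup>2 + 4 * t\<^sup>2 * kernel_form F F edge ?a ?a"
    by (simp add: moment_2 kernel_form_add kernel_form_mult kernel_form_diagonal L2_set_mult_self
      power2_eq_square)
  have vertex_pairs: "vertex_pair_form F ?a ?b (\<lambda>i j k. moment t {i, j, k})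
      = 8 * t\<^sup>2 * (\<Sum>i\<in>F. ?a i * row_sum F ?b i)
      + 128 * t ^ 3 * vertex_pair_form F ?a ?b (\<lambda>i j k. edge i j * edge i k)"
    by (rule moment_vertex_pair_form[OF swap_invariant_edge_coeff edge_coeff_nonzero])
  have pair_pairs: "pair_form F ?b (\<lambda>i j k l. moment t {i, j, k, l}) = 8 * t\<^sup>2 * (pair_norm ?b)\<^sup>2
      + 512 * t ^ 3 * pair_form F ?b (\<lambda>i j k l. of_bool (i = k) * edge j l)
      + 16384 * t ^ 4 * pair_form F ?b (\<lambda>i j k l. edge i k * edge i l * edge j k * edge j l)"
    by (rule moment_pair_form[OF swap_invariant_edge_coeff edge_coeff_nonzero])
  have singletons: "(\<Sum>i\<in>F. ?a i * moment t {i}) = t * (\<Sum>i\<in>F. ?a i)"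
    by (simp add: moment_1 sum_distrib_left mult.commute)
  have "pseudo_expectation (moment t) (f ^ 2)
      = ?c\<^sup>2 + 2 * ?c * (t * (\<Sum>i\<in>F. ?a i)) + 2 * ?c * (4 * t\<^sup>2 * (\<Sum>r\<in>F \<times> F. ?b r))
        + (t * (L2_set ?a F)\<^sup>2 + 4 * t\<^sup>2 * kernel_form F F edge ?a ?a)
        + 2 * (8 * t\<^sup>2 * (\<Sum>i\<in>F. ?a i * row_sum F ?b i)
          + 128 * t ^ 3 * vertex_pair_form F ?a ?b (\<lambda>i j k. edge i j * edge i k))
        + (8 * t\<^sup>2 * (pair_norm ?b)\<^sup>2 + 512 * t ^ 3 * pair_form F ?b (\<lambda>i j k l. of_bool (i = k) * edge j l)
          + 16384 * t ^ 4 * pair_form F ?b (\<lambda>i j k l. edge i k * edge i l * edge j k * edge j l))"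
    unfolding power2_eq_square[of f]
      pseudo_expectation_square[OF pseudo_expectation_edge_coeff[OF degree_f]]
      pairs vertices vertex_pairs pair_pairs singletons moment_0 by simp
  also have "0 \<le> \<dots>"
    by (rule moment_form_nonneg[OF swap_invariant_edge_coeff periodic2_edge_coeff _ t_pos small])
      (simp add: edge_coeff_def)
  finally show ?thesis .
qed

lemma paley_adj_iff: "paley_adj p i j \<longleftrightarrow> chi (i - j) = 1"
  by (auto simp: paley_adj_def chi_def Legendre_def)

lemma sos4_feasible_moment:
  assumes "0 < t" "t * sqrt (real p) \<le> 1 / 20000" "t * sqrt t * real p \<le> 1 / 20000"
    "t\<^sup>2 * real p powr (5 / 4) \<le> 1 / 20000"
  shows "sos4_feasible F (paley_adj p) (pseudo_expectation (moment t))"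
  unfolding sos4_feasible_def linear_functional_upto_def
proof (intro conjI ballI allI impI)
  show "pseudo_expectation (moment t) 1 = 1"
    by (simp add: pseudo_expectation_1 moment_0)
next
  fix i j :: int and q :: "int mpoly" assume "i \<noteq> j \<and> \<not> paley_adj p i j"
  then have "moment t (insert i (insert j K)) = 0" for K
    using moment_nonadjacent[of i _ j] by (simp add: paley_adj_iff)
  then show "pseudo_expectation (moment t) (var_poly i * var_poly j * q) = 0"
    by (simp add: mult.assoc pseudo_expectation_var_mult) (simp add: pseudo_expectation_def)
next
  fix q :: "int mpoly" assume "q \<in> polys_upto F 2"
  then show "0 \<le> pseudo_expectation (moment t) (q ^ 2)"
    using assms by (rule pseudo_expectation_moment_square_nonneg)
qed (simp_all add: pseudo_expectation_add pseudo_expectation_const_mult pseudo_expectation_boolean)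

lemma SOS4_paley_ge:
  assumes "0 < t" "t * sqrt (real p) \<le> 1 / 20000" "t * sqrt t * real p \<le> 1 / 20000"
    "t\<^sup>2 * real p powr (5 / 4) \<le> 1 / 20000"
  shows "real p * t \<le> SOS4 (paley_vertices p) (paley_adj p)"
proof -
  obtain E :: "int mpoly \<Rightarrow> real"
    where "\<And>E'. sos4_feasible F (paley_adj p) E' \<Longrightarrow> (\<Sum>i\<in>F. E' (var_poly i)) \<le> SOS4 F (paley_adj p)"
    using SOS4_is_maximum[of F "paley_adj p"] by blast
  from this[OF sos4_feasible_moment[OF assms]] show ?thesis
    by (simp add: paley_vertices_def pseudo_expectation_var moment_1)
qed

lemma SOS4_paley_ge_cube_root: "1 / 22500 * real p powr (1 / 3) \<le> SOS4 (paley_vertices p) (paley_adj p)"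
proof -
  define t where "t = real p powr (- 2 / 3) / 22500"
  have real_p: "0 < real p" "1 \<le> real p"
    using p_pos by auto
  have le_1: "real p powr e \<le> 1" if "e \<le> 0" for e
    using powr_mono[OF that real_p(2)] real_p(1) by simp
  have "t = (real p powr (- 1 / 3) / 150)\<^sup>2"
    by (simp add: t_def power2_eq_square flip: powr_add)
  then have sqrt_t: "sqrt t = real p powr (- 1 / 3) / 150"
    by simp
  have "t * sqrt (real p) = real p powr (- 1 / 6) / 22500"
    by (simp add: t_def flip: powr_half_sqrt powr_add)
  moreover have "t * sqrt t * real p
      = (real p powr (- 2 / 3) * real p powr (- 1 / 3) * real p powr 1) / 3375000"
    unfolding sqrt_t by (simp add: t_def)
  then have "t * sqrt t * real p = 1 / 3375000"
    using real_p(1) by (simp flip: powr_add)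
  moreover have "t\<^sup>2 * real p powr (5 / 4) = real p powr (- 1 / 12) / 506250000"
    by (simp add: t_def power2_eq_square mult.assoc flip: powr_add)
  moreover have "real p * t = 1 / 22500 * real p powr (1 / 3)"
    using real_p(1) by (simp add: t_def powr_mult_base)
  ultimately show ?thesis
    using SOS4_paley_ge[of t] le_1[of "- 1 / 6"] le_1[of "- 1 / 12"] real_p by (simp add: t_def)
qed

end

theorem theorem1p1:
  shows "\<exists>c::real. c > 0 \<and>
    (\<forall>p::nat. prime p \<and> [p = 1] (mod 4) \<longrightarrow>
       SOS4 (paley_vertices p) (paley_adj p) \<ge> c * real p powr (1 / 3))"
proof (intro exI[of _ "1 / 22500 :: real"] conjI allI impI)
  fix p :: nat assume "prime p \<and> [p = 1] (mod 4)"
  then interpret paley p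
    by unfold_locales auto
  show "1 / 22500 * real p powr (1 / 3) \<le> SOS4 (paley_vertices p) (paley_adj p)"
    by (rule SOS4_paley_ge_cube_root)
qed simp

end
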